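(* Let $(\mathcal{X},\mathcal{F},m)$ be a probability space with $\mathcal{X}$ Polish and pre-compact, and let $(\mathcal{E},\mathbb{D})$ be a conservative, local (diffusion type) Dirichlet form on $L^2(\mathcal{X};m)$ with associated Markov process $(X_t)$ with continuous paths, realized on $\Omega=\mathcal{C}([0,1],\mathcal{X})$, $X_t(\omega)=\omega(t)$, with law $\mathbb{P}$ (initial distribution $m$). For $s>0$ let $\mathbb{P}^s$ be the law of the time-scaled process $X^s_t=X_{st}$, $t\in[0,1]$. Let $\Delta=\{0=t_0<\dots<t_n=1\}$ be a partition of $[0,1]$, $A_0,\dots,A_n$ measurable subsets of $\mathcal{X}$ and $\mathcal{A}_\Delta=\{\gamma\in\mathcal{C}([0,1],\mathcal{X}):\gamma(t_i)\in A_i,\ i=0,\dots,n\}$. Then $$\limsup_{s\to0}\, s\log\mathbb{P}^s(X_\cdot\in\mathcal{A}_\Delta)\le-\inf_{\gamma\in\mathcal{A}_\Delta}H_\Delta(\gamma).$$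
   Context: $\mathbb{D}_b=\mathbb{D}\cap L^\infty$; $I(f,g;h)=\mathcal{E}(gh,f)+\mathcal{E}(fh,g)-\mathcal{E}(fg,h)$, $I_f(h)=I(f,f;h)$; $\mathbb{D}_0=\{f\in\mathbb{D}_b: I_f(h)\le\|h\|_{L^1}\ \forall h\in\mathbb{D}_b\}$. The intrinsic (pseudo)metric on points is $d(x,y)=\sup_{f\in\mathbb{D}_0}\{f(x)-f(y)\}$ (possibly $\infty$), and pre-compactness of $\mathcal{X}$ is with respect to $d$. For a continuous curve $\gamma:[0,1]\to\mathcal{X}$ the discretized energy is $H_\Delta(\gamma)=\frac12\sum_{i=0}^{n-1}\frac{d^2(\gamma(t_i),\gamma(t_{i+1}))}{t_{i+1}-t_i}$. *)

theory Defs
  imports "HOL-Probability.Probability"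
begin

section \<open>L2 functions (representatives; classes handled via a.e. statements)\<close>

definition L2 :: "'a measure \<Rightarrow> ('a \<Rightarrow> real) set" where
  "L2 m = {f. f \<in> borel_measurable m \<and> integrable m (\<lambda>x. (f x)\<^sup>2)}"

definition Linf :: "'a measure \<Rightarrow> ('a \<Rightarrow> real) set" where
  "Linf m = {f. f \<in> borel_measurable m \<and> (\<exists>c. AE x in m. \<bar>f x\<bar> \<le> c)}"

definition dirichlet_form ::
  "'a measure \<Rightarrow> (('a \<Rightarrow> real) \<Rightarrow> ('a \<Rightarrow> real) \<Rightarrow> real) \<Rightarrow> ('a \<Rightarrow> real) set \<Rightarrow> bool" where
  "dirichlet_form m E D \<longleftrightarrow>
     D \<subseteq> L2 m \<and>
     (\<forall>f\<in>D. \<forall>g\<in>D. \<forall>a b::real. (\<lambda>x. a * f x + b * g x) \<in> D) \<and>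
     (\<forall>f\<in>D. \<forall>g\<in>D. E f g = E g f) \<and>
     (\<forall>f\<in>D. \<forall>g\<in>D. \<forall>h\<in>D. \<forall>a b::real.
         E (\<lambda>x. a * f x + b * g x) h = a * E f h + b * E g h) \<and>
     (\<forall>f\<in>D. E f f \<ge> 0) \<and>
     (\<forall>f\<in>D. \<forall>g. g \<in> borel_measurable m \<and> (AE x in m. f x = g x) \<longrightarrow> g \<in> D \<and> (\<forall>h\<in>D. E g h = E f h)) \<and>
     \<comment> \<open>dense in L2\<close>
     (\<forall>f\<in>L2 m. \<forall>e>0. \<exists>g\<in>D. (\<integral>x. (f x - g x)\<^sup>2 \<partial>m) < e) \<and>
     \<comment> \<open>closed: complete w.r.t. the E_1 norm\<close>
     (\<forall>u::nat \<Rightarrow> ('a \<Rightarrow> real). (\<forall>k. u k \<in> D) \<and>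
        (\<forall>e>0. \<exists>N. \<forall>k\<ge>N. \<forall>l\<ge>N.
           (\<integral>x. (u k x - u l x)\<^sup>2 \<partial>m) + E (\<lambda>x. u k x - u l x) (\<lambda>x. u k x - u l x) < e)
      \<longrightarrow> (\<exists>f\<in>D. (\<lambda>k. (\<integral>x. (u k x - f x)\<^sup>2 \<partial>m) + E (\<lambda>x. u k x - f x) (\<lambda>x. u k x - f x))
                     \<longlonglongrightarrow> 0)) \<and>
     \<comment> \<open>Markovian: unit contraction operates\<close>
     (\<forall>f\<in>D. (\<lambda>x. max 0 (min 1 (f x))) \<in> D \<and>
        E (\<lambda>x. max 0 (min 1 (f x))) (\<lambda>x. max 0 (min 1 (f x))) \<le> E f f)"

definition esupp :: "'a::topological_space measure \<Rightarrow> ('a \<Rightarrow> real) \<Rightarrow> 'a set" where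
  "esupp m g = - \<Union>{U. open U \<and> (AE x in m. x \<in> U \<longrightarrow> g x = 0)}"

definition strongly_local ::
  "'a::topological_space measure \<Rightarrow> (('a \<Rightarrow> real) \<Rightarrow> ('a \<Rightarrow> real) \<Rightarrow> real) \<Rightarrow> ('a \<Rightarrow> real) set \<Rightarrow> bool" where
  "strongly_local m E D \<longleftrightarrow>
     (\<forall>f\<in>D. \<forall>g\<in>D. compact (esupp m f) \<and> compact (esupp m g) \<and>
        (\<exists>U c. open U \<and> esupp m g \<subseteq> U \<and> (AE x in m. x \<in> U \<longrightarrow> f x = c))
        \<longrightarrow> E f g = 0)"

definition sym_markov_semigroup ::
  "'a measure \<Rightarrow> (real \<Rightarrow> ('a \<Rightarrow> real) \<Rightarrow> ('a \<Rightarrow> real)) \<Rightarrow> bool" where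
  "sym_markov_semigroup m T \<longleftrightarrow>
     (\<forall>t\<ge>0. \<forall>f\<in>L2 m. T t f \<in> L2 m) \<and>
     (\<forall>t\<ge>0. \<forall>f\<in>L2 m. \<forall>g\<in>L2 m. (AE x in m. f x = g x) \<longrightarrow> (AE x in m. T t f x = T t g x)) \<and>
     (\<forall>t\<ge>0. \<forall>f\<in>L2 m. \<forall>g\<in>L2 m. \<forall>a b::real.
        AE x in m. T t (\<lambda>y. a * f y + b * g y) x = a * T t f x + b * T t g x) \<and>
     (\<forall>f\<in>L2 m. AE x in m. T 0 f x = f x) \<and>
     (\<forall>t\<ge>0. \<forall>u\<ge>0. \<forall>f\<in>L2 m. AE x in m. T (t + u) f x = T t (T u f) x) \<and>
     (\<forall>t\<ge>0. \<forall>f\<in>L2 m. \<forall>g\<in>L2 m. (\<integral>x. T t f x * g x \<partial>m) = (\<integral>x. f x * T t g x \<partial>m)) \<and>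
     (\<forall>t\<ge>0. \<forall>f\<in>L2 m. (\<integral>x. (T t f x)\<^sup>2 \<partial>m) \<le> (\<integral>x. (f x)\<^sup>2 \<partial>m)) \<and>
     (\<forall>f\<in>L2 m. ((\<lambda>t. \<integral>x. (T t f x - f x)\<^sup>2 \<partial>m) \<longlongrightarrow> 0) (at_right 0))"

text \<open>The semigroup T is the one associated with (E,D) (Fukushima--Oshima--Takeda, Lemma 1.3.4).\<close>
definition associated_semigroup ::
  "'a measure \<Rightarrow> (('a \<Rightarrow> real) \<Rightarrow> ('a \<Rightarrow> real) \<Rightarrow> real) \<Rightarrow> ('a \<Rightarrow> real) set
     \<Rightarrow> (real \<Rightarrow> ('a \<Rightarrow> real) \<Rightarrow> ('a \<Rightarrow> real)) \<Rightarrow> bool" where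
  "associated_semigroup m E D T \<longleftrightarrow>
     sym_markov_semigroup m T \<and>
     (\<forall>f. f \<in> D \<longleftrightarrow> f \<in> L2 m \<and>
          (\<exists>c. ((\<lambda>t. (\<integral>x. (f x - T t f x) * f x \<partial>m) / t) \<longlongrightarrow> c) (at_right 0))) \<and>
     (\<forall>f\<in>D. \<forall>g\<in>D. ((\<lambda>t. (\<integral>x. (f x - T t f x) * g x \<partial>m) / t) \<longlongrightarrow> E f g) (at_right 0))"

definition conservative :: "'a measure \<Rightarrow> (real \<Rightarrow> ('a \<Rightarrow> real) \<Rightarrow> ('a \<Rightarrow> real)) \<Rightarrow> bool" where
  "conservative m T \<longleftrightarrow> (\<forall>t\<ge>0. AE x in m. T t (\<lambda>_. 1) x = 1)"

fun sg_chain :: "(real \<Rightarrow> ('a \<Rightarrow> real) \<Rightarrow> ('a \<Rightarrow> real)) \<Rightarrow> (real \<times> ('a \<Rightarrow> real)) list \<Rightarrow> 'a \<Rightarrow> real" where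
  "sg_chain T [] = (\<lambda>_. 1)"
| "sg_chain T ((h, f) # ps) = T h (\<lambda>x. f x * sg_chain T ps x)"

fun path_prod :: "(real \<Rightarrow> 'w \<Rightarrow> 'a) \<Rightarrow> 'w \<Rightarrow> real \<Rightarrow> (real \<times> ('a \<Rightarrow> real)) list \<Rightarrow> real" where
  "path_prod X w t [] = 1"
| "path_prod X w t ((h, f) # ps) = f (X (t + h) w) * path_prod X w (t + h) ps"

definition continuous_markov_process ::
  "'w measure \<Rightarrow> (real \<Rightarrow> 'w \<Rightarrow> 'a::topological_space) \<Rightarrow> 'a measure
     \<Rightarrow> (real \<Rightarrow> ('a \<Rightarrow> real) \<Rightarrow> ('a \<Rightarrow> real)) \<Rightarrow> bool" where
  "continuous_markov_process Q X m T \<longleftrightarrow>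
     prob_space Q \<and>
     (\<forall>t\<ge>0. X t \<in> measurable Q borel) \<and>
     (\<forall>w\<in>space Q. continuous_on {0..} (\<lambda>t. X t w)) \<and>
     (\<forall>ps. (\<forall>(h, f)\<in>set ps. h \<ge> 0 \<and> f \<in> borel_measurable borel \<and> bounded (range f)) \<longrightarrow>
        (\<integral>w. path_prod X w 0 ps \<partial>Q) = (\<integral>x. sg_chain T ps x \<partial>m))"

definition Db :: "'a measure \<Rightarrow> ('a \<Rightarrow> real) set \<Rightarrow> ('a \<Rightarrow> real) set" where
  "Db m D = D \<inter> Linf m"

definition Iform :: "(('a \<Rightarrow> real) \<Rightarrow> ('a \<Rightarrow> real) \<Rightarrow> real) \<Rightarrow> ('a \<Rightarrow> real) \<Rightarrow> ('a \<Rightarrow> real) \<Rightarrow> ('a \<Rightarrow> real) \<Rightarrow> real" where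
  "Iform E f g h = E (\<lambda>x. g x * h x) f + E (\<lambda>x. f x * h x) g - E (\<lambda>x. f x * g x) h"

definition D0 :: "'a measure \<Rightarrow> (('a \<Rightarrow> real) \<Rightarrow> ('a \<Rightarrow> real) \<Rightarrow> real) \<Rightarrow> ('a \<Rightarrow> real) set \<Rightarrow> ('a \<Rightarrow> real) set" where
  "D0 m E D = {f \<in> Db m D. \<forall>h\<in>Db m D. Iform E f f h \<le> (\<integral>x. \<bar>h x\<bar> \<partial>m)}"

text \<open>Intrinsic pseudometric; point values are taken for continuous representatives.\<close>
definition intrinsic_dist ::
  "'a::topological_space measure \<Rightarrow> (('a \<Rightarrow> real) \<Rightarrow> ('a \<Rightarrow> real) \<Rightarrow> real) \<Rightarrow> ('a \<Rightarrow> real) set \<Rightarrow> 'a \<Rightarrow> 'a \<Rightarrow> ereal" where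
  "intrinsic_dist m E D x y = (SUP f\<in>{f \<in> D0 m E D. continuous_on UNIV f}. ereal (f x - f y))"

definition precompact_wrt :: "('a \<Rightarrow> 'a \<Rightarrow> ereal) \<Rightarrow> bool" where
  "precompact_wrt d \<longleftrightarrow> (\<forall>e>0. \<exists>F. finite F \<and> (\<forall>x. \<exists>y\<in>F. d x y < ereal e))"

definition H_energy :: "('a \<Rightarrow> 'a \<Rightarrow> ereal) \<Rightarrow> (nat \<Rightarrow> real) \<Rightarrow> nat \<Rightarrow> (real \<Rightarrow> 'a) \<Rightarrow> ereal" where
  "H_energy d t n \<gamma> = ereal (1/2) *
     (\<Sum>i<n. (d (\<gamma> (t i)) (\<gamma> (t (Suc i))))\<^sup>2 * ereal (1 / (t (Suc i) - t i)))"

end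

theory Submission
  imports Defs
begin

text \<open>Let \<open>T\<close> be the semigroup and \<open>f\<close> a continuous function in \<open>D0\<close>. Conservativity turns the form
  into \<open>E f g = lim (1/2t) \<integral>(f(X\<^sub>t) - f(X\<^sub>0)) (g(X\<^sub>t) - g(X\<^sub>0))\<close>, and \<open>I\<^sub>f(h)\<close> is the limit of
  \<open>(1/t) \<integral>h(X\<^sub>0) (f(X\<^sub>t) - f(X\<^sub>0))\<^sup>2\<close>. Locality is used in the form that the fourth moments of the
  increments of \<open>f(X)\<close> are \<open>o(t)\<close>, and this follows from the continuity of the paths: if \<open>g\<close> is a time
  average of \<open>T r f\<close>, the quadratic variation of \<open>g(X)\<close> along a partition is bounded in \<open>L\<^sup>2\<close>, and
  that of \<open>(f - g)(X)\<close> is small in \<open>L\<^sup>1\<close>. The weighted norm of \<open>T s u\<close> with weight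
  \<open>exp (\<alpha> f)\<close> then grows at rate at most \<open>\<alpha>\<^sup>2\<close> (Davies' method), which bounds the norm of \<open>T s\<close>
  between two sets that \<open>f\<close> separates by \<open>r\<close> by \<open>exp (- r\<^sup>2 / 2s)\<close>. Precompactness splits the event into
  finitely many tubes around \<open>d\<close>-balls; a single \<open>f\<close> per time step nearly attains the distance
  of two balls, and the semigroup chain gives the energy of a curve in the tube.\<close>

section \<open>Square-integrable functions\<close>

text \<open>Constants: \<open>Iform\<close> is a limit of mean squared increments without the factor
  1/2 carried by the energy, so the weight \<open>exp (\<alpha> f)\<close> costs exactly
  \<open>\<alpha>^2\<close> per unit time on squared norms. Optimising gives
  \<open>exp (- r^2 / s)\<close> for squared norms, and a last Cauchy-Schwarz step halves the
  exponent, which is the 1/2 of \<open>H_energy\<close>. Fourth moments arise because comparing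
  weights at two times produces \<open>exp z + exp (- z) - 2\<close>, whose part beyond
  \<open>z^2\<close> is quartic; the sharp rate needs that part to vanish. The obstacle is that
  \<open>f\<close> is merely in \<open>D\<close>: \<open>T t f - f\<close> need not be of order
  \<open>t\<close> in sup norm, so the sums of squared increments of \<open>f(X)\<close> have no
  evident uniform integrability. Time averages have it and cost little energy. \<open>T\<close> is a
  family of L2 maps determined up to null sets. Sup bounds and the Markov property are therefore
  drawn from the finite-dimensional laws, in integrated form and through bounded representatives.
  Both \<open>d\<close> and the infimum may be infinite, so the bound is proved for each real
  \<open>M\<close> below the infimum, with truncated distances.\<close>

lemma L2_borel_measurable: "f \<in> L2 M \<Longrightarrow> f \<in> borel_measurable M"
  by (simp add: L2_def)

lemma L2_integrable_mult:
  assumes "f \<in> L2 M" "g \<in> L2 M"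
  shows "integrable M (\<lambda>x. f x * g x)"
proof (rule Bochner_Integration.integrable_bound)
  show "integrable M (\<lambda>x. (f x)\<^sup>2 + (g x)\<^sup>2)"
    using assms by (auto simp: L2_def)
  show "(\<lambda>x. f x * g x) \<in> borel_measurable M"
    using assms by (auto simp: L2_def)
  have "\<bar>a * b\<bar> \<le> a\<^sup>2 + b\<^sup>2" for a b :: real
  proof -
    have "0 \<le> (\<bar>a\<bar> - \<bar>b\<bar>)\<^sup>2" "0 \<le> a\<^sup>2" "0 \<le> b\<^sup>2" by auto
    moreover have "0 \<le> \<bar>a\<bar> * \<bar>b\<bar>" by simp
    ultimately show ?thesis by (simp only: power2_diff abs_mult power2_abs)
  qed
  then show "AE x in M. norm (f x * g x) \<le> norm ((f x)\<^sup>2 + (g x)\<^sup>2)" by auto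
qed

lemma L2_lincomb:
  assumes "f \<in> L2 M" "g \<in> L2 M"
  shows "(\<lambda>x. a * f x + b * g x) \<in> L2 M"
proof -
  have "(\<lambda>x. (a * f x + b * g x)\<^sup>2) =
      (\<lambda>x. a\<^sup>2 * (f x)\<^sup>2 + (2 * a * b) * (f x * g x) + b\<^sup>2 * (g x)\<^sup>2)"
    by (auto simp: power2_eq_square algebra_simps)
  moreover have "integrable M (\<lambda>x. a\<^sup>2 * (f x)\<^sup>2 + (2 * a * b) * (f x * g x) + b\<^sup>2 * (g x)\<^sup>2)"
    using assms L2_integrable_mult[OF assms]
    by (intro Bochner_Integration.integrable_add integrable_mult_right) (auto simp: L2_def)
  ultimately show ?thesis
    using assms by (auto simp: L2_def)
qed

lemma L2_diff:
  assumes "f \<in> L2 M" "g \<in> L2 M"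
  shows "(\<lambda>x. f x - g x) \<in> L2 M"
  using L2_lincomb[OF assms, of 1 "-1"] by simp

section \<open>The inner product and the Cauchy-Schwarz inequality\<close>

definition ip :: "'a measure \<Rightarrow> ('a \<Rightarrow> real) \<Rightarrow> ('a \<Rightarrow> real) \<Rightarrow> real" where
  "ip M f g = (\<integral>x. f x * g x \<partial>M)"

lemma ip_commute: "ip M f g = ip M g f"
  by (simp add: ip_def mult.commute)

lemma ip_self: "ip M f f = (\<integral>x. (f x)\<^sup>2 \<partial>M)"
  by (simp add: ip_def power2_eq_square)

lemma ip_nonneg: "0 \<le> ip M f f"
  by (simp add: ip_def)

lemma ip_cong_AE:
  assumes "f \<in> borel_measurable M" "f' \<in> borel_measurable M"
    and "g \<in> borel_measurable M" "g' \<in> borel_measurable M"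
    and "AE x in M. f x = f' x" "AE x in M. g x = g' x"
  shows "ip M f g = ip M f' g'"
  unfolding ip_def
proof (rule integral_cong_AE)
  show "AE x in M. f x * g x = f' x * g' x"
    using assms(5,6) by eventually_elim simp
qed (use assms in auto)

lemma ip_lincomb_left:
  assumes "f \<in> L2 M" "g \<in> L2 M" "h \<in> L2 M"
  shows "ip M (\<lambda>x. a * f x + b * g x) h = a * ip M f h + b * ip M g h"
proof -
  have "(\<lambda>x. (a * f x + b * g x) * h x) = (\<lambda>x. a * (f x * h x) + b * (g x * h x))"
    by (auto simp: algebra_simps)
  then show ?thesis
    unfolding ip_def using L2_integrable_mult[of _ M h] assms by simp
qed

lemma ip_diff_left:
  assumes "f \<in> L2 M" "g \<in> L2 M" "h \<in> L2 M"
  shows "ip M (\<lambda>x. f x - g x) h = ip M f h - ip M g h"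
  using ip_lincomb_left[OF assms, of 1 "-1"] by simp

lemma ip_diff_right:
  assumes "f \<in> L2 M" "g \<in> L2 M" "h \<in> L2 M"
  shows "ip M h (\<lambda>x. f x - g x) = ip M h f - ip M h g"
  using ip_diff_left[OF assms] by (simp add: ip_commute)

lemma ip_diff_self:
  assumes "f \<in> L2 M" "g \<in> L2 M"
  shows "ip M (\<lambda>x. f x - g x) (\<lambda>x. f x - g x) = ip M f f - 2 * ip M f g + ip M g g"
  using assms by (simp add: ip_diff_left ip_diff_right L2_diff ip_commute[of M g f])

lemma ip_Cauchy_Schwarz:
  assumes "f \<in> L2 M" "g \<in> L2 M"
  shows "(ip M f g)\<^sup>2 \<le> ip M f f * ip M g g"
proof -
  have q: "0 \<le> a\<^sup>2 * ip M f f - 2 * a * b * ip M f g + b\<^sup>2 * ip M g g" for a b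
  proof -
    have af: "(\<lambda>x. a * f x) \<in> L2 M" and bg: "(\<lambda>x. b * g x) \<in> L2 M"
      using L2_lincomb[OF assms, of a 0] L2_lincomb[OF assms, of 0 b] by auto
    have "ip M (\<lambda>x. a * f x) (\<lambda>x. a * f x) = a\<^sup>2 * ip M f f"
      "ip M (\<lambda>x. b * g x) (\<lambda>x. b * g x) = b\<^sup>2 * ip M g g"
      "ip M (\<lambda>x. a * f x) (\<lambda>x. b * g x) = a * b * ip M f g"
      unfolding ip_def by (simp_all add: power2_eq_square algebra_simps flip: integral_mult_right_zero)
    then show ?thesis
      using ip_diff_self[OF af bg] ip_nonneg[of M "\<lambda>x. a * f x - b * g x"] by simp
  qed
  show ?thesis
  proof (cases "ip M g g = 0")
    case False
    then have pos: "ip M g g > 0" using ip_nonneg[of M g] by simp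
    have "0 \<le> ip M g g * (ip M f f * ip M g g - (ip M f g)\<^sup>2)"
      using q[of "ip M g g" "ip M f g"] by (simp add: power2_eq_square algebra_simps)
    then show ?thesis using pos by (simp add: zero_le_mult_iff)
  next
    case True
    have "ip M f g = 0"
    proof (rule ccontr)
      assume nz: "ip M f g \<noteq> 0"
      \<comment> \<open>For \<open>ip M g g = 0\<close> the quadratic form is affine in
        \<open>b\<close>, and this value of \<open>b\<close> makes it negative.\<close>
      have "0 \<le> ip M f f - 2 * ((ip M f f + 1) / ip M f g) * ip M f g"
        using q[of 1 "(ip M f f + 1) / ip M f g"] True by simp
      also have "\<dots> = - ip M f f - 2" using nz by simp
      finally show False using ip_nonneg[of M f] by simp
    qed
    then show ?thesis using True by simp
  qed
qed

lemma ip_abs_le: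
  assumes "f \<in> L2 M" "g \<in> L2 M"
  shows "\<bar>ip M f g\<bar> \<le> sqrt (ip M f f) * sqrt (ip M g g)"
  using ip_Cauchy_Schwarz[OF assms] by (metis real_sqrt_abs real_sqrt_le_mono real_sqrt_mult)

text \<open>The bound holds at every point, not just almost everywhere: it then survives composition
  with \<open>X t\<close>, and such functions are admissible in
  \<open>continuous_markov_process\<close>, which asks for a bounded range.\<close>

definition bm :: "'a measure \<Rightarrow> ('a \<Rightarrow> real) set" where
  "bm M = {f. f \<in> borel_measurable M \<and> bounded (range f)}"

abbreviation Bb :: "('a::topological_space \<Rightarrow> real) set" where
  "Bb \<equiv> bm borel"

lemma bmI: "f \<in> borel_measurable M \<Longrightarrow> (\<And>x. \<bar>f x\<bar> \<le> c) \<Longrightarrow> f \<in> bm M"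
  unfolding bm_def bounded_iff by auto

lemma bmE:
  assumes "f \<in> bm M"
  obtains c where "c > 0" "\<And>x. \<bar>f x\<bar> \<le> c"
  using assms unfolding bm_def bounded_pos by auto

lemma bm_borel_measurable[measurable_dest]: "f \<in> bm M \<Longrightarrow> f \<in> borel_measurable M"
  by (simp add: bm_def)

lemma bm_const[simp]: "(\<lambda>_. c) \<in> bm M"
  by (rule bmI[of _ _ "\<bar>c\<bar>"]) auto

lemma bm_mult[intro]:
  assumes "f \<in> bm M" "g \<in> bm M"
  shows "(\<lambda>x. f x * g x) \<in> bm M"
proof -
  obtain a b where "a > 0" "\<And>x. \<bar>f x\<bar> \<le> a" "b > 0" "\<And>x. \<bar>g x\<bar> \<le> b"
    using assms by (auto elim!: bmE)
  then show ?thesis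
    using assms by (intro bmI[of _ _ "a * b"]) (auto simp: abs_mult intro!: mult_mono)
qed

lemma bm_add[intro]:
  assumes "f \<in> bm M" "g \<in> bm M"
  shows "(\<lambda>x. f x + g x) \<in> bm M"
proof -
  obtain a b where "\<And>x. \<bar>f x\<bar> \<le> a" "\<And>x. \<bar>g x\<bar> \<le> b"
    using assms by (metis bmE)
  then show ?thesis
    using assms by (intro bmI[of _ _ "a + b"]) (auto intro: order_trans[OF abs_triangle_ineq] add_mono)
qed

lemma bm_uminus[intro]: "f \<in> bm M \<Longrightarrow> (\<lambda>x. - f x) \<in> bm M"
  using bm_mult[of "\<lambda>_. -1" M f] by simp

lemma bm_diff[intro]: "f \<in> bm M \<Longrightarrow> g \<in> bm M \<Longrightarrow> (\<lambda>x. f x - g x) \<in> bm M"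
  using bm_add[of f M "\<lambda>x. - g x"] bm_uminus[of g M] by simp

lemma bm_power[intro]: "f \<in> bm M \<Longrightarrow> (\<lambda>x. (f x) ^ n) \<in> bm M"
  by (induction n) auto

lemma bm_sum[intro]: "(\<And>i. i \<in> I \<Longrightarrow> f i \<in> bm M) \<Longrightarrow> (\<lambda>x. \<Sum>i\<in>I. f i x) \<in> bm M"
  by (induction I rule: infinite_finite_induct) auto

lemma bm_indicator: "A \<in> sets M \<Longrightarrow> indicator A \<in> bm M"
  by (rule bmI[of _ _ 1]) (auto simp: indicator_def)

section \<open>Quadratic forms of the semigroup\<close>

locale diffusion =
  fixes m :: "'a::polish_space measure"
    and E :: "('a \<Rightarrow> real) \<Rightarrow> ('a \<Rightarrow> real) \<Rightarrow> real"
    and D :: "('a \<Rightarrow> real) set"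
    and T :: "real \<Rightarrow> ('a \<Rightarrow> real) \<Rightarrow> ('a \<Rightarrow> real)"
    and Q :: "'w measure"
    and X :: "real \<Rightarrow> 'w \<Rightarrow> 'a"
  assumes prob_m: "prob_space m"
    and sets_m[measurable_cong]: "sets m = sets borel"
    and form: "dirichlet_form m E D"
    and assoc: "associated_semigroup m E D T"
    and conserv: "conservative m T"
    and process: "continuous_markov_process Q X m T"
begin

sublocale m: prob_space m by (rule prob_m)

lemma space_m[simp]: "space m = UNIV"
  using sets_eq_imp_space_eq[OF sets_m] by simp

lemma borel_measurable_m: "f \<in> borel_measurable m \<longleftrightarrow> f \<in> borel_measurable borel"
  by (simp only: measurable_cong_sets[OF sets_m refl])

lemma bm_integrable:
  assumes "f \<in> Bb"
  shows "integrable m f"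
proof -
  obtain c where "\<And>x. \<bar>f x\<bar> \<le> c" using assms by (metis bmE)
  then show ?thesis
    using assms by (intro m.integrable_const_bound[of _ c]) (auto simp: borel_measurable_m bm_borel_measurable)
qed

lemma bm_L2: "f \<in> Bb \<Longrightarrow> f \<in> L2 m"
  using bm_integrable[OF bm_power[of f borel 2]]
  by (simp add: L2_def borel_measurable_m bm_borel_measurable)

lemma L2_bm_mult:
  assumes "f \<in> Bb" "g \<in> L2 m"
  shows "(\<lambda>x. f x * g x) \<in> L2 m"
proof -
  obtain c where c: "\<And>x. \<bar>f x\<bar> \<le> c" using assms by (metis bmE)
  have mf: "f \<in> borel_measurable m" "g \<in> borel_measurable m"
    using assms by (auto simp: borel_measurable_m bm_borel_measurable L2_def)
  have "integrable m (\<lambda>x. (f x * g x)\<^sup>2)"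
  proof (rule Bochner_Integration.integrable_bound)
    show "integrable m (\<lambda>x. c\<^sup>2 * (g x)\<^sup>2)" using assms by (auto simp: L2_def)
    have "(f x)\<^sup>2 \<le> c\<^sup>2" for x using c[of x] by (metis abs_ge_zero power2_abs power_mono)
    then show "AE x in m. norm ((f x * g x)\<^sup>2) \<le> norm (c\<^sup>2 * (g x)\<^sup>2)"
      by (auto simp: power_mult_distrib intro!: mult_right_mono)
  qed (use mf in auto)
  then show ?thesis using mf by (auto simp: L2_def)
qed

section \<open>Semigroup and form axioms in inner-product notation\<close>

lemma associated_semigroupD: "sym_markov_semigroup m T"
  "\<forall>f. f \<in> D \<longleftrightarrow> f \<in> L2 m \<and> (\<exists>c. ((\<lambda>t. ip m (\<lambda>x. f x - T t f x) f / t) \<longlongrightarrow> c) (at_right 0))"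
  "\<forall>f\<in>D. \<forall>g\<in>D. ((\<lambda>t. ip m (\<lambda>x. f x - T t f x) g / t) \<longlongrightarrow> E f g) (at_right 0)"
  unfolding ip_def
  by (rule assoc[unfolded associated_semigroup_def, THEN conjunct1]
      assoc[unfolded associated_semigroup_def, THEN conjunct2, THEN conjunct1]
      assoc[unfolded associated_semigroup_def, THEN conjunct2, THEN conjunct2])+

lemmas sym_markov_semigroupD = associated_semigroupD(1)[unfolded sym_markov_semigroup_def]

lemmas dirichlet_formD = form[unfolded dirichlet_form_def]

lemma T_L2[intro]: "0 \<le> t \<Longrightarrow> f \<in> L2 m \<Longrightarrow> T t f \<in> L2 m"
  by (rule sym_markov_semigroupD[THEN conjunct1, rule_format])

lemma T_cong: "0 \<le> t \<Longrightarrow> f \<in> L2 m \<Longrightarrow> g \<in> L2 m \<Longrightarrow> AE x in m. f x = g x \<Longrightarrow>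
    AE x in m. T t f x = T t g x"
  by (rule sym_markov_semigroupD[THEN conjunct2, THEN conjunct1, rule_format])

lemma T_lincomb: "0 \<le> t \<Longrightarrow> f \<in> L2 m \<Longrightarrow> g \<in> L2 m \<Longrightarrow>
    AE x in m. T t (\<lambda>y. a * f y + b * g y) x = a * T t f x + b * T t g x"
  by (rule sym_markov_semigroupD[THEN conjunct2, THEN conjunct2, THEN conjunct1, rule_format])

lemma T_0: "f \<in> L2 m \<Longrightarrow> AE x in m. T 0 f x = f x"
  by (rule sym_markov_semigroupD[THEN conjunct2, THEN conjunct2, THEN conjunct2, THEN conjunct1, rule_format])

lemma T_add: "0 \<le> t \<Longrightarrow> 0 \<le> u \<Longrightarrow> f \<in> L2 m \<Longrightarrow> AE x in m. T (t + u) f x = T t (T u f) x"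
  by (rule sym_markov_semigroupD[THEN conjunct2, THEN conjunct2, THEN conjunct2, THEN conjunct2, THEN conjunct1, rule_format])

lemma T_sym: "0 \<le> t \<Longrightarrow> f \<in> L2 m \<Longrightarrow> g \<in> L2 m \<Longrightarrow> ip m (T t f) g = ip m f (T t g)"
  unfolding ip_def by (rule sym_markov_semigroupD[THEN conjunct2, THEN conjunct2, THEN conjunct2, THEN conjunct2, THEN conjunct2, THEN conjunct1, rule_format])

lemma T_contraction: "0 \<le> t \<Longrightarrow> f \<in> L2 m \<Longrightarrow> ip m (T t f) (T t f) \<le> ip m f f"
  unfolding ip_self by (rule sym_markov_semigroupD[THEN conjunct2, THEN conjunct2, THEN conjunct2, THEN conjunct2, THEN conjunct2, THEN conjunct2, THEN conjunct1, rule_format])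

lemma T_continuous: "f \<in> L2 m \<Longrightarrow>
    ((\<lambda>t. ip m (\<lambda>x. T t f x - f x) (\<lambda>x. T t f x - f x)) \<longlongrightarrow> 0) (at_right 0)"
  unfolding ip_self by (rule sym_markov_semigroupD[THEN conjunct2, THEN conjunct2, THEN conjunct2, THEN conjunct2, THEN conjunct2, THEN conjunct2, THEN conjunct2, rule_format])

lemma T_one: "0 \<le> t \<Longrightarrow> AE x in m. T t (\<lambda>_. 1) x = 1"
  using conserv by (simp add: conservative_def)

lemma D_iff: "f \<in> D \<longleftrightarrow> f \<in> L2 m \<and> (\<exists>c. ((\<lambda>t. ip m (\<lambda>x. f x - T t f x) f / t) \<longlongrightarrow> c) (at_right 0))"
  by (rule associated_semigroupD(2)[rule_format])

lemma E_lim: "f \<in> D \<Longrightarrow> g \<in> D \<Longrightarrow> ((\<lambda>t. ip m (\<lambda>x. f x - T t f x) g / t) \<longlongrightarrow> E f g) (at_right 0)"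
  by (rule associated_semigroupD(3)[rule_format])

lemma D_L2: "f \<in> D \<Longrightarrow> f \<in> L2 m"
  by (simp add: D_iff)

lemma D_lincomb: "f \<in> D \<Longrightarrow> g \<in> D \<Longrightarrow> (\<lambda>x. a * f x + b * g x) \<in> D"
  by (rule dirichlet_formD[THEN conjunct2, THEN conjunct1, rule_format])

lemma E_sym: "f \<in> D \<Longrightarrow> g \<in> D \<Longrightarrow> E f g = E g f"
  by (rule dirichlet_formD[THEN conjunct2, THEN conjunct2, THEN conjunct1, rule_format])

lemma E_lincomb: "f \<in> D \<Longrightarrow> g \<in> D \<Longrightarrow> h \<in> D \<Longrightarrow>
    E (\<lambda>x. a * f x + b * g x) h = a * E f h + b * E g h"
  by (rule dirichlet_formD[THEN conjunct2, THEN conjunct2, THEN conjunct2, THEN conjunct1, rule_format])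

lemma
  assumes "f \<in> D" "g \<in> borel_measurable borel" "AE x in m. f x = g x"
  shows D_cong: "g \<in> D" and E_cong: "h \<in> D \<Longrightarrow> E g h = E f h"
  using dirichlet_formD[THEN conjunct2, THEN conjunct2, THEN conjunct2, THEN conjunct2, THEN conjunct2,
      THEN conjunct1] assms by (simp_all add: borel_measurable_m)

lemma T_diff:
  assumes "0 \<le> t" "f \<in> L2 m" "g \<in> L2 m"
  shows "AE x in m. T t (\<lambda>y. f y - g y) x = T t f x - T t g x"
  using T_lincomb[OF assms, of 1 "-1"] by simp

section \<open>Decay and convexity of the pairing of \<open>T t f\<close> with
  \<open>f\<close>\<close>

lemma ip_T_T:
  assumes "0 \<le> a" "0 \<le> b" "f \<in> L2 m"
  shows "ip m (T a f) (T b f) = ip m (T (a + b) f) f"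
proof -
  have "ip m (T (a + b) f) f = ip m (T a (T b f)) f"
    using T_add[OF assms] assms
    by (intro ip_cong_AE) (auto intro!: L2_borel_measurable)
  also have "\<dots> = ip m (T b f) (T a f)"
    using assms by (intro T_sym) auto
  finally show ?thesis by (simp add: ip_commute)
qed

text \<open>In spectral terms, the Laplace transform of the spectral measure of \<open>f\<close>.
  Nonnegativity, decrease and convexity in \<open>t\<close> are derived below from symmetry,
  contraction and the semigroup law, so no spectral theorem is invoked.\<close>

definition G :: "('a \<Rightarrow> real) \<Rightarrow> real \<Rightarrow> real" where "G f t = ip m (T t f) f"

lemma G_nonneg:
  assumes "0 \<le> t" "f \<in> L2 m"
  shows "0 \<le> G f t"
  using ip_T_T[of "t/2" "t/2" f] ip_nonneg[of m "T (t/2) f"] assms by (simp add: G_def)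

lemma G_0: "f \<in> L2 m \<Longrightarrow> G f 0 = ip m f f"
  unfolding G_def by (rule ip_cong_AE) (auto simp: T_0 intro!: L2_borel_measurable)

lemma G_antimono:
  assumes "0 \<le> s" "s \<le> t" "f \<in> L2 m"
  shows "G f t \<le> G f s"
proof -
  let ?h = "(t - s) / 2"
  have "G f t = ip m (T (t/2) f) (T (t/2) f)"
    using ip_T_T[of "t/2" "t/2" f] assms by (simp add: G_def)
  also have "\<dots> = ip m (T ?h (T (s/2) f)) (T ?h (T (s/2) f))"
    using T_add[of ?h "s/2" f] assms
    by (intro ip_cong_AE) (auto intro!: L2_borel_measurable T_L2 simp: field_simps)
  also have "\<dots> \<le> ip m (T (s/2) f) (T (s/2) f)"
    using assms by (intro T_contraction) auto
  also have "\<dots> = G f s"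
    using ip_T_T[of "s/2" "s/2" f] assms by (simp add: G_def)
  finally show ?thesis .
qed

lemma G_le_0: "0 \<le> t \<Longrightarrow> f \<in> L2 m \<Longrightarrow> G f t \<le> ip m f f"
  using G_antimono[of 0 t f] by (simp add: G_0)

lemma ip_minus_T:
  assumes "0 \<le> t" "f \<in> L2 m"
  shows "ip m (\<lambda>x. f x - T t f x) f = G f 0 - G f t"
  using assms by (simp add: ip_diff_left T_L2 G_0) (simp add: G_def)

lemma G_T:
  assumes "0 \<le> r" "0 \<le> t" "f \<in> L2 m"
  shows "G (T r f) t = G f (2 * r + t)"
proof -
  have "G (T r f) t = ip m (T (t + r) f) (T r f)"
    unfolding G_def using T_add[of t r f] assms
    by (intro ip_cong_AE) (auto intro!: L2_borel_measurable elim: AE_mp)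
  also have "\<dots> = G f (2 * r + t)"
    using ip_T_T[of "t + r" r f] assms by (simp add: G_def add.commute add.left_commute)
  finally show ?thesis .
qed

lemma ip_T_minus_self:
  assumes "0 \<le> r" "f \<in> L2 m"
  shows "ip m (\<lambda>x. T r f x - f x) (\<lambda>x. T r f x - f x) = G f 0 - 2 * G f r + G f (2 * r)"
  using assms ip_T_T[of r r f]
  by (simp add: ip_diff_self T_L2 G_0 flip: G_def)

text \<open>By symmetry the left side pairs \<open>f\<close> with \<open>T t (1 - T a)^2 f\<close>;
  the coefficients 1, -2, 1 are those of the expanded square. Energies of \<open>f - T a f\<close>
  thereby become second differences of \<open>G f\<close>.\<close>

lemma G_minus_T:
  assumes "0 \<le> a" "0 \<le> t" "f \<in> L2 m"
  shows "G (\<lambda>x. f x - T a f x) t = G f t - 2 * G f (a + t) + G f (2 * a + t)"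
proof -
  let ?v = "\<lambda>x. f x - T a f x"
  have v: "?v \<in> L2 m" using assms by (auto intro: L2_diff)
  have Ta: "T a f \<in> L2 m" using assms by auto
  have "G ?v t = ip m (\<lambda>x. T t f x - T t (T a f) x) ?v"
    unfolding G_def using T_diff[of t f "T a f"] assms v Ta
    by (intro ip_cong_AE) (auto intro!: L2_borel_measurable L2_diff)
  also have "\<dots> = ip m (T t f) f - ip m (T t (T a f)) f - (ip m (T t f) (T a f) - ip m (T t (T a f)) (T a f))"
    using assms Ta by (simp add: ip_diff_left ip_diff_right L2_diff T_L2)
  also have "ip m (T t (T a f)) f = ip m (T t f) (T a f)"
    using assms Ta T_sym[of t "T a f" f] by (simp add: ip_commute)
  also have "ip m (T t f) (T a f) = G f (a + t)"
    using assms ip_T_T[of t a f] by (simp add: G_def add.commute)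
  also have "ip m (T t (T a f)) (T a f) = G f (2 * a + t)"
    using assms G_T[of a t f] by (simp add: G_def)
  finally show ?thesis by (simp add: G_def)
qed

text \<open>The energy \<open>q\<close> of \<open>T a f\<close> at scale \<open>h\<close> is midpoint convex in \<open>a\<close> and bounded on the half
  line; a first increase would double forever, so \<open>q\<close> decreases.\<close>

lemma G_increment_antimono_0:
  assumes "0 \<le> a" "0 \<le> h" "f \<in> L2 m"
  shows "G f a - G f (a + h) \<le> G f 0 - G f h"
proof -
  define q where "q a = G f a - G f (a + h)" for a
  have mid: "2 * q a \<le> q 0 + q (2 * a)" if a: "0 \<le> a" for a
  proof -
    let ?v = "\<lambda>x. f x - T a f x"
    have v: "?v \<in> L2 m" using assms a by (auto intro: L2_diff)
    have "q 0 - 2 * q a + q (2 * a) = G ?v 0 - G ?v h"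
      using assms a by (simp add: q_def G_minus_T)
    also have "0 \<le> \<dots>" using G_antimono[of 0 h ?v] v assms by simp
    finally show ?thesis by simp
  qed
  have dbl: "2 ^ k * (q a - q 0) \<le> q (2 ^ k * a) - q 0" for k
  proof (induction k)
    case (Suc k)
    have "2 ^ Suc k * (q a - q 0) \<le> 2 * (q (2 ^ k * a) - q 0)" using Suc by simp
    also have "\<dots> \<le> q (2 ^ Suc k * a) - q 0"
      using mid[of "2 ^ k * a"] assms by (simp add: mult.assoc)
    finally show ?case .
  qed simp
  have bd: "2 ^ k * (q a - q 0) \<le> ip m f f" for k
  proof -
    have "q (2 ^ k * a) \<le> G f (2 ^ k * a)"
      using G_nonneg[of "2 ^ k * a + h" f] assms by (simp add: q_def)
    also have "\<dots> \<le> ip m f f" using assms by (intro G_le_0) auto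
    finally show ?thesis
      using dbl[of k] G_antimono[of 0 h f] assms by (simp add: q_def)
  qed
  have "q a - q 0 \<le> 0"
  proof (rule ccontr)
    assume "\<not> q a - q 0 \<le> 0"
    then have p: "q a - q 0 > 0" by simp
    obtain k where "ip m f f / (q a - q 0) < 2 ^ k"
      using real_arch_pow[of 2 "ip m f f / (q a - q 0)"] by auto
    then have "ip m f f < 2 ^ k * (q a - q 0)" using p by (simp add: field_simps)
    then show False using bd[of k] by simp
  qed
  then show ?thesis by (simp add: q_def)
qed

text \<open>Convexity of \<open>G f\<close>. Replacing \<open>f\<close> by \<open>T (a/2) f\<close>
  shifts the argument of \<open>G\<close> by \<open>a\<close>, so the case starting at zero
  suffices.\<close>

lemma G_increment_antimono:
  assumes "0 \<le> a" "a \<le> b" "0 \<le> h" "f \<in> L2 m"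
  shows "G f b - G f (b + h) \<le> G f a - G f (a + h)"
  using G_increment_antimono_0[of "b - a" h "T (a/2) f"] assms
  by (simp add: G_T T_L2)

text \<open>The approximating form at time \<open>t\<close>. It is bounded by its limit at zero, the
  energy, and for bounded functions it is half a mean squared increment divided by
  \<open>t\<close>.\<close>

definition en :: "real \<Rightarrow> ('a \<Rightarrow> real) \<Rightarrow> real" where
  "en t f = ip m (\<lambda>x. f x - T t f x) f / t"

lemma en_eq: "0 \<le> t \<Longrightarrow> f \<in> L2 m \<Longrightarrow> en t f = (G f 0 - G f t) / t"
  by (simp add: en_def ip_minus_T)

lemma en_nonneg: "0 < t \<Longrightarrow> f \<in> L2 m \<Longrightarrow> 0 \<le> en t f"
  using G_antimono[of 0 t f] by (simp add: en_eq)

lemma G_iterate: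
  assumes "0 \<le> s" "f \<in> L2 m"
  shows "G f 0 - G f (real k * s) \<le> real k * (G f 0 - G f s)"
proof (induction k)
  case (Suc k)
  have "G f (real k * s) - G f (real k * s + s) \<le> G f 0 - G f s"
    using assms by (intro G_increment_antimono_0) auto
  with Suc show ?case by (simp add: algebra_simps)
qed simp

text \<open>A Fekete-type bound for the subadditive function \<open>t \<mapsto> G f 0 - G f t\<close>.\<close>

lemma en_lower:
  assumes "0 < s" "0 < t" "f \<in> L2 m"
  shows "(G f 0 - G f t) / (t + s) \<le> en s f"
proof -
  \<comment> \<open>This many steps of length \<open>s\<close> cover \<open>t\<close> and overshoot
    it by at most \<open>s\<close>, which is where the denominator \<open>t + s\<close> comes
    from.\<close>
  define k where "k = nat \<lceil>t / s\<rceil>"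
  have tk: "t \<le> real k * s" and kt: "real k * s \<le> t + s"
  proof -
    have "t / s \<le> real k" unfolding k_def using assms by simp
    then show "t \<le> real k * s" using assms by (simp add: field_simps)
    have "real k < t / s + 1" unfolding k_def using assms ceiling_correct[of "t/s"] by (simp add: nat_less_real_le)
    then show "real k * s \<le> t + s" using assms by (simp add: field_simps)
  qed
  have "G f 0 - G f t \<le> G f 0 - G f (real k * s)"
    using G_antimono[of t "real k * s" f] tk assms by simp
  also have "\<dots> \<le> real k * (G f 0 - G f s)" using assms by (intro G_iterate) auto
  also have "\<dots> = real k * s * en s f" using assms by (simp add: en_eq)
  also have "\<dots> \<le> (t + s) * en s f" using kt en_nonneg assms by (intro mult_right_mono) auto
  finally show ?thesis using assms by (simp add: field_simps)
qed

lemma en_tendsto: "f \<in> D \<Longrightarrow> ((\<lambda>t. en t f) \<longlongrightarrow> E f f) (at_right 0)"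
  unfolding en_def by (rule E_lim)

text \<open>Keep \<open>t\<close> fixed and let \<open>s\<close> tend to zero in
  \<open>en_lower\<close>: its left side tends to \<open>en t f\<close>.\<close>

lemma en_le_limit:
  assumes "f \<in> L2 m" "((\<lambda>t. en t f) \<longlongrightarrow> c) (at_right 0)" "0 < t"
  shows "en t f \<le> c"
proof (rule tendsto_le[OF _ assms(2)])
  have "((\<lambda>s. (G f 0 - G f t) / (t + s)) \<longlongrightarrow> (G f 0 - G f t) / (t + 0)) (at_right 0)"
    using assms by (intro tendsto_intros) auto
  then show "((\<lambda>s. (G f 0 - G f t) / (t + s)) \<longlongrightarrow> en t f) (at_right 0)"
    using assms by (simp add: en_eq)
  show "\<forall>\<^sub>F s in at_right 0. (G f 0 - G f t) / (t + s) \<le> en s f"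
    using eventually_at_right_less[of 0] by eventually_elim (use assms en_lower in auto)
qed simp

lemma en_le_E: "f \<in> D \<Longrightarrow> 0 < t \<Longrightarrow> en t f \<le> E f f"
  by (rule en_le_limit[OF D_L2 en_tendsto])

text \<open>Membership in \<open>D\<close> asks for a limit, not for a bound. The supremum
  \<open>S\<close> is that limit: \<open>en_lower\<close> with small \<open>s\<close> puts the lower
  limit at zero above every single \<open>en t f\<close>.\<close>

lemma D_if_en_bounded:
  assumes "f \<in> L2 m" "0 < d" "\<And>t. 0 < t \<Longrightarrow> t < d \<Longrightarrow> en t f \<le> c"
  shows "f \<in> D"
proof -
  define S where "S = Sup ((\<lambda>t. en t f) ` {0<..<d})"
  have bdd: "bdd_above ((\<lambda>t. en t f) ` {0<..<d})"
    using assms by (intro bdd_aboveI[of _ c]) auto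
  have "((\<lambda>t. en t f) \<longlongrightarrow> S) (at_right 0)"
  proof (rule order_tendstoI)
    fix a assume "a < S"
    then obtain t where t: "0 < t" "t < d" "a < en t f"
      using less_cSup_iff[OF _ bdd] assms(2) unfolding S_def by auto
    have "((\<lambda>s. (G f 0 - G f t) / (t + s)) \<longlongrightarrow> (G f 0 - G f t) / (t + 0)) (at_right 0)"
      using t by (intro tendsto_intros) auto
    then have "\<forall>\<^sub>F s in at_right 0. a < (G f 0 - G f t) / (t + s)"
      using t assms by (intro order_tendstoD(1)) (auto simp: en_eq)
    then show "\<forall>\<^sub>F s in at_right 0. a < en s f"
      using eventually_at_right_less[of 0]
      by eventually_elim (use assms en_lower t in \<open>force intro: less_le_trans\<close>)
  next
    fix a assume a: "S < a"
    have "en t f \<le> S" if "0 < t" "t < d" for t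
      unfolding S_def using bdd that by (auto intro: cSup_upper)
    then show "\<forall>\<^sub>F s in at_right 0. en s f < a"
      using a assms(2) by (auto simp: eventually_at_right_field intro!: exI[of _ d] intro: le_less_trans)
  qed
  then show ?thesis using assms(1) unfolding D_iff en_def by blast
qed

text \<open>The energy of \<open>T s f\<close> at scale \<open>t\<close> is an increment of
  \<open>G f\<close> of length \<open>t\<close> at time \<open>2 * s\<close>. By convexity every
  earlier increment of that length is at least as large; \<open>k\<close> of them, with
  \<open>k * t\<close> between \<open>s\<close> and \<open>2 * s\<close>, telescope to at most the
  squared norm of \<open>f\<close>.\<close>

lemma T_in_D:
  assumes "0 < s" "f \<in> L2 m"
  shows "T s f \<in> D"
proof (rule D_if_en_bounded[where d = s and c = "ip m f f / s"])
  show Ts: "T s f \<in> L2 m" using assms by auto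
  fix t :: real assume t: "0 < t" "t < s"
  define k where "k = nat \<lfloor>2 * s / t\<rfloor>"
  have k1: "real k * t \<le> 2 * s" and k2: "s \<le> real k * t"
  proof -
    have "real k \<le> 2 * s / t" unfolding k_def using t by simp
    then show "real k * t \<le> 2 * s" using t by (simp add: field_simps)
    have "2 * s / t < real k + 1" unfolding k_def using t
      by (simp add: of_nat_nat)
    then have "2 * s < real k * t + t" using t by (simp add: field_simps)
    then show "s \<le> real k * t" using t by simp
  qed
  have step: "real j * (G f (2 * s) - G f (2 * s + t)) \<le> G f 0 - G f (real j * t)"
    if "real j * t \<le> 2 * s" for j
    using that
  proof (induction j)
    case (Suc j)
    then have "real j * t \<le> 2 * s" using t by (simp add: algebra_simps)
    moreover from this have "G f (2 * s) - G f (2 * s + t) \<le> G f (real j * t) - G f (real j * t + t)"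
      using t assms by (intro G_increment_antimono) auto
    ultimately show ?case using Suc by (simp add: algebra_simps)
  qed simp
  have "s * en t (T s f) = s / t * (G f (2 * s) - G f (2 * s + t))"
    using assms t Ts by (simp add: en_eq G_T)
  also have "\<dots> \<le> real k * (G f (2 * s) - G f (2 * s + t))"
    using k2 t G_antimono[of "2 * s" "2 * s + t" f] assms
    by (intro mult_right_mono) (auto simp: field_simps)
  also have "\<dots> \<le> G f 0 - G f (real k * t)" using step[OF k1] .
  also have "\<dots> \<le> ip m f f"
    using G_nonneg[of "real k * t" f] t assms by (simp add: G_0)
  finally show "en t (T s f) \<le> ip m f f / s"
    using assms by (simp add: field_simps)
qed (use assms in auto)

section \<open>The stationary process\<close>

lemma
  shows prob_Q: "prob_space Q"
    and X_measurable[measurable]: "0 \<le> t \<Longrightarrow> X t \<in> measurable Q borel"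
    and X_continuous: "w \<in> space Q \<Longrightarrow> continuous_on {0..} (\<lambda>t. X t w)"
  using process by (simp_all add: continuous_markov_process_def)

lemma process_formula:
  assumes "\<And>h f. (h, f) \<in> set ps \<Longrightarrow> 0 \<le> h \<and> f \<in> Bb"
  shows "(\<integral>w. path_prod X w 0 ps \<partial>Q) = (\<integral>x. sg_chain T ps x \<partial>m)"
proof -
  have "\<forall>(h, f)\<in>set ps. h \<ge> 0 \<and> f \<in> borel_measurable borel \<and> bounded (range f)"
    using assms by (auto simp: bm_def)
  then show ?thesis using process unfolding continuous_markov_process_def by blast
qed

sublocale Q: prob_space Q by (rule prob_Q)

lemma bm_Q_integrable[intro]:
  assumes "u \<in> bm Q"
  shows "integrable Q u"
proof -
  obtain c where "\<And>x. \<bar>u x\<bar> \<le> c" using assms by (metis bmE)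
  then show ?thesis
    using assms by (intro Q.integrable_const_bound[of _ c]) (auto simp: bm_borel_measurable)
qed

lemma bm_X[intro]:
  assumes "f \<in> Bb" "0 \<le> a"
  shows "(\<lambda>w. f (X a w)) \<in> bm Q"
proof -
  obtain c where "\<And>x. \<bar>f x\<bar> \<le> c" using assms by (metis bmE)
  moreover have "(\<lambda>w. f (X a w)) \<in> borel_measurable Q"
    using assms by (auto intro: measurable_compose[OF X_measurable] bm_borel_measurable)
  ultimately show ?thesis by (intro bmI)
qed

text \<open>Invariance of \<open>m\<close>: symmetry moves \<open>T t\<close> onto the constant 1,
  which conservativity fixes.\<close>

lemma integral_T:
  assumes "0 \<le> t" "u \<in> L2 m"
  shows "(\<integral>x. T t u x \<partial>m) = (\<integral>x. u x \<partial>m)"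
proof -
  have one: "(\<lambda>_. 1) \<in> L2 m" by (intro bm_L2) simp
  have "(\<integral>x. T t u x \<partial>m) = ip m u (T t (\<lambda>_. 1))"
    using T_sym[OF assms one] by (simp add: ip_def)
  also have "\<dots> = ip m u (\<lambda>_. 1)"
    using assms one T_one[of t] by (intro ip_cong_AE) (auto intro!: L2_borel_measurable)
  finally show ?thesis by (simp add: ip_def)
qed

lemma two_point:
  assumes "0 \<le> a" "0 \<le> h" "F \<in> Bb" "H \<in> Bb"
  shows "(\<integral>w. F (X a w) * H (X (a + h) w) \<partial>Q) = ip m F (T h H)"
proof -
  have "(\<integral>w. F (X a w) * H (X (a + h) w) \<partial>Q) = (\<integral>x. T a (\<lambda>x. F x * T h H x) x \<partial>m)"
    using process_formula[of "[(a, F), (h, H)]"] assms by auto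
  also have "\<dots> = ip m F (T h H)"
    using assms by (subst integral_T) (auto intro!: L2_bm_mult T_L2 intro: bm_L2 simp: ip_def)
  finally show ?thesis .
qed

lemma law_X:
  assumes "0 \<le> a"
  shows "distr Q borel (X a) = m"
proof (rule measure_eqI)
  show "sets (distr Q borel (X a)) = sets m" by (simp add: sets_m)
  fix A assume "A \<in> sets (distr Q borel (X a))"
  then have A: "A \<in> sets borel" by simp
  have one: "(\<lambda>_. 1) \<in> L2 m" by (intro bm_L2) simp
  have "measure Q (X a -` A \<inter> space Q) = (\<integral>w. indicator (X a -` A \<inter> space Q) w \<partial>Q)"
    by simp
  also have "\<dots> = (\<integral>w. indicator A (X a w) \<partial>Q)"
    by (intro Bochner_Integration.integral_cong) (auto simp: indicator_def)
  also have "\<dots> = ip m (indicator A) (T 0 (\<lambda>_. 1))"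
    using two_point[of a 0 "indicator A" "\<lambda>_. 1"] assms A by (simp add: bm_indicator)
  also have "\<dots> = ip m (indicator A) (\<lambda>_. 1)"
    using one T_0[OF one] A bm_indicator[OF A] by (intro ip_cong_AE) (auto intro!: L2_borel_measurable T_L2 intro: bm_L2)
  also have "\<dots> = measure m A"
    using A by (simp add: ip_def sets_m)
  finally show "emeasure (distr Q borel (X a)) A = emeasure m A"
    using A assms by (simp add: emeasure_distr Q.emeasure_eq_measure m.emeasure_eq_measure)
qed

lemma AE_X:
  assumes "AE x in m. P x" "0 \<le> a"
  shows "AE w in Q. P (X a w)"
  by (rule AE_distrD[OF X_measurable[OF assms(2)], unfolded law_X[OF assms(2)], OF assms(1)])

lemma integral_X:
  fixes F :: "'a \<Rightarrow> real"
  assumes "F \<in> borel_measurable borel" "0 \<le> a"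
  shows "(\<integral>w. F (X a w) \<partial>Q) = (\<integral>x. F x \<partial>m)"
  using integral_distr[OF X_measurable[OF assms(2)], of F] assms by (simp add: law_X)

text \<open>Measurable rectangles form an intersection-stable generator. This carries the two-point
  formula, which concerns products of functions, over to arbitrary functions of a pair, such as
  powers of increments.\<close>

lemma pair_law_eqI:
  assumes [measurable]: "U \<in> measurable Q borel" "V \<in> measurable Q borel"
      "U' \<in> measurable Q borel" "V' \<in> measurable Q borel"
    and eq: "\<And>A B. A \<in> sets (borel::'a measure) \<Longrightarrow> B \<in> sets (borel::'a measure) \<Longrightarrow>
      (\<integral>w. indicator A (U w) * (indicator B (V w) :: real) \<partial>Q) = (\<integral>w. indicator A (U' w) * indicator B (V' w) \<partial>Q)"
  shows "distr Q (borel \<Otimes>\<^sub>M borel) (\<lambda>w. (U w, V w)) = distr Q (borel \<Otimes>\<^sub>M borel) (\<lambda>w. (U' w, V' w))"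
proof (rule measure_eqI_generator_eq[OF Int_stable_pair_measure_generator, where A = "\<lambda>_. UNIV \<times> UNIV" and \<Omega> = UNIV])
  let ?G = "{a \<times> b |a b. a \<in> sets (borel::'a measure) \<and> b \<in> sets (borel::'a measure)}"
  have S: "sets ((borel::'a measure) \<Otimes>\<^sub>M (borel::'a measure)) = sigma_sets UNIV ?G"
    by (simp add: sets_pair_measure)
  show "sets (distr Q (borel \<Otimes>\<^sub>M borel) (\<lambda>w. (U w, V w))) = sigma_sets UNIV ?G"
    "sets (distr Q (borel \<Otimes>\<^sub>M borel) (\<lambda>w. (U' w, V' w))) = sigma_sets UNIV ?G"
    using S by simp_all
  have rect: "emeasure (distr Q (borel \<Otimes>\<^sub>M borel) (\<lambda>w. (U w, V w))) (A \<times> B) =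
      ennreal (\<integral>w. indicator A (U w) * indicator B (V w) \<partial>Q)"
    if [measurable]: "A \<in> sets borel" "B \<in> sets borel" "U \<in> measurable Q borel" "V \<in> measurable Q borel" for A B :: "'a set" and U V
  proof -
    have "(\<integral>w. indicator A (U w) * (indicator B (V w) :: real) \<partial>Q) =
        (\<integral>w. indicator ((\<lambda>w. (U w, V w)) -` (A \<times> B) \<inter> space Q) w \<partial>Q)"
      by (intro Bochner_Integration.integral_cong) (auto simp: indicator_def)
    also have "\<dots> = measure Q ((\<lambda>w. (U w, V w)) -` (A \<times> B) \<inter> space Q)" by simp
    finally show ?thesis by (simp add: emeasure_distr Q.emeasure_eq_measure)
  qed
  show "emeasure (distr Q (borel \<Otimes>\<^sub>M borel) (\<lambda>w. (U w, V w))) R =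
      emeasure (distr Q (borel \<Otimes>\<^sub>M borel) (\<lambda>w. (U' w, V' w))) R" if R_in: "R \<in> ?G" for R
  proof -
    obtain A B where R: "R = A \<times> B" and [measurable]: "A \<in> sets borel" "B \<in> sets borel"
      using R_in by auto
    show ?thesis unfolding R by (subst (1 2) rect) (auto simp: eq)
  qed
  show "emeasure (distr Q (borel \<Otimes>\<^sub>M borel) (\<lambda>w. (U w, V w))) (UNIV \<times> UNIV) \<noteq> \<infinity>" for i :: nat
    by (subst rect) auto
  show "range (\<lambda>_::nat. UNIV \<times> UNIV) \<subseteq> ?G" by (auto intro!: exI[of _ UNIV])
qed auto

lemma two_point':
  assumes "0 \<le> a" "a \<le> b" "F \<in> Bb" "H \<in> Bb"
  shows "(\<integral>w. F (X a w) * H (X b w) \<partial>Q) = ip m F (T (b - a) H)"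
  using two_point[of a "b - a" F H] assms by simp

lemma pair_shift:
  fixes \<Phi> :: "'a \<times> 'a \<Rightarrow> real"
  assumes [measurable]: "\<Phi> \<in> borel_measurable (borel \<Otimes>\<^sub>M borel)" and "0 \<le> a" "0 \<le> h"
  shows "(\<integral>w. \<Phi> (X a w, X (a + h) w) \<partial>Q) = (\<integral>w. \<Phi> (X 0 w, X h w) \<partial>Q)"
proof -
  have [measurable]: "X a \<in> measurable Q borel" "X (a + h) \<in> measurable Q borel"
      "X 0 \<in> measurable Q borel" "X h \<in> measurable Q borel"
    using assms by auto
  have "distr Q (borel \<Otimes>\<^sub>M borel) (\<lambda>w. (X a w, X (a + h) w)) = distr Q (borel \<Otimes>\<^sub>M borel) (\<lambda>w. (X 0 w, X h w))"
    using assms by (intro pair_law_eqI) (auto simp: two_point' bm_indicator)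
  then have eq: "integral\<^sup>L (distr Q (borel \<Otimes>\<^sub>M borel) (\<lambda>w. (X a w, X (a + h) w))) \<Phi> =
      integral\<^sup>L (distr Q (borel \<Otimes>\<^sub>M borel) (\<lambda>w. (X 0 w, X h w))) \<Phi>" by simp
  show ?thesis
    by (rule trans[OF trans[OF _ eq]]) (subst integral_distr; measurable)+
qed

text \<open>Reversibility of the process, from the symmetry of \<open>T h\<close>.\<close>

lemma pair_flip:
  fixes \<Phi> :: "'a \<times> 'a \<Rightarrow> real"
  assumes [measurable]: "\<Phi> \<in> borel_measurable (borel \<Otimes>\<^sub>M borel)" and "0 \<le> h"
  shows "(\<integral>w. \<Phi> (X h w, X 0 w) \<partial>Q) = (\<integral>w. \<Phi> (X 0 w, X h w) \<partial>Q)"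
proof -
  have [measurable]: "X 0 \<in> measurable Q borel" "X h \<in> measurable Q borel"
    using assms by auto
  have "(\<integral>w. indicator A (X h w) * (indicator B (X 0 w) :: real) \<partial>Q) =
      (\<integral>w. indicator A (X 0 w) * indicator B (X h w) \<partial>Q)"
    if "A \<in> sets borel" "B \<in> sets borel" for A B
  proof -
    have "(\<integral>w. indicator A (X h w) * (indicator B (X 0 w) :: real) \<partial>Q) =
        (\<integral>w. indicator B (X 0 w) * indicator A (X h w) \<partial>Q)" by (simp add: mult.commute)
    also have "\<dots> = ip m (indicator B) (T h (indicator A))"
      using that assms by (simp add: two_point' bm_indicator)
    also have "\<dots> = ip m (T h (indicator B)) (indicator A)"
      using that assms by (simp add: T_sym bm_indicator bm_L2)
    also have "\<dots> = (\<integral>w. indicator A (X 0 w) * indicator B (X h w) \<partial>Q)"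
      using that assms by (simp add: two_point' bm_indicator ip_commute)
    finally show ?thesis .
  qed
  then have "distr Q (borel \<Otimes>\<^sub>M borel) (\<lambda>w. (X h w, X 0 w)) = distr Q (borel \<Otimes>\<^sub>M borel) (\<lambda>w. (X 0 w, X h w))"
    by (intro pair_law_eqI) auto
  then have eq: "integral\<^sup>L (distr Q (borel \<Otimes>\<^sub>M borel) (\<lambda>w. (X h w, X 0 w))) \<Phi> =
      integral\<^sup>L (distr Q (borel \<Otimes>\<^sub>M borel) (\<lambda>w. (X 0 w, X h w))) \<Phi>" by simp
  show ?thesis
    by (rule trans[OF trans[OF _ eq]]) (subst integral_distr; measurable)+
qed

section \<open>Energies as mean squared increments; products and exponentials in
  \<open>D\<close>\<close>

lemma ip_minus_T_eq:
  assumes "0 \<le> h" "f \<in> Bb" "g \<in> Bb"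
  shows "ip m (\<lambda>x. f x - T h f x) g = (\<integral>w. (f (X h w) - f (X 0 w)) * (g (X h w) - g (X 0 w)) \<partial>Q) / 2"
proof -
  have i: "integrable Q (\<lambda>w. f (X a w) * g (X b w))" if "0 \<le> a" "0 \<le> b" for a b
    using assms that by (intro bm_Q_integrable bm_mult bm_X)
  have d: "(\<integral>w. f (X a w) * g (X a w) \<partial>Q) = ip m f g" if "0 \<le> a" for a
    using integral_X[of "\<lambda>x. f x * g x" a] that assms by (simp add: ip_def)
  have "(\<integral>w. (f (X h w) - f (X 0 w)) * (g (X h w) - g (X 0 w)) \<partial>Q) =
      (\<integral>w. f (X h w) * g (X h w) - f (X h w) * g (X 0 w) - f (X 0 w) * g (X h w) + f (X 0 w) * g (X 0 w) \<partial>Q)"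
    by (simp add: algebra_simps)
  also have "\<dots> = ip m f g - (\<integral>w. f (X h w) * g (X 0 w) \<partial>Q) - (\<integral>w. f (X 0 w) * g (X h w) \<partial>Q) + ip m f g"
    using i assms by (simp add: d)
  also have "(\<integral>w. f (X h w) * g (X 0 w) \<partial>Q) = ip m (T h f) g"
    using two_point'[of 0 h g f] assms by (simp add: mult.commute ip_commute)
  also have "(\<integral>w. f (X 0 w) * g (X h w) \<partial>Q) = ip m (T h f) g"
    using two_point'[of 0 h f g] assms by (simp add: T_sym bm_L2)
  finally show ?thesis using assms by (simp add: ip_diff_left T_L2 bm_L2)
qed

lemma en_Bb:
  assumes "0 \<le> h" "f \<in> Bb"
  shows "en h f = (\<integral>w. (f (X h w) - f (X 0 w))\<^sup>2 \<partial>Q) / (2 * h)"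
  using assms by (simp add: en_def ip_minus_T_eq power2_eq_square)

text \<open>Since energies at scale \<open>t\<close> are mean squared increments, a pointwise
  domination of increments dominates \<open>en t\<close> uniformly in \<open>t\<close>. Two
  dominating functions are allowed in order to cover products.\<close>

lemma D_if_increments_bounded:
  assumes f: "f\<^sub>1 \<in> Bb" "f\<^sub>1 \<in> D" "f\<^sub>2 \<in> Bb" "f\<^sub>2 \<in> D" and g: "g \<in> Bb"
    and le: "\<And>x y. \<bar>g x - g y\<bar> \<le> K * (\<bar>f\<^sub>1 x - f\<^sub>1 y\<bar> + \<bar>f\<^sub>2 x - f\<^sub>2 y\<bar>)"
  shows "g \<in> D"
proof (rule D_if_en_bounded[where d = 1 and c = "2 * K\<^sup>2 * (E f\<^sub>1 f\<^sub>1 + E f\<^sub>2 f\<^sub>2)"])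
  fix t :: real assume t: "0 < t" "t < 1"
  have sq: "(g x - g y)\<^sup>2 \<le> 2 * K\<^sup>2 * ((f\<^sub>1 x - f\<^sub>1 y)\<^sup>2 + (f\<^sub>2 x - f\<^sub>2 y)\<^sup>2)" for x y
  proof -
    have "(g x - g y)\<^sup>2 \<le> (K * (\<bar>f\<^sub>1 x - f\<^sub>1 y\<bar> + \<bar>f\<^sub>2 x - f\<^sub>2 y\<bar>))\<^sup>2"
      using le[of x y] by (metis abs_ge_zero power2_abs power_mono)
    also have "\<dots> \<le> K\<^sup>2 * (2 * (\<bar>f\<^sub>1 x - f\<^sub>1 y\<bar>\<^sup>2 + \<bar>f\<^sub>2 x - f\<^sub>2 y\<bar>\<^sup>2))"
      unfolding power_mult_distrib
      using sum_squares_bound[of "\<bar>f\<^sub>1 x - f\<^sub>1 y\<bar>" "\<bar>f\<^sub>2 x - f\<^sub>2 y\<bar>"]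
      by (intro mult_left_mono) (auto simp: power2_sum)
    finally show ?thesis by (simp add: algebra_simps)
  qed
  have "(\<integral>w. (g (X t w) - g (X 0 w))\<^sup>2 \<partial>Q) \<le>
      (\<integral>w. 2 * K\<^sup>2 * ((f\<^sub>1 (X t w) - f\<^sub>1 (X 0 w))\<^sup>2 + (f\<^sub>2 (X t w) - f\<^sub>2 (X 0 w))\<^sup>2) \<partial>Q)"
    using f g t sq by (intro integral_mono bm_Q_integrable bm_mult bm_add bm_power bm_diff bm_X) auto
  also have "\<dots> = 2 * K\<^sup>2 * ((\<integral>w. (f\<^sub>1 (X t w) - f\<^sub>1 (X 0 w))\<^sup>2 \<partial>Q) + (\<integral>w. (f\<^sub>2 (X t w) - f\<^sub>2 (X 0 w))\<^sup>2 \<partial>Q))"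
    using f g t by (simp add: bm_Q_integrable bm_X bm_diff bm_power)
  finally have "en t g \<le> 2 * K\<^sup>2 * (en t f\<^sub>1 + en t f\<^sub>2)"
    using t f g by (simp add: en_Bb field_simps)
  also have "\<dots> \<le> 2 * K\<^sup>2 * (E f\<^sub>1 f\<^sub>1 + E f\<^sub>2 f\<^sub>2)"
    using f t by (intro mult_left_mono add_mono en_le_E) auto
  finally show "en t g \<le> 2 * K\<^sup>2 * (E f\<^sub>1 f\<^sub>1 + E f\<^sub>2 f\<^sub>2)" .
qed (use g in \<open>auto intro: bm_L2\<close>)

lemma D_mult:
  assumes "f \<in> Bb" "f \<in> D" "g \<in> Bb" "g \<in> D"
  shows "(\<lambda>x. f x * g x) \<in> D"
proof -
  obtain a b where a: "a > 0" "\<And>x. \<bar>f x\<bar> \<le> a" and b: "b > 0" "\<And>x. \<bar>g x\<bar> \<le> b"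
    using assms by (auto elim!: bmE)
  have le: "\<bar>f x * g x - f y * g y\<bar> \<le> (a + b) * (\<bar>f x - f y\<bar> + \<bar>g x - g y\<bar>)" for x y
  proof -
    have "\<bar>f x * g x - f y * g y\<bar> = \<bar>f x * (g x - g y) + g y * (f x - f y)\<bar>" by (simp add: algebra_simps)
    also have "\<dots> \<le> \<bar>f x\<bar> * \<bar>g x - g y\<bar> + \<bar>g y\<bar> * \<bar>f x - f y\<bar>"
      by (metis abs_mult abs_triangle_ineq)
    also have "\<dots> \<le> (a + b) * \<bar>g x - g y\<bar> + (a + b) * \<bar>f x - f y\<bar>"
      using a(2)[of x] b(2)[of y] a(1) b(1) by (intro add_mono mult_right_mono) auto
    finally show ?thesis by (simp add: algebra_simps)
  qed
  show ?thesis
    by (rule D_if_increments_bounded[OF assms bm_mult[OF assms(1,3)] le])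
qed

lemma Bb_exp:
  assumes "f \<in> Bb"
  shows "(\<lambda>x. exp (\<alpha> * f x)) \<in> Bb"
proof -
  obtain c where c: "c > 0" "\<And>x. \<bar>f x\<bar> \<le> c" using assms by (metis bmE)
  have "\<alpha> * f x \<le> \<bar>\<alpha>\<bar> * c" for x
    using c(2)[of x] by (metis abs_ge_zero abs_le_D1 abs_mult mult_left_mono)
  then show ?thesis
    using assms by (intro bmI[of _ _ "exp (\<bar>\<alpha>\<bar> * c)"]) auto
qed

lemma exp_diff_le: "\<bar>exp a - exp b\<bar> \<le> max (exp a) (exp b) * \<bar>a - b\<bar>" for a b :: real
proof -
  have *: "exp b - exp a \<le> exp b * (b - a)" for a b :: real
  proof -
    have "1 + (a - b) \<le> exp (a - b)" by (rule exp_ge_add_one_self)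
    then have "exp b * (1 + (a - b)) \<le> exp b * exp (a - b)" by (intro mult_left_mono) auto
    then show ?thesis by (simp add: exp_diff algebra_simps)
  qed
  show ?thesis
    using *[of a b] *[of b a] by (cases "a \<le> b") (auto simp: abs_if max_def)
qed

lemma D_exp:
  assumes "f \<in> Bb" "f \<in> D"
  shows "(\<lambda>x. exp (\<alpha> * f x)) \<in> D"
proof -
  obtain c where c: "c > 0" "\<And>x. \<bar>exp (\<alpha> * f x)\<bar> \<le> c"
    using Bb_exp[OF assms(1)] by (metis bmE)
  have le: "\<bar>exp (\<alpha> * f x) - exp (\<alpha> * f y)\<bar> \<le> (c * \<bar>\<alpha>\<bar>) * (\<bar>f x - f y\<bar> + \<bar>f x - f y\<bar>)" for x y
  proof -
    have "\<bar>exp (\<alpha> * f x) - exp (\<alpha> * f y)\<bar> \<le> max (exp (\<alpha> * f x)) (exp (\<alpha> * f y)) * \<bar>\<alpha> * f x - \<alpha> * f y\<bar>"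
      by (rule exp_diff_le)
    also have "\<dots> \<le> c * \<bar>\<alpha> * f x - \<alpha> * f y\<bar>"
      using c(2)[of x] c(2)[of y] by (intro mult_right_mono) auto
    also have "\<dots> = c * \<bar>\<alpha>\<bar> * \<bar>f x - f y\<bar>"
      by (simp add: abs_mult flip: right_diff_distrib)
    also have "\<dots> \<le> (c * \<bar>\<alpha>\<bar>) * (\<bar>f x - f y\<bar> + \<bar>f x - f y\<bar>)"
      using c by (intro mult_left_mono) auto
    finally show ?thesis .
  qed
  show ?thesis
    by (rule D_if_increments_bounded[OF assms assms Bb_exp[OF assms(1)] le])
qed

text \<open>Expanding the square and applying the two-point formula gives
  \<open>2 <f - T t f, f h> - <f^2 - T t f^2, h>\<close> before any limit, the same combination that
  defines \<open>Iform\<close> with two of its three terms merged by symmetry. Dividing by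
  \<open>t\<close> and using \<open>E_lim\<close> finishes.\<close>

lemma Iform_lim:
  assumes f: "f \<in> Bb" "f \<in> D" and h: "h \<in> Bb" "h \<in> D"
  shows "((\<lambda>t. (\<integral>w. h (X 0 w) * (f (X t w) - f (X 0 w))\<^sup>2 \<partial>Q) / t) \<longlongrightarrow> Iform E f f h) (at_right 0)"
proof -
  let ?fh = "\<lambda>x. f x * h x" and ?ff = "\<lambda>x. f x * f x"
  have D: "?fh \<in> D" "?ff \<in> D" and B: "?fh \<in> Bb" "?ff \<in> Bb"
    using f h by (auto intro: D_mult)
  have eq: "(\<integral>w. h (X 0 w) * (f (X t w) - f (X 0 w))\<^sup>2 \<partial>Q) =
      2 * ip m (\<lambda>x. f x - T t f x) ?fh - ip m (\<lambda>x. ?ff x - T t ?ff x) h" if t: "0 < t" for t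
  proof -
    have "(\<integral>w. h (X 0 w) * (f (X t w) - f (X 0 w))\<^sup>2 \<partial>Q) =
      (\<integral>w. h (X 0 w) * ?ff (X t w) - 2 * (?fh (X 0 w) * f (X t w)) + (h (X 0 w) * ?ff (X 0 w)) \<partial>Q)"
      by (simp add: power2_eq_square algebra_simps)
    also have "\<dots> = (\<integral>w. h (X 0 w) * ?ff (X t w) \<partial>Q) - 2 * (\<integral>w. ?fh (X 0 w) * f (X t w) \<partial>Q) + (\<integral>w. h (X 0 w) * ?ff (X 0 w) \<partial>Q)"
    proof -
      have "integrable Q (\<lambda>w. h (X 0 w) * ?ff (X t w))" "integrable Q (\<lambda>w. ?fh (X 0 w) * f (X t w))"
        "integrable Q (\<lambda>w. h (X 0 w) * ?ff (X 0 w))"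
        using f h t by (intro bm_Q_integrable bm_mult bm_X; simp)+
      then show ?thesis by simp
    qed
    also have "(\<integral>w. h (X 0 w) * ?ff (X t w) \<partial>Q) = ip m h (T t ?ff)"
      using two_point'[of 0 t h ?ff] B h t by simp
    also have "(\<integral>w. ?fh (X 0 w) * f (X t w) \<partial>Q) = ip m ?fh (T t f)"
      using two_point'[of 0 t ?fh f] B f t by simp
    also have "(\<integral>w. h (X 0 w) * ?ff (X 0 w) \<partial>Q) = ip m h ?ff"
      using integral_X[of "\<lambda>x. h x * ?ff x" 0] B h by (simp add: ip_def bm_borel_measurable)
    finally have "(\<integral>w. h (X 0 w) * (f (X t w) - f (X 0 w))\<^sup>2 \<partial>Q) =
        ip m h (T t ?ff) - 2 * ip m ?fh (T t f) + ip m h ?ff" .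
    moreover have "ip m f ?fh = ip m h ?ff" by (simp add: ip_def algebra_simps)
    ultimately show ?thesis
      using B f h t
      by (simp add: ip_diff_left T_L2 bm_L2) (simp add: ip_commute[of m _ h] ip_commute[of m "\<lambda>x. f x * h x"])
  qed
  have "((\<lambda>t. 2 * (ip m (\<lambda>x. f x - T t f x) ?fh / t) - ip m (\<lambda>x. ?ff x - T t ?ff x) h / t)
      \<longlongrightarrow> 2 * E f ?fh - E ?ff h) (at_right 0)"
    using f h D by (intro tendsto_intros E_lim)
  moreover have "2 * E f ?fh - E ?ff h = Iform E f f h"
    using E_sym[OF f(2) D(1)] by (simp add: Iform_def)
  ultimately show ?thesis
  proof (simp only:, elim Lim_transform_eventually)
    show "\<forall>\<^sub>F t in at_right 0. 2 * (ip m (\<lambda>x. f x - T t f x) ?fh / t) - ip m (\<lambda>x. ?ff x - T t ?ff x) h / t =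
        (\<integral>w. h (X 0 w) * (f (X t w) - f (X 0 w))\<^sup>2 \<partial>Q) / t"
      using eventually_at_right_less[of 0]
      by eventually_elim (simp add: eq diff_divide_distrib)
  qed
qed

text \<open>The clauses of \<open>sym_markov_semigroup\<close> are about L2 only; the pointwise
  bound is read off from the process, by testing against the indicator of the set where the bound
  fails.\<close>

lemma T_upper:
  assumes "F \<in> Bb" "\<And>x. F x \<le> c" "0 \<le> h"
  shows "AE x in m. T h F x \<le> c"
proof -
  have TF: "T h F \<in> L2 m" using assms by (auto intro: bm_L2)
  then have [measurable]: "T h F \<in> borel_measurable borel" by (simp add: L2_def borel_measurable_m)
  define A where "A = {x. T h F x > c}"
  have A[measurable]: "A \<in> sets borel" unfolding A_def by measurable
  have iA: "indicator A \<in> Bb" by (rule bm_indicator[OF A])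
  have int: "integrable m (\<lambda>x. indicator A x * T h F x)" "integrable m (\<lambda>x. c * indicator A x)"
    using L2_integrable_mult[OF bm_L2[OF iA] TF] bm_integrable[OF iA] by auto
  have "(\<integral>x. indicator A x * T h F x \<partial>m) = (\<integral>w. indicator A (X 0 w) * F (X h w) \<partial>Q)"
    using two_point'[of 0 h "indicator A" F] assms iA by (simp add: ip_def)
  also have "\<dots> \<le> (\<integral>w. c * indicator A (X 0 w) \<partial>Q)"
  proof (intro integral_mono bm_Q_integrable bm_mult bm_X bm_const)
    show "indicator A (X 0 w) * F (X h w) \<le> c * indicator A (X 0 w)" for w
      using assms(2)[of "X h w"] by (auto simp: indicator_def)
  qed (use assms iA in auto)
  also have "\<dots> = (\<integral>x. c * indicator A x \<partial>m)"
    using integral_X[of "\<lambda>x. c * indicator A x" 0] by simp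
  finally have "(\<integral>x. indicator A x * T h F x - c * indicator A x \<partial>m) \<le> 0"
    using int by simp
  moreover have nn: "AE x in m. 0 \<le> indicator A x * T h F x - c * indicator A x"
    by (auto simp: A_def indicator_def)
  ultimately have "(\<integral>x. indicator A x * T h F x - c * indicator A x \<partial>m) = 0"
    using integral_nonneg_AE[OF nn] by simp
  then have "AE x in m. indicator A x * T h F x - c * indicator A x = 0"
    using integral_nonneg_eq_0_iff_AE[OF _ nn] int by simp
  then show ?thesis by eventually_elim (auto simp: A_def indicator_def split: if_splits)
qed

lemma T_abs_le:
  assumes "F \<in> Bb" "\<And>x. \<bar>F x\<bar> \<le> c" "0 \<le> h"
  shows "AE x in m. \<bar>T h F x\<bar> \<le> c"
proof -
  have "AE x in m. T h F x \<le> c" using assms by (intro T_upper) (auto intro: abs_le_D1)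
  moreover have "AE x in m. T h (\<lambda>x. - F x) x \<le> c"
    using assms by (intro T_upper) (auto intro: abs_le_D2)
  moreover have "AE x in m. T h (\<lambda>x. - F x) x = - T h F x"
    using T_lincomb[of h F F "-1" 0] assms by (simp add: bm_L2)
  ultimately show ?thesis by eventually_elim auto
qed

text \<open>\<open>T h F\<close> is an L2 function fixed up to null sets, whereas the process
  formula takes functions that are bounded everywhere. Truncation at the sup bound changes
  \<open>T h F\<close> on a null set only.\<close>

lemma T_representative:
  assumes "F \<in> Bb" "\<And>x. \<bar>F x\<bar> \<le> c" "0 \<le> h"
  obtains F' where "F' \<in> Bb" "\<And>x. \<bar>F' x\<bar> \<le> c" "AE x in m. T h F x = F' x"
proof
  have c: "0 \<le> c" using assms(2)[of undefined] by linarith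
  let ?F = "\<lambda>x. max (- c) (min c (T h F x))"
  have "T h F \<in> L2 m" using assms by (auto intro: bm_L2)
  then have [measurable]: "T h F \<in> borel_measurable borel" by (simp add: L2_def borel_measurable_m)
  show le: "\<bar>?F x\<bar> \<le> c" for x using c by auto
  show "?F \<in> Bb" using le by (intro bmI[of _ _ c]) auto
  show "AE x in m. T h F x = ?F x"
    using T_abs_le[OF assms] by eventually_elim auto
qed

section \<open>Semigroup chains and the integrated Markov property\<close>

lemma sg_chain_L2:
  assumes "\<And>h f. (h, f) \<in> set ps \<Longrightarrow> 0 \<le> h \<and> f \<in> Bb"
  shows "sg_chain T ps \<in> L2 m"
  using assms
proof (induction ps)
  case Nil
  show ?case by (auto intro: bm_L2)
next
  case (Cons p ps)
  obtain h f where p: "p = (h, f)" by (cases p)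
  have "0 \<le> h" "f \<in> Bb" using Cons.prems[of h f] p by auto
  moreover have "sg_chain T ps \<in> L2 m" using Cons by auto
  ultimately show ?case using p by (auto intro!: T_L2 L2_bm_mult)
qed

lemma sg_chain_append_cong:
  assumes "\<And>h f. (h, f) \<in> set ps \<Longrightarrow> 0 \<le> h \<and> f \<in> Bb"
    and "sg_chain T qs \<in> L2 m" "sg_chain T qs' \<in> L2 m"
    and "AE x in m. sg_chain T qs x = sg_chain T qs' x"
  shows "sg_chain T (ps @ qs) \<in> L2 m \<and> sg_chain T (ps @ qs') \<in> L2 m \<and>
    (AE x in m. sg_chain T (ps @ qs) x = sg_chain T (ps @ qs') x)"
  using assms(1)
proof (induction ps)
  case (Cons p ps)
  obtain h f where p: "p = (h, f)" by (cases p)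
  have hf: "0 \<le> h" "f \<in> Bb" using Cons.prems[of h f] p by auto
  have IH: "sg_chain T (ps @ qs) \<in> L2 m" "sg_chain T (ps @ qs') \<in> L2 m"
    "AE x in m. sg_chain T (ps @ qs) x = sg_chain T (ps @ qs') x"
    using Cons.IH Cons.prems by auto
  have "AE x in m. f x * sg_chain T (ps @ qs) x = f x * sg_chain T (ps @ qs') x"
    using IH(3) by eventually_elim simp
  then have "AE x in m. T h (\<lambda>x. f x * sg_chain T (ps @ qs) x) x = T h (\<lambda>x. f x * sg_chain T (ps @ qs') x) x"
    using hf IH by (intro T_cong L2_bm_mult)
  then show ?case
    using hf IH(1,2) p by (auto intro!: T_L2 L2_bm_mult)
qed (use assms in auto)

text \<open>The simple Markov property at the last step, without conditional expectations: against
  any product of functions at earlier times, \<open>K\<close> at the last time may be replaced by a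
  version of \<open>T h K\<close> one step before.\<close>

lemma markov_last:
  assumes "\<And>h f. (h, f) \<in> set ps \<Longrightarrow> 0 \<le> h \<and> f \<in> Bb"
    and "0 \<le> a" "0 \<le> h" "F \<in> Bb" "K \<in> Bb" "K' \<in> Bb" "AE x in m. T h K x = K' x"
  shows "(\<integral>w. path_prod X w 0 (ps @ [(a, F), (h, K)]) \<partial>Q) =
    (\<integral>w. path_prod X w 0 (ps @ [(a, \<lambda>x. F x * K' x)]) \<partial>Q)"
proof -
  let ?qs = "[(a, F), (h, K)]" and ?qs' = "[(a, \<lambda>x. F x * K' x)]"
  have L: "sg_chain T ?qs \<in> L2 m" "sg_chain T ?qs' \<in> L2 m"
    using assms(2-6) by (intro sg_chain_L2; auto)+
  have "AE x in m. F x * T h K x = F x * K' x"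
    using assms(7) by eventually_elim simp
  then have "AE x in m. T a (\<lambda>x. F x * T h K x) x = T a (\<lambda>x. F x * K' x) x"
    using assms(2-6) by (intro T_cong L2_bm_mult) (auto intro: bm_L2)
  then have "AE x in m. sg_chain T ?qs x = sg_chain T ?qs' x" by simp
  note cong = sg_chain_append_cong[of ps, OF assms(1) L this]
  have "(\<integral>w. path_prod X w 0 (ps @ ?qs) \<partial>Q) = (\<integral>x. sg_chain T (ps @ ?qs) x \<partial>m)"
    using assms by (intro process_formula) auto
  also have "\<dots> = (\<integral>x. sg_chain T (ps @ ?qs') x \<partial>m)"
    using cong by (intro integral_cong_AE) (auto intro!: L2_borel_measurable)
  also have "\<dots> = (\<integral>w. path_prod X w 0 (ps @ ?qs') \<partial>Q)"
    using assms by (intro process_formula[symmetric]) auto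
  finally show ?thesis .
qed

section \<open>Quadratic variation along a partition\<close>

lemma markov_three:
  assumes "0 \<le> s\<^sub>0" "s\<^sub>0 \<le> s\<^sub>1" "s\<^sub>1 \<le> s\<^sub>2" "F\<^sub>0 \<in> Bb" "F\<^sub>1 \<in> Bb" "K \<in> Bb" "K' \<in> Bb"
    and "AE x in m. T (s\<^sub>2 - s\<^sub>1) K x = K' x"
  shows "(\<integral>w. F\<^sub>0 (X s\<^sub>0 w) * F\<^sub>1 (X s\<^sub>1 w) * K (X s\<^sub>2 w) \<partial>Q) =
    (\<integral>w. F\<^sub>0 (X s\<^sub>0 w) * F\<^sub>1 (X s\<^sub>1 w) * K' (X s\<^sub>1 w) \<partial>Q)"
  using markov_last[of "[(s\<^sub>0, F\<^sub>0)]" "s\<^sub>1 - s\<^sub>0" "s\<^sub>2 - s\<^sub>1" F\<^sub>1 K K'] assms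
  by (simp add: mult.assoc)

text \<open>The first two times carry test functions for one increment of the path, the last two
  carry a later increment that is being conditioned on its left endpoint.\<close>

lemma markov_four:
  assumes "0 \<le> s\<^sub>0" "s\<^sub>0 \<le> s\<^sub>1" "s\<^sub>1 \<le> s\<^sub>2" "s\<^sub>2 \<le> s\<^sub>3" "F\<^sub>0 \<in> Bb" "F\<^sub>1 \<in> Bb" "F \<in> Bb" "K \<in> Bb" "K' \<in> Bb"
    and "AE x in m. T (s\<^sub>3 - s\<^sub>2) K x = K' x"
  shows "(\<integral>w. F\<^sub>0 (X s\<^sub>0 w) * F\<^sub>1 (X s\<^sub>1 w) * (F (X s\<^sub>2 w) * K (X s\<^sub>3 w)) \<partial>Q) =
    (\<integral>w. F\<^sub>0 (X s\<^sub>0 w) * F\<^sub>1 (X s\<^sub>1 w) * (F (X s\<^sub>2 w) * K' (X s\<^sub>2 w)) \<partial>Q)"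
proof -
  have ok: "0 \<le> h \<and> f \<in> Bb" if "(h, f) \<in> set [(s\<^sub>0, F\<^sub>0), (s\<^sub>1 - s\<^sub>0, F\<^sub>1)]" for h f
    using that assms by auto
  show ?thesis
    using markov_last[of "[(s\<^sub>0, F\<^sub>0), (s\<^sub>1 - s\<^sub>0, F\<^sub>1)]" "s\<^sub>2 - s\<^sub>1" "s\<^sub>3 - s\<^sub>2" F K K', OF ok] assms
    by (simp add: mult.assoc)
qed

definition inc :: "('a \<Rightarrow> real) \<Rightarrow> real \<Rightarrow> nat \<Rightarrow> 'w \<Rightarrow> real" where
  "inc g \<tau> i w = g (X (real (Suc i) * \<tau>) w) - g (X (real i * \<tau>) w)"

lemma inc_bm[intro]:
  assumes "g \<in> Bb" "0 \<le> \<tau>"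
  shows "inc g \<tau> i \<in> bm Q"
  unfolding inc_def[abs_def] using assms by (intro bm_diff bm_X) auto

lemma inc_0: "inc g \<tau> 0 w = g (X \<tau> w) - g (X 0 w)"
  by (simp add: inc_def)

lemma inc_abs_le:
  assumes "\<And>x. \<bar>g x\<bar> \<le> C"
  shows "\<bar>inc g \<tau> i w\<bar> \<le> 2 * C"
  using assms[of "X (real (Suc i) * \<tau>) w"] assms[of "X (real i * \<tau>) w"] unfolding inc_def by linarith

lemma inc_diff: "inc (\<lambda>x. f x - g x) \<tau> i w = inc f \<tau> i w - inc g \<tau> i w"
  by (simp add: inc_def)

lemma integral_inc_power:
  assumes "g \<in> Bb" "0 \<le> \<tau>"
  shows "(\<integral>w. (inc g \<tau> i w) ^ k \<partial>Q) = (\<integral>w. (inc g \<tau> 0 w) ^ k \<partial>Q)"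
proof -
  have [measurable]: "g \<in> borel_measurable borel" using assms by (rule_tac bm_borel_measurable)
  have "(\<lambda>(x, y). (g y - g x) ^ k) \<in> borel_measurable (borel \<Otimes>\<^sub>M borel)" by measurable
  from pair_shift[OF this, of "real i * \<tau>" \<tau>] show ?thesis
    using assms by (simp add: inc_def algebra_simps)
qed

text \<open>The squared increment is a sum of three products of a function at \<open>a\<close> and a
  function at \<open>b\<close>, so an identity known for all such products extends to it.\<close>

lemma square_increment_test:
  assumes "g \<in> Bb" "0 \<le> a" "0 \<le> b" "Y \<in> bm Q" "Z \<in> bm Q"
    and eq: "\<And>F\<^sub>0 F\<^sub>1. F\<^sub>0 \<in> Bb \<Longrightarrow> F\<^sub>1 \<in> Bb \<Longrightarrow>
      (\<integral>w. F\<^sub>0 (X a w) * F\<^sub>1 (X b w) * Y w \<partial>Q) = (\<integral>w. F\<^sub>0 (X a w) * F\<^sub>1 (X b w) * Z w \<partial>Q)"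
  shows "(\<integral>w. (g (X b w) - g (X a w))\<^sup>2 * Y w \<partial>Q) = (\<integral>w. (g (X b w) - g (X a w))\<^sup>2 * Z w \<partial>Q)"
proof -
  have expand: "(\<integral>w. (g (X b w) - g (X a w))\<^sup>2 * U w \<partial>Q) =
      (\<integral>w. 1 * (g (X b w))\<^sup>2 * U w \<partial>Q) - 2 * (\<integral>w. g (X a w) * g (X b w) * U w \<partial>Q) +
      (\<integral>w. (g (X a w))\<^sup>2 * 1 * U w \<partial>Q)" if "U \<in> bm Q" for U
  proof -
    have i: "integrable Q (\<lambda>w. 1 * (g (X b w))\<^sup>2 * U w)" "integrable Q (\<lambda>w. g (X a w) * g (X b w) * U w)"
      "integrable Q (\<lambda>w. (g (X a w))\<^sup>2 * 1 * U w)"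
      using assms that by (intro bm_Q_integrable bm_mult bm_power bm_X bm_const; simp)+
    have "(\<integral>w. (g (X b w) - g (X a w))\<^sup>2 * U w \<partial>Q) =
        (\<integral>w. 1 * (g (X b w))\<^sup>2 * U w - 2 * (g (X a w) * g (X b w) * U w) + (g (X a w))\<^sup>2 * 1 * U w \<partial>Q)"
      by (simp add: power2_eq_square algebra_simps)
    then show ?thesis using i by simp
  qed
  show ?thesis
    unfolding expand[OF assms(4)] expand[OF assms(5)]
    using eq[of "\<lambda>_. 1" "\<lambda>x. (g x)\<^sup>2"] eq[of g g] eq[of "\<lambda>x. (g x)\<^sup>2" "\<lambda>_. 1"] assms(1) bm_power[OF assms(1), of 2]
    by simp
qed

lemma square_sum_expand:
  "(\<Sum>i<n. a i)\<^sup>2 = (\<Sum>i<n. (a i)\<^sup>2) + 2 * (\<Sum>i<n. a i * (\<Sum>j = Suc i..<n. a j))" for a :: "nat \<Rightarrow> real"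
proof (induction n)
  case (Suc n)
  have "(\<Sum>i<Suc n. a i * (\<Sum>j = Suc i..<Suc n. a j)) = (\<Sum>i<n. a i * ((\<Sum>j = Suc i..<n. a j) + a n))"
    by (auto intro!: sum.cong)
  also have "\<dots> = (\<Sum>i<n. a i * (\<Sum>j = Suc i..<n. a j)) + (\<Sum>i<n. a i) * a n"
    by (simp add: distrib_left sum.distrib sum_distrib_right)
  finally show ?case using Suc by (simp add: power2_sum algebra_simps)
qed simp

lemma T_upper_AE:
  assumes "F \<in> Bb" "AE x in m. F x \<le> c" "0 \<le> h"
  shows "AE x in m. T h F x \<le> c"
proof -
  obtain b where b: "\<And>x. \<bar>F x\<bar> \<le> b" using assms by (metis bmE)
  have F': "(\<lambda>x. min (F x) c) \<in> Bb"
  proof (rule bmI[of _ _ "b + \<bar>c\<bar>"])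
    show "(\<lambda>x. min (F x) c) \<in> borel_measurable borel" using assms by measurable
    show "\<bar>min (F x) c\<bar> \<le> b + \<bar>c\<bar>" for x using b[of x] by auto
  qed
  have "AE x in m. F x = min (F x) c" using assms(2) by eventually_elim auto
  then have "AE x in m. T h F x = T h (\<lambda>x. min (F x) c) x"
    using assms F' by (intro T_cong) (auto intro: bm_L2)
  moreover have "AE x in m. T h (\<lambda>x. min (F x) c) x \<le> c"
    using F' assms by (intro T_upper) auto
  ultimately show ?thesis by eventually_elim simp
qed

text \<open>The sum telescopes because \<open>\<gamma> = (T \<tau> g\<^sup>2 - g\<^sup>2) + 2 g (g - T \<tau> g)\<close>.\<close>

lemma sum_T_carre_le:
  assumes g: "g \<in> Bb" "\<And>x. \<bar>g x\<bar> \<le> C" and "0 < \<tau>" "0 \<le> K"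
    and small: "AE x in m. \<bar>T \<tau> g x - g x\<bar> \<le> K * \<tau>"
    and \<gamma>: "\<gamma> \<in> Bb" "AE x in m. \<gamma> x = T \<tau> (\<lambda>x. (g x)\<^sup>2) x - 2 * g x * T \<tau> g x + (g x)\<^sup>2"
    and \<gamma>s: "\<And>k::nat. AE x in m. T (real k * \<tau>) \<gamma> x = \<gamma>s k x"
    and "real N * \<tau> \<le> 1"
  shows "AE x in m. (\<Sum>k<N. \<gamma>s k x) \<le> C\<^sup>2 + 2 * C * K"
proof -
  have C: "0 \<le> C" using g(2)[of undefined] by linarith
  let ?g2 = "\<lambda>x. (g x)\<^sup>2"
  have g2: "?g2 \<in> Bb" using g by auto
  obtain g' where g': "g' \<in> Bb" "AE x in m. T \<tau> g x = g' x"
    using T_representative[OF g, of \<tau>] \<open>0 < \<tau>\<close> by auto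
  define e where "e x = 2 * g x * (g x - g' x)" for x
  have e: "e \<in> Bb" unfolding e_def[abs_def] using g g' by (intro bm_mult bm_const bm_diff)
  have e_le: "AE x in m. e x \<le> 2 * C * K * \<tau>"
    using g'(2) small
  proof eventually_elim
    case (elim x)
    have "\<bar>e x\<bar> = 2 * (\<bar>g x\<bar> * \<bar>g x - g' x\<bar>)" by (simp add: e_def abs_mult)
    also have "\<dots> \<le> 2 * (C * (K * \<tau>))"
      using elim g(2)[of x] C by (intro mult_left_mono mult_mono) (auto simp: abs_minus_commute)
    finally show ?case by (simp add: mult.assoc)
  qed
  have step: "AE x in m. \<gamma>s k x \<le> T (real (Suc k) * \<tau>) ?g2 x - T (real k * \<tau>) ?g2 x + 2 * C * K * \<tau>" for k
  proof -
    let ?t = "real k * \<tau>"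
    have t: "0 \<le> ?t" using assms by auto
    have L: "T \<tau> ?g2 \<in> L2 m" "?g2 \<in> L2 m" "e \<in> L2 m" "\<gamma> \<in> L2 m"
      using assms g2 e by (auto intro: bm_L2)
    have "AE x in m. \<gamma> x = (T \<tau> ?g2 x - ?g2 x) + e x"
      using \<gamma>(2) g'(2) by eventually_elim (simp add: e_def power2_eq_square algebra_simps)
    then have "AE x in m. \<gamma> x = 1 * (T \<tau> ?g2 x - ?g2 x) + 1 * e x" by simp
    then have "AE x in m. T ?t \<gamma> x = T ?t (\<lambda>x. 1 * (T \<tau> ?g2 x - ?g2 x) + 1 * e x) x"
      using L t by (intro T_cong L2_lincomb L2_diff) auto
    moreover have "AE x in m. T ?t (\<lambda>x. 1 * (T \<tau> ?g2 x - ?g2 x) + 1 * e x) x =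
        1 * T ?t (\<lambda>x. T \<tau> ?g2 x - ?g2 x) x + 1 * T ?t e x"
      using L t by (intro T_lincomb L2_diff) auto
    moreover have "AE x in m. T ?t (\<lambda>x. T \<tau> ?g2 x - ?g2 x) x = T ?t (T \<tau> ?g2) x - T ?t ?g2 x"
      using L t by (intro T_diff) auto
    moreover have "AE x in m. T (?t + \<tau>) ?g2 x = T ?t (T \<tau> ?g2) x"
      using L t assms by (intro T_add) auto
    moreover have "AE x in m. T ?t e x \<le> 2 * C * K * \<tau>"
      using e e_le t by (rule T_upper_AE)
    ultimately show ?thesis using \<gamma>s[of k]
    proof eventually_elim
      case (elim x)
      then show ?case by (simp add: distrib_right add.commute)
    qed
  qed
  have tele: "AE x in m. (\<Sum>k<N. \<gamma>s k x) \<le> T (real N * \<tau>) ?g2 x - T 0 ?g2 x + real N * (2 * C * K * \<tau>)" for N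
  proof (induction N)
    case (Suc N)
    from Suc step[of N] show ?case by eventually_elim (simp add: algebra_simps)
  qed simp
  have up: "AE x in m. T (real N * \<tau>) ?g2 x \<le> C\<^sup>2"
  proof (rule T_upper[OF g2])
    show "(g x)\<^sup>2 \<le> C\<^sup>2" for x using g(2)[of x] by (metis abs_ge_zero power2_abs power_mono)
  qed (use assms in auto)
  have T0: "AE x in m. T 0 ?g2 x = ?g2 x" using g2 by (intro T_0 bm_L2)
  have drift: "real N * (2 * C * K * \<tau>) \<le> 2 * C * K"
    using mult_right_mono[OF \<open>real N * \<tau> \<le> 1\<close>, of "2 * C * K"] C \<open>0 \<le> K\<close> by (simp add: algebra_simps)
  from tele[of N] up T0 show ?thesis
  proof eventually_elim
    case (elim x)
    moreover have "0 \<le> (g x)\<^sup>2" by simp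
    ultimately show ?case using drift by linarith
  qed
qed

text \<open>After \<open>square_sum_expand\<close>, the diagonal is controlled by the bound
  \<open>2 * C\<close> on increments, giving \<open>4 * C^2\<close>. Off the diagonal, conditioning
  at the right end of the earlier increment turns the sum of the later squared increments into a sum
  of \<open>T (k \<tau>) \<gamma>\<close>, at most \<open>C^2 + 2 * C * K\<close> by
  \<open>sum_T_carre_le\<close>. Twice this plus the diagonal gives
  \<open>6 * C^2 + 4 * C * K\<close>.\<close>

lemma quadratic_variation_second_moment:
  assumes g: "g \<in> Bb" "\<And>x. \<bar>g x\<bar> \<le> C" and \<tau>: "0 < \<tau>" and K: "0 \<le> K"
    and small: "AE x in m. \<bar>T \<tau> g x - g x\<bar> \<le> K * \<tau>" and n: "real n * \<tau> \<le> 1"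
  shows "(\<integral>w. (\<Sum>i<n. (inc g \<tau> i w)\<^sup>2)\<^sup>2 \<partial>Q) \<le>
    (6 * C\<^sup>2 + 4 * C * K) * (real n * (\<integral>w. (inc g \<tau> 0 w)\<^sup>2 \<partial>Q))"
proof -
  let ?g2 = "\<lambda>x. (g x)\<^sup>2" and ?B = "C\<^sup>2 + 2 * C * K" and ?t = "\<lambda>i::nat. real i * \<tau>"
  have g2: "?g2 \<in> Bb" using g by auto
  obtain g' where g': "g' \<in> Bb" "AE x in m. T \<tau> g x = g' x"
    using T_representative[OF g, of \<tau>] \<tau> by auto
  obtain c where c: "\<And>x. \<bar>?g2 x\<bar> \<le> c" using g2 by (metis bmE)
  obtain k where k: "k \<in> Bb" "AE x in m. T \<tau> ?g2 x = k x"
    using T_representative[OF g2 c, of \<tau>] \<tau> by auto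
  \<comment> \<open>A bounded version of the conditional second moment of
    \<open>g (X \<tau>) - g (X 0)\<close> given \<open>X 0\<close>.\<close>
  define \<gamma> where "\<gamma> x = k x - 2 * (g x * g' x) + ?g2 x" for x
  have \<gamma>: "\<gamma> \<in> Bb" unfolding \<gamma>_def[abs_def] using k g g' g2 by (intro bm_add bm_diff bm_mult bm_const)
  obtain b where b: "\<And>x. \<bar>\<gamma> x\<bar> \<le> b" using \<gamma> by (metis bmE)
  have "\<exists>F. F \<in> Bb \<and> (AE x in m. T (real k * \<tau>) \<gamma> x = F x)" for k :: nat
    using T_representative[OF \<gamma> b, of "real k * \<tau>"] \<tau> by (metis of_nat_0_le_iff less_imp_le mult_nonneg_nonneg)
  then obtain \<gamma>s where \<gamma>s: "\<And>k. \<gamma>s k \<in> Bb" "\<And>k::nat. AE x in m. T (real k * \<tau>) \<gamma> x = \<gamma>s k x"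
    by metis
  have t_mono: "?t i \<le> ?t j" if "i \<le> j" for i j using that \<tau> by (intro mult_right_mono) auto
  have t_nn: "0 \<le> ?t i" for i using \<tau> by simp
  \<comment> \<open>Two conditionings: the later squared increment on its own left endpoint, which
    yields \<open>\<gamma>\<close>, and then \<open>\<gamma>\<close> on the right endpoint of the
    earlier increment, \<open>j - Suc i\<close> cells before.\<close>
  have pair: "(\<integral>w. (inc g \<tau> i w)\<^sup>2 * (inc g \<tau> j w)\<^sup>2 \<partial>Q) =
      (\<integral>w. (inc g \<tau> i w)\<^sup>2 * \<gamma>s (j - Suc i) (X (?t (Suc i)) w) \<partial>Q)" if ij: "i < j" for i j
    unfolding inc_def[of g \<tau> i]
  proof (rule square_increment_test)
    fix F\<^sub>0 F\<^sub>1 :: "'a \<Rightarrow> real" assume F: "F\<^sub>0 \<in> Bb" "F\<^sub>1 \<in> Bb"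
    let ?P = "\<lambda>w. F\<^sub>0 (X (?t i) w) * F\<^sub>1 (X (?t (Suc i)) w)"
    have P: "?P \<in> bm Q" using F t_nn by (intro bm_mult bm_X)
    have m4: "(\<integral>w. ?P w * (F (X (?t j) w) * K (X (?t (Suc j)) w)) \<partial>Q) =
        (\<integral>w. ?P w * (F (X (?t j) w) * K' (X (?t j) w)) \<partial>Q)"
      if "F \<in> Bb" "K \<in> Bb" "K' \<in> Bb" "AE x in m. T \<tau> K x = K' x" for F K K'
    proof (rule markov_four)
      have "?t (Suc j) - ?t j = \<tau>" by (simp add: algebra_simps)
      then show "AE x in m. T (?t (Suc j) - ?t j) K x = K' x" using that by simp
    qed (use that F ij t_nn t_mono[of i "Suc i"] t_mono[of "Suc i" j] t_mono[of j "Suc j"] in auto)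
    have split: "(\<integral>w. ?P w * (U w - 2 * V w + W w) \<partial>Q) =
        (\<integral>w. ?P w * U w \<partial>Q) - 2 * (\<integral>w. ?P w * V w \<partial>Q) + (\<integral>w. ?P w * W w \<partial>Q)"
      if "U \<in> bm Q" "V \<in> bm Q" "W \<in> bm Q" for U V W
    proof -
      have i: "integrable Q (\<lambda>w. ?P w * U w)" "integrable Q (\<lambda>w. ?P w * V w)" "integrable Q (\<lambda>w. ?P w * W w)"
        by (intro bm_Q_integrable bm_mult[OF P] that)+
      have "(\<integral>w. ?P w * (U w - 2 * V w + W w) \<partial>Q) = (\<integral>w. ?P w * U w - 2 * (?P w * V w) + ?P w * W w \<partial>Q)"
        by (simp add: algebra_simps)
      then show ?thesis using i by simp
    qed
    have one: "AE x in m. T \<tau> (\<lambda>_. 1) x = 1" using \<tau> by (intro T_one) simp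
    have "(\<integral>w. ?P w * (inc g \<tau> j w)\<^sup>2 \<partial>Q) =
        (\<integral>w. ?P w * (1 * ?g2 (X (?t (Suc j)) w) - 2 * (g (X (?t j) w) * g (X (?t (Suc j)) w)) + ?g2 (X (?t j) w) * 1) \<partial>Q)"
      by (simp add: inc_def power2_eq_square algebra_simps)
    also have "\<dots> = (\<integral>w. ?P w * (1 * ?g2 (X (?t (Suc j)) w)) \<partial>Q) - 2 * (\<integral>w. ?P w * (g (X (?t j) w) * g (X (?t (Suc j)) w)) \<partial>Q) +
        (\<integral>w. ?P w * (?g2 (X (?t j) w) * 1) \<partial>Q)"
      using g t_nn by (intro split bm_mult bm_power bm_X bm_const)
    also have "\<dots> = (\<integral>w. ?P w * (1 * k (X (?t j) w)) \<partial>Q) - 2 * (\<integral>w. ?P w * (g (X (?t j) w) * g' (X (?t j) w)) \<partial>Q) +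
        (\<integral>w. ?P w * (?g2 (X (?t j) w) * 1) \<partial>Q)"
      using m4[of "\<lambda>_. 1" ?g2 k] m4[of g g g'] k g' g g2 by simp
    also have "\<dots> = (\<integral>w. ?P w * (1 * k (X (?t j) w) - 2 * (g (X (?t j) w) * g' (X (?t j) w)) + ?g2 (X (?t j) w) * 1) \<partial>Q)"
      using g g' k t_nn by (intro split[symmetric] bm_mult bm_power bm_X bm_const)
    also have "\<dots> = (\<integral>w. ?P w * \<gamma> (X (?t j) w) \<partial>Q)"
      by (simp add: \<gamma>_def)
    also have "\<dots> = (\<integral>w. ?P w * \<gamma>s (j - Suc i) (X (?t (Suc i)) w) \<partial>Q)"
    proof (rule markov_three)
      have "?t j - ?t (Suc i) = real (j - Suc i) * \<tau>" using ij by (simp add: of_nat_diff algebra_simps)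
      then show "AE x in m. T (?t j - ?t (Suc i)) \<gamma> x = \<gamma>s (j - Suc i) x" using \<gamma>s(2) by simp
    qed (use ij t_nn t_mono[of i "Suc i"] t_mono[of "Suc i" j] F \<gamma> \<gamma>s in auto)
    finally show "(\<integral>w. ?P w * (inc g \<tau> j w)\<^sup>2 \<partial>Q) = (\<integral>w. ?P w * \<gamma>s (j - Suc i) (X (?t (Suc i)) w) \<partial>Q)" .
  qed (use g t_nn \<tau> \<gamma>s in \<open>auto intro!: bm_power inc_bm bm_X\<close>)
  have inc2: "(\<lambda>w. (inc g \<tau> i w)\<^sup>2) \<in> bm Q" for i
    using g \<tau> by (intro bm_power inc_bm) auto
  have row: "(\<Sum>j = Suc i..<n. \<integral>w. (inc g \<tau> i w)\<^sup>2 * (inc g \<tau> j w)\<^sup>2 \<partial>Q) \<le> ?B * (\<integral>w. (inc g \<tau> 0 w)\<^sup>2 \<partial>Q)"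
    if i: "i < n" for i
  proof -
    let ?x = "\<lambda>w. X (?t (Suc i)) w"
    have bx: "(\<lambda>w. \<gamma>s k (?x w)) \<in> bm Q" for k using \<gamma>s t_nn by (intro bm_X)
    have "(\<Sum>j = Suc i..<n. \<integral>w. (inc g \<tau> i w)\<^sup>2 * (inc g \<tau> j w)\<^sup>2 \<partial>Q) =
        (\<Sum>j = Suc i..<n. \<integral>w. (inc g \<tau> i w)\<^sup>2 * \<gamma>s (j - Suc i) (?x w) \<partial>Q)"
      by (intro sum.cong pair) auto
    also have "\<dots> = (\<Sum>k<n - Suc i. \<integral>w. (inc g \<tau> i w)\<^sup>2 * \<gamma>s k (?x w) \<partial>Q)"
      by (rule sum.reindex_bij_witness[of _ "\<lambda>k. k + Suc i" "\<lambda>j. j - Suc i"]) auto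
    also have "\<dots> = (\<integral>w. (\<Sum>k<n - Suc i. (inc g \<tau> i w)\<^sup>2 * \<gamma>s k (?x w)) \<partial>Q)"
      using inc2 bx by (intro Bochner_Integration.integral_sum[symmetric] bm_Q_integrable bm_mult)
    also have "\<dots> = (\<integral>w. (inc g \<tau> i w)\<^sup>2 * (\<Sum>k<n - Suc i. \<gamma>s k (?x w)) \<partial>Q)"
      by (simp add: sum_distrib_left)
    also have "\<dots> \<le> (\<integral>w. (inc g \<tau> i w)\<^sup>2 * ?B \<partial>Q)"
    proof (rule integral_mono_AE)
      have "AE x in m. (\<Sum>k<n - Suc i. \<gamma>s k x) \<le> ?B"
      proof (rule sum_T_carre_le[OF g \<tau> K small \<gamma> _ \<gamma>s(2)])
        show "AE x in m. \<gamma> x = T \<tau> ?g2 x - 2 * g x * T \<tau> g x + (g x)\<^sup>2"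
          using g'(2) k(2) by eventually_elim (simp add: \<gamma>_def)
        have "real (n - Suc i) * \<tau> \<le> real n * \<tau>" using \<tau> by (intro mult_right_mono) auto
        then show "real (n - Suc i) * \<tau> \<le> 1" using n by simp
      qed
      from AE_X[OF this t_nn[of "Suc i"]]
      show "AE w in Q. (inc g \<tau> i w)\<^sup>2 * (\<Sum>k<n - Suc i. \<gamma>s k (?x w)) \<le> (inc g \<tau> i w)\<^sup>2 * ?B"
        by eventually_elim (intro mult_left_mono, auto)
      show "integrable Q (\<lambda>w. (inc g \<tau> i w)\<^sup>2 * (\<Sum>k<n - Suc i. \<gamma>s k (?x w)))"
        "integrable Q (\<lambda>w. (inc g \<tau> i w)\<^sup>2 * ?B)"
        using inc2 bx by (intro bm_Q_integrable bm_mult bm_sum bm_const; simp)+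
    qed
    also have "\<dots> = ?B * (\<integral>w. (inc g \<tau> 0 w)\<^sup>2 \<partial>Q)"
      using integral_inc_power[OF g(1), of \<tau> i 2] \<tau> by simp
    finally show ?thesis .
  qed
  have diag: "(\<integral>w. ((inc g \<tau> i w)\<^sup>2)\<^sup>2 \<partial>Q) \<le> 4 * C\<^sup>2 * (\<integral>w. (inc g \<tau> 0 w)\<^sup>2 \<partial>Q)" for i
  proof -
    have le: "((inc g \<tau> i w)\<^sup>2)\<^sup>2 \<le> 4 * C\<^sup>2 * (inc g \<tau> i w)\<^sup>2" for w
    proof -
      have "(inc g \<tau> i w)\<^sup>2 \<le> (2 * C)\<^sup>2"
        using inc_abs_le[of g C \<tau> i w] g(2) by (metis abs_ge_zero power2_abs power_mono)
      then show ?thesis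
        unfolding power2_eq_square[of "(inc g \<tau> i w)\<^sup>2"]
        by (intro mult_right_mono) (auto simp: power_mult_distrib)
    qed
    have "(\<integral>w. ((inc g \<tau> i w)\<^sup>2)\<^sup>2 \<partial>Q) \<le> (\<integral>w. 4 * C\<^sup>2 * (inc g \<tau> i w)\<^sup>2 \<partial>Q)"
      by (intro integral_mono le bm_Q_integrable bm_power[OF inc2] bm_mult[OF bm_const inc2])
    then show ?thesis using integral_inc_power[OF g(1), of \<tau> i 2] \<tau> by simp
  qed
  let ?a = "\<lambda>i w. (inc g \<tau> i w)\<^sup>2"
  have "(\<integral>w. (\<Sum>i<n. ?a i w)\<^sup>2 \<partial>Q) =
      (\<integral>w. (\<Sum>i<n. (?a i w)\<^sup>2) + 2 * (\<Sum>i<n. \<Sum>j = Suc i..<n. ?a i w * ?a j w) \<partial>Q)"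
    by (simp add: square_sum_expand sum_distrib_left)
  also have "\<dots> = (\<integral>w. (\<Sum>i<n. (?a i w)\<^sup>2) \<partial>Q) + 2 * (\<integral>w. (\<Sum>i<n. \<Sum>j = Suc i..<n. ?a i w * ?a j w) \<partial>Q)"
  proof -
    have "integrable Q (\<lambda>w. \<Sum>i<n. (?a i w)\<^sup>2)" "integrable Q (\<lambda>w. \<Sum>i<n. \<Sum>j = Suc i..<n. ?a i w * ?a j w)"
      by (intro bm_Q_integrable bm_sum bm_power[OF inc2] bm_mult[OF inc2 inc2])+
    then show ?thesis by simp
  qed
  also have "(\<integral>w. (\<Sum>i<n. (?a i w)\<^sup>2) \<partial>Q) = (\<Sum>i<n. \<integral>w. (?a i w)\<^sup>2 \<partial>Q)"
    by (intro Bochner_Integration.integral_sum bm_Q_integrable bm_power[OF inc2])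
  also have "(\<integral>w. (\<Sum>i<n. \<Sum>j = Suc i..<n. ?a i w * ?a j w) \<partial>Q) = (\<Sum>i<n. \<integral>w. (\<Sum>j = Suc i..<n. ?a i w * ?a j w) \<partial>Q)"
    by (intro Bochner_Integration.integral_sum bm_Q_integrable bm_sum bm_mult[OF inc2 inc2])
  also have "\<dots> = (\<Sum>i<n. \<Sum>j = Suc i..<n. \<integral>w. ?a i w * ?a j w \<partial>Q)"
    by (intro sum.cong Bochner_Integration.integral_sum bm_Q_integrable bm_mult[OF inc2 inc2] refl)
  finally have "(\<integral>w. (\<Sum>i<n. ?a i w)\<^sup>2 \<partial>Q) =
    (\<Sum>i<n. \<integral>w. (?a i w)\<^sup>2 \<partial>Q) + 2 * (\<Sum>i<n. \<Sum>j = Suc i..<n. \<integral>w. ?a i w * ?a j w \<partial>Q)" .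
  also have "\<dots> \<le> (\<Sum>i<n. 4 * C\<^sup>2 * (\<integral>w. (inc g \<tau> 0 w)\<^sup>2 \<partial>Q)) + 2 * (\<Sum>i<n. ?B * (\<integral>w. (inc g \<tau> 0 w)\<^sup>2 \<partial>Q))"
    using diag row by (intro add_mono mult_left_mono sum_mono) auto
  also have "\<dots> = (6 * C\<^sup>2 + 4 * C * K) * (real n * (\<integral>w. (inc g \<tau> 0 w)\<^sup>2 \<partial>Q))"
    by (simp add: algebra_simps)
  finally show ?thesis .
qed

section \<open>Vanishing of the fourth moments\<close>

lemma en_cong:
  assumes "f \<in> L2 m" "g \<in> L2 m" "AE x in m. f x = g x" "0 \<le> t"
  shows "en t f = en t g"
proof -
  have "AE x in m. T t f x = T t g x" using assms by (intro T_cong)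
  with assms(3) have "AE x in m. f x - T t f x = g x - T t g x" by eventually_elim simp
  then have "ip m (\<lambda>x. f x - T t f x) f = ip m (\<lambda>x. g x - T t g x) g"
    using assms by (intro ip_cong_AE) (auto intro!: L2_borel_measurable L2_diff)
  then show ?thesis by (simp add: en_def)
qed

text \<open>The point is uniformity in \<open>t\<close>. By convexity of \<open>G f\<close>, the
  energy of \<open>f - T r f\<close> at scale \<open>t\<close> is at most
  \<open>en t f - en t (T (\<epsilon> / 2) f)\<close>. The first term is at most
  \<open>E f f\<close>. The second is bounded below through \<open>en_lower\<close> at one fixed
  time \<open>\<delta>0\<close>, at which \<open>en\<close> nearly attains \<open>E f f\<close>;
  \<open>\<epsilon>\<close> is then taken small against that time.\<close>

lemma energy_minus_T_small:
  assumes f: "f \<in> D" and "0 < \<eta>"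
  obtains \<epsilon> \<delta> where "0 < \<epsilon>" "0 < \<delta>"
    "\<And>t r. 0 < t \<Longrightarrow> t < \<delta> \<Longrightarrow> 0 \<le> r \<Longrightarrow> r \<le> \<epsilon> \<Longrightarrow> en t (\<lambda>x. f x - T r f x) \<le> \<eta>"
proof -
  have fL: "f \<in> L2 m" using f by (rule D_L2)
  have E0: "0 \<le> E f f" using en_le_E[OF f, of 1] en_nonneg[of 1 f] fL by simp
  have "\<forall>\<^sub>F t in at_right 0. E f f - \<eta> / 3 < en t f"
    using en_tendsto[OF f] \<open>0 < \<eta>\<close> by (intro order_tendstoD(1)) auto
  then have ev: "\<forall>\<^sub>F t in at_right 0. E f f - \<eta> / 3 < en t f \<and> 0 < t"
    using eventually_at_right_less[of 0] by eventually_elim simp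
  obtain \<delta>\<^sub>0 where \<delta>\<^sub>0: "0 < \<delta>\<^sub>0" "E f f - \<eta> / 3 < en \<delta>\<^sub>0 f"
    using eventually_happens'[OF trivial_limit_at_right_real ev] by auto
  \<comment> \<open>Chosen so that \<open>G f\<close> falls by at most \<open>\<eta>/3\<close> times
    the fixed time over \<open>{0..\<epsilon>}\<close>; the added 1 covers a vanishing
    energy.\<close>
  define \<epsilon> where "\<epsilon> = \<eta> * \<delta>\<^sub>0 / (3 * (E f f + 1))"
  have \<epsilon>: "0 < \<epsilon>" using \<open>0 < \<eta>\<close> \<delta>\<^sub>0 E0 by (simp add: \<epsilon>_def)
  have "G f 0 - G f \<epsilon> = \<epsilon> * en \<epsilon> f" using \<epsilon> fL by (simp add: en_eq)
  also have "\<dots> \<le> \<epsilon> * (E f f + 1)" using \<epsilon> en_le_E[OF f \<epsilon>] by (intro mult_left_mono) auto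
  also have "\<dots> = \<eta> * \<delta>\<^sub>0 / 3" using E0 by (simp add: \<epsilon>_def field_simps)
  finally have G\<epsilon>: "G f 0 - G f \<epsilon> \<le> \<eta> * \<delta>\<^sub>0 / 3" .
  define H where "H = G f \<epsilon> - G f (\<epsilon> + \<delta>\<^sub>0)"
  have H1: "(G f 0 - G f \<delta>\<^sub>0) - (G f 0 - G f \<epsilon>) \<le> H"
    using G_antimono[of \<delta>\<^sub>0 "\<epsilon> + \<delta>\<^sub>0" f] \<delta>\<^sub>0 \<epsilon> fL by (simp add: H_def)
  have H2: "\<delta>\<^sub>0 * (E f f - \<eta> / 3) < G f 0 - G f \<delta>\<^sub>0"
    using mult_strict_left_mono[OF \<delta>\<^sub>0(2,1)] \<delta>\<^sub>0 fL by (simp add: en_eq)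
  have H3: "\<delta>\<^sub>0 * (E f f - \<eta> / 3) - \<eta> * \<delta>\<^sub>0 / 3 = \<delta>\<^sub>0 * (E f f - \<eta>) + \<eta> * \<delta>\<^sub>0 / 3"
    by (simp add: field_simps)
  have H4: "0 < \<eta> * \<delta>\<^sub>0 / 3" using \<delta>\<^sub>0 \<open>0 < \<eta>\<close> by simp
  have "\<delta>\<^sub>0 * (E f f - \<eta>) < H" using H1 H2 H3 H4 G\<epsilon> by linarith
  then have H: "E f f - \<eta> < H / \<delta>\<^sub>0" using \<delta>\<^sub>0 by (simp add: field_simps)
  have "((\<lambda>t. H / (\<delta>\<^sub>0 + t)) \<longlongrightarrow> H / (\<delta>\<^sub>0 + 0)) (at_right 0)"
    using \<delta>\<^sub>0 by (intro tendsto_intros) auto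
  then have "\<forall>\<^sub>F t in at_right 0. E f f - \<eta> < H / (\<delta>\<^sub>0 + t)"
    using H by (intro order_tendstoD(1)) auto
  then obtain \<delta> where \<delta>: "0 < \<delta>" "\<And>t. 0 < t \<Longrightarrow> t < \<delta> \<Longrightarrow> E f f - \<eta> < H / (\<delta>\<^sub>0 + t)"
    by (auto simp: eventually_at_right_field)
  show ?thesis
  proof (rule that[OF \<epsilon> \<delta>(1)])
    fix t r :: real assume t: "0 < t" "t < \<delta>" and r: "0 \<le> r" "r \<le> \<epsilon>"
    let ?v = "\<lambda>x. f x - T r f x"
    have v: "?v \<in> L2 m" using fL r by (auto intro: L2_diff)
    have "t * en t ?v = (G f 0 - G f t) - 2 * (G f r - G f (r + t)) + (G f (2 * r) - G f (2 * r + t))"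
      using t r fL v by (simp add: en_eq G_minus_T)
    also have "G f (2 * r) - G f (2 * r + t) \<le> G f r - G f (r + t)"
      using t r fL by (intro G_increment_antimono) auto
    also have "(G f 0 - G f t) - 2 * (G f r - G f (r + t)) + (G f r - G f (r + t)) \<le>
        (G f 0 - G f t) - (G f \<epsilon> - G f (\<epsilon> + t))"
      using G_increment_antimono[of r \<epsilon> t f] t r fL by simp
    also have "\<dots> = t * (en t f - en t (T (\<epsilon> / 2) f))"
      using t fL \<epsilon> T_L2[of "\<epsilon>/2" f] by (simp add: en_eq G_T field_simps)
    finally have "en t ?v \<le> en t f - en t (T (\<epsilon> / 2) f)" using t by simp
    moreover have "H / (\<delta>\<^sub>0 + t) \<le> en t (T (\<epsilon> / 2) f)"
      using en_lower[of t \<delta>\<^sub>0 "T (\<epsilon> / 2) f"] t \<delta>\<^sub>0 fL \<epsilon> T_L2[of "\<epsilon>/2" f] by (simp add: G_T H_def)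
    ultimately show "en t ?v \<le> \<eta>"
      using \<delta>(2)[OF t] en_le_E[OF f t(1)] by linarith
  qed
qed

text \<open>\<open>g\<close> averages \<open>N\<close> values \<open>T (k/n) f\<close> with
  \<open>N\<close> about \<open>\<epsilon> * n\<close>. Because the average runs over multiples of
  the mesh \<open>1/n\<close>, \<open>T (1/n) g - g\<close> telescopes to two terms divided by
  \<open>N\<close>, hence is of order \<open>1/n\<close> with a constant independent of
  \<open>n\<close>. Convexity of the square bounds the energy of \<open>f - g\<close> by the average
  energy of the \<open>f - T (k/n) f\<close>, each at most \<open>\<eta>\<close>.\<close>

lemma smoothing:
  assumes f: "f \<in> Bb" "f \<in> D" "\<And>x. \<bar>f x\<bar> \<le> C" and \<eta>: "0 < \<eta>"
  obtains K n\<^sub>0 where "0 \<le> K" "0 < n\<^sub>0"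
    "\<And>n. n \<ge> n\<^sub>0 \<Longrightarrow> \<exists>g\<in>Bb. (\<forall>x. \<bar>g x\<bar> \<le> C) \<and> (AE x in m. \<bar>T (1 / real n) g x - g x\<bar> \<le> K * (1 / real n)) \<and>
      (\<integral>w. (inc (\<lambda>x. f x - g x) (1 / real n) 0 w)\<^sup>2 \<partial>Q) \<le> 2 * \<eta> / real n"
proof -
  have C: "0 \<le> C" using f(3)[of undefined] by linarith
  obtain \<epsilon> \<delta> where \<epsilon>: "0 < \<epsilon>" and \<delta>: "0 < \<delta>" and
    small: "\<And>t r. 0 < t \<Longrightarrow> t < \<delta> \<Longrightarrow> 0 \<le> r \<Longrightarrow> r \<le> \<epsilon> \<Longrightarrow> en t (\<lambda>x. f x - T r f x) \<le> \<eta>"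
    using energy_minus_T_small[OF f(2) \<eta>] by blast
  obtain n\<^sub>0 :: nat where n\<^sub>0: "1 / \<epsilon> + 1 / \<delta> < real n\<^sub>0" using reals_Archimedean2 by blast
  \<comment> \<open>The two surviving terms are at most \<open>2 * C / N\<close>, and
    \<open>N\<close> is at least \<open>\<epsilon> * n / 2\<close>.\<close>
  define K where "K = 4 * C / \<epsilon>"
  show ?thesis
  proof (rule that[of K n\<^sub>0])
    show "0 \<le> K" using C \<epsilon> by (simp add: K_def)
    have "0 < 1 / \<epsilon> + 1 / \<delta>" using \<epsilon> \<delta> by (simp add: add_pos_pos)
    then have "0 < real n\<^sub>0" using n\<^sub>0 by linarith
    then show n0p: "0 < n\<^sub>0" by simp
    fix n assume n: "n \<ge> n\<^sub>0"
    then have np: "0 < real n" using n0p by simp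
    have nn: "1 / \<epsilon> + 1 / \<delta> < real n" using n n\<^sub>0 by simp
    let ?\<tau> = "1 / real n"
    have "1 / \<epsilon> < real n" "1 / \<delta> < real n" using nn \<epsilon> \<delta> by (smt (verit) zero_less_divide_1_iff)+
    then have en1: "1 < \<epsilon> * real n" and \<tau>: "0 < ?\<tau>" "?\<tau> < \<delta>"
      using \<epsilon> \<delta> np by (simp_all add: field_simps)
    define N where "N = nat \<lfloor>\<epsilon> * real n\<rfloor>"
    have N1: "real N \<le> \<epsilon> * real n" and N2: "\<epsilon> * real n < real N + 1"
      using en1 by (simp_all add: N_def)
    have "0 < real N" using N2 en1 by linarith
    then have Np: "1 \<le> real N" by simp
    have N3: "\<epsilon> * real n \<le> 2 * real N" using N2 Np by linarith
    have "\<exists>F. F \<in> Bb \<and> (\<forall>x. \<bar>F x\<bar> \<le> C) \<and> (AE x in m. T (real k * ?\<tau>) f x = F x)" for k :: nat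
      using T_representative[OF f(1,3), of "real k * ?\<tau>"] np by (metis zero_le_divide_1_iff of_nat_0_le_iff mult_nonneg_nonneg)
    then obtain gs where gs: "\<And>k. gs k \<in> Bb" "\<And>k x. \<bar>gs k x\<bar> \<le> C" "\<And>k::nat. AE x in m. T (real k * ?\<tau>) f x = gs k x"
      by metis
    define g where "g x = (1 / real N) * (\<Sum>k<N. gs k x)" for x
    have gB: "g \<in> Bb" unfolding g_def[abs_def] using gs by (intro bm_mult bm_const bm_sum)
    have gC: "\<bar>g x\<bar> \<le> C" for x
    proof -
      have "\<bar>\<Sum>k<N. gs k x\<bar> \<le> (\<Sum>k<N. C)"
        by (rule order_trans[OF sum_abs sum_mono]) (rule gs)
      then show ?thesis using Np by (simp add: g_def abs_mult field_simps)
    qed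
    have shift: "AE x in m. T ?\<tau> (gs k) x = gs (Suc k) x" for k
    proof -
      have "AE x in m. T ?\<tau> (gs k) x = T ?\<tau> (T (real k * ?\<tau>) f) x"
        using gs(3)[of k] gs(1) f \<tau> by (intro T_cong) (auto elim: AE_mp intro: bm_L2)
      moreover have "AE x in m. T (?\<tau> + real k * ?\<tau>) f x = T ?\<tau> (T (real k * ?\<tau>) f) x"
        using f \<tau> by (intro T_add bm_L2) auto
      moreover have "?\<tau> + real k * ?\<tau> = real (Suc k) * ?\<tau>" by (simp add: add_divide_distrib)
      ultimately show ?thesis using gs(3)[of "Suc k"] by (auto elim!: AE_mp)
    qed
    have Tsum: "(AE x in m. T ?\<tau> (\<lambda>x. \<Sum>k<M. gs k x) x = (\<Sum>k<M. gs (Suc k) x))" for M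
    proof (induction M)
      case 0
      have "(\<lambda>_. 0) \<in> L2 m" by (intro bm_L2 bm_const)
      from T_lincomb[OF _ this this, of ?\<tau> 0 0] show ?case using \<tau> by simp
    next
      case (Suc M)
      have "(\<lambda>x. \<Sum>k<M. gs k x) \<in> L2 m" "gs M \<in> L2 m" using gs by (auto intro!: bm_L2)
      from T_lincomb[OF _ this, of ?\<tau> 1 1] Suc shift[of M] \<tau> show ?case
        by (auto elim!: AE_mp)
    qed
    have "AE x in m. \<bar>T ?\<tau> g x - g x\<bar> \<le> K * ?\<tau>"
    proof -
      let ?S = "\<lambda>x. \<Sum>k<N. gs k x"
      have S: "?S \<in> L2 m" using gs by (auto intro!: bm_L2)
      have "AE x in m. T ?\<tau> g x = 1 / real N * T ?\<tau> ?S x"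
        using T_lincomb[OF _ S S, of ?\<tau> "1 / real N" 0] \<tau> by (simp add: g_def[abs_def])
      with Tsum[of N] show ?thesis
      proof eventually_elim
        case (elim x)
        have "T ?\<tau> g x - g x = 1 / real N * ((\<Sum>k<N. gs (Suc k) x) - (\<Sum>k<N. gs k x))"
          using elim by (simp add: g_def right_diff_distrib)
        also have "(\<Sum>k<N. gs (Suc k) x) - (\<Sum>k<N. gs k x) = gs N x - gs 0 x"
          using sum_lessThan_telescope[of "\<lambda>k. gs k x" N] by (simp add: sum_subtractf)
        finally have "\<bar>T ?\<tau> g x - g x\<bar> \<le> 1 / real N * (2 * C)"
          using gs(2)[of N x] gs(2)[of 0 x] Np by (simp add: abs_mult divide_right_mono)
        also have "\<dots> \<le> K * ?\<tau>"
          using mult_left_mono[OF N3, of C] C Np np \<epsilon> by (simp add: K_def field_simps)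
        finally show ?case .
      qed
    qed
    moreover have "(\<integral>w. (inc (\<lambda>x. f x - g x) ?\<tau> 0 w)\<^sup>2 \<partial>Q) \<le> 2 * \<eta> / real n"
    proof -
      let ?d = "\<lambda>k x. f x - gs k x"
      have d: "?d k \<in> Bb" for k using f gs by auto
      have d2: "(\<lambda>w. (inc (?d k) ?\<tau> 0 w)\<^sup>2) \<in> bm Q" for k
        using d \<tau> by (intro bm_power inc_bm) auto
      have dk: "(\<integral>w. (inc (?d k) ?\<tau> 0 w)\<^sup>2 \<partial>Q) \<le> 2 * \<eta> / real n" if "k < N" for k
      proof -
        have "AE x in m. ?d k x = f x - T (real k * ?\<tau>) f x" using gs(3)[of k] by eventually_elim simp
        then have "en ?\<tau> (?d k) = en ?\<tau> (\<lambda>x. f x - T (real k * ?\<tau>) f x)"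
          using \<tau> by (intro en_cong bm_L2[OF d] L2_diff bm_L2[OF f(1)] T_L2) auto
        also have "\<dots> \<le> \<eta>"
        proof (rule small)
          have "real k \<le> \<epsilon> * real n" using that N1 by linarith
          then show "real k * ?\<tau> \<le> \<epsilon>" using np by (simp add: field_simps)
        qed (use \<tau> in auto)
        finally show ?thesis using d \<tau> np by (simp add: en_Bb inc_0 field_simps)
      qed
      have le: "(inc (\<lambda>x. f x - g x) ?\<tau> 0 w)\<^sup>2 \<le> 1 / real N * (\<Sum>k<N. (inc (?d k) ?\<tau> 0 w)\<^sup>2)" for w
      proof -
        have "f x - g x = 1 / real N * (\<Sum>k<N. ?d k x)" for x
          using Np by (simp add: g_def sum_subtractf right_diff_distrib)
        then have "inc (\<lambda>x. f x - g x) ?\<tau> 0 w = 1 / real N * (\<Sum>k<N. inc (?d k) ?\<tau> 0 w)"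
          by (simp add: inc_def sum_subtractf flip: right_diff_distrib diff_divide_distrib)
        then have "(inc (\<lambda>x. f x - g x) ?\<tau> 0 w)\<^sup>2 = (1 / real N)\<^sup>2 * (\<Sum>k<N. inc (?d k) ?\<tau> 0 w)\<^sup>2"
          by (simp only: power_mult_distrib)
        also have "\<dots> \<le> (1 / real N)\<^sup>2 * (real N * (\<Sum>k<N. (inc (?d k) ?\<tau> 0 w)\<^sup>2))"
          using sum_squared_le_sum_of_squares[of "\<lambda>k. inc (?d k) ?\<tau> 0 w" "{..<N}"]
          by (intro mult_left_mono) (auto simp: mult.commute)
        also have "\<dots> = 1 / real N * (\<Sum>k<N. (inc (?d k) ?\<tau> 0 w)\<^sup>2)"
          using Np by (simp add: power2_eq_square)
        finally show ?thesis .
      qed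
      have "(\<integral>w. (inc (\<lambda>x. f x - g x) ?\<tau> 0 w)\<^sup>2 \<partial>Q) \<le> (\<integral>w. 1 / real N * (\<Sum>k<N. (inc (?d k) ?\<tau> 0 w)\<^sup>2) \<partial>Q)"
        using d2 f gB gs(1) \<tau>
        by (intro integral_mono le bm_Q_integrable bm_mult[OF bm_const] bm_sum bm_power[OF inc_bm] bm_diff) auto
      also have "\<dots> = 1 / real N * (\<Sum>k<N. \<integral>w. (inc (?d k) ?\<tau> 0 w)\<^sup>2 \<partial>Q)"
        using d2 by (subst Bochner_Integration.integral_mult_right_zero, subst Bochner_Integration.integral_sum) auto
      also have "\<dots> \<le> 1 / real N * (\<Sum>k<N. 2 * \<eta> / real n)"
        using dk by (intro mult_left_mono sum_mono) auto
      also have "\<dots> = 2 * \<eta> / real n" using Np by simp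
      finally show ?thesis .
    qed
    ultimately show "\<exists>g\<in>Bb. (\<forall>x. \<bar>g x\<bar> \<le> C) \<and> (AE x in m. \<bar>T ?\<tau> g x - g x\<bar> \<le> K * ?\<tau>) \<and>
      (\<integral>w. (inc (\<lambda>x. f x - g x) ?\<tau> 0 w)\<^sup>2 \<partial>Q) \<le> 2 * \<eta> / real n"
      using gB gC by blast
  qed
qed

text \<open>The largest squared increment, a modulus of continuity of the path. Including the index
  \<open>n\<close> keeps the set nonempty when \<open>n = 0\<close>.\<close>

definition maxinc :: "('a \<Rightarrow> real) \<Rightarrow> nat \<Rightarrow> 'w \<Rightarrow> real" where
  "maxinc f n w = Max ((\<lambda>i. (inc f (1 / real n) i w)\<^sup>2) ` {..n})"

lemma inc_le_maxinc: "i \<le> n \<Longrightarrow> (inc f (1 / real n) i w)\<^sup>2 \<le> maxinc f n w"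
  unfolding maxinc_def by (intro Max_ge) auto

lemma maxinc_nonneg: "0 \<le> maxinc f n w"
  using inc_le_maxinc[of 0 n f w] by (rule order_trans[OF zero_le_power2]) simp

lemma maxinc_le:
  assumes "\<And>x. \<bar>f x\<bar> \<le> C"
  shows "maxinc f n w \<le> (2 * C)\<^sup>2"
proof -
  have "(inc f \<tau> i w)\<^sup>2 \<le> (2 * C)\<^sup>2" for \<tau> i
    using inc_abs_le[of f C \<tau> i w] assms by (metis abs_ge_zero power2_abs power_mono)
  then show ?thesis unfolding maxinc_def by (subst Max_le_iff) auto
qed

lemma maxinc_bm:
  assumes "f \<in> Bb"
  shows "maxinc f n \<in> bm Q"
proof -
  obtain C where C: "\<And>x. \<bar>f x\<bar> \<le> C" using assms by (metis bmE)
  have "(\<lambda>w. (inc f (1 / real n) i w)\<^sup>2) \<in> borel_measurable Q" for i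
    using assms by (intro bm_borel_measurable bm_power inc_bm) auto
  then have "maxinc f n \<in> borel_measurable Q"
    unfolding maxinc_def[abs_def] by (intro borel_measurable_Max) auto
  then show ?thesis
    using maxinc_nonneg maxinc_le[of f C] C by (intro bmI[of _ _ "(2 * C)\<^sup>2"]) auto
qed

lemma maxinc_tendsto:
  assumes "continuous_on UNIV f" "w \<in> space Q"
  shows "(\<lambda>n. maxinc f n w) \<longlonglongrightarrow> 0"
proof (rule LIMSEQ_I)
  fix e :: real assume e: "0 < e"
  \<comment> \<open>The increment with index \<open>n\<close> ends at time
    \<open>(n + 1) / n\<close>, which is at most 2.\<close>
  have "continuous_on {0..2} (\<lambda>t. f (X t w))"
    by (rule continuous_on_compose2[OF assms(1) continuous_on_subset[OF X_continuous[OF assms(2)]]]) auto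
  then have "uniformly_continuous_on {0..2} (\<lambda>t. f (X t w))"
    by (intro compact_uniformly_continuous) auto
  then obtain d where d: "0 < d" "\<And>s t. s \<in> {0..2} \<Longrightarrow> t \<in> {0..2} \<Longrightarrow> dist t s < d \<Longrightarrow>
      dist (f (X t w)) (f (X s w)) < sqrt e"
    unfolding uniformly_continuous_on_def using e by (metis real_sqrt_gt_zero)
  obtain n\<^sub>0 :: nat where n\<^sub>0: "1 / d < real n\<^sub>0" using reals_Archimedean2 by blast
  have "norm (maxinc f n w - 0) < e" if n: "n \<ge> Suc n\<^sub>0" for n
  proof -
    have np: "0 < real n" "1 / d < real n" using n n\<^sub>0 by auto
    have "(inc f (1 / real n) i w)\<^sup>2 < e" if i: "i \<le> n" for i
    proof -
      have "real (Suc i) * (1 / real n) \<in> {0..2}" "real i * (1 / real n) \<in> {0..2}"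
        using i n np by (auto simp: field_simps)
      moreover have "dist (real (Suc i) * (1 / real n)) (real i * (1 / real n)) < d"
        using np d(1) by (simp add: dist_real_def field_simps)
      ultimately have "dist (f (X (real (Suc i) * (1 / real n)) w)) (f (X (real i * (1 / real n)) w)) < sqrt e"
        by (intro d(2))
      then have "\<bar>inc f (1 / real n) i w\<bar> < sqrt e" by (simp add: inc_def dist_real_def)
      then have "\<bar>inc f (1 / real n) i w\<bar>\<^sup>2 < (sqrt e)\<^sup>2" by (intro power_strict_mono) auto
      then show ?thesis using e by simp
    qed
    then have "maxinc f n w < e" unfolding maxinc_def by (subst Max_less_iff) auto
    then show ?thesis using maxinc_nonneg[of f n w] by simp
  qed
  then show "\<exists>no. \<forall>n\<ge>no. norm (maxinc f n w - 0) < e" by blast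
qed

lemma maxinc_sq_tendsto:
  assumes "f \<in> Bb" "continuous_on UNIV f"
  shows "(\<lambda>n. \<integral>w. (maxinc f n w)\<^sup>2 \<partial>Q) \<longlonglongrightarrow> 0"
proof -
  obtain C where C: "\<And>x. \<bar>f x\<bar> \<le> C" using assms by (metis bmE)
  have "(\<lambda>n. \<integral>w. (maxinc f n w)\<^sup>2 \<partial>Q) \<longlonglongrightarrow> (\<integral>w. 0 \<partial>Q)"
  proof (rule integral_dominated_convergence)
    show "integrable Q (\<lambda>_. ((2 * C)\<^sup>2)\<^sup>2)" by simp
    show "(\<lambda>w. (maxinc f n w)\<^sup>2) \<in> borel_measurable Q" for n
      using maxinc_bm[OF assms(1)] by (intro bm_borel_measurable bm_power)
    show "AE w in Q. (\<lambda>n. (maxinc f n w)\<^sup>2) \<longlonglongrightarrow> 0"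
      using tendsto_power[OF maxinc_tendsto[OF assms(2)], of _ 2] by (intro AE_I2) simp
    show "AE w in Q. norm ((maxinc f n w)\<^sup>2) \<le> ((2 * C)\<^sup>2)\<^sup>2" for n
      using maxinc_le[of f C n] C maxinc_nonneg[of f n]
      by (intro AE_I2) (simp only: real_norm_def abs_of_nonneg zero_le_power2, intro power_mono, auto)
  qed simp
  then show ?thesis by simp
qed

text \<open>Path continuity excludes jumps of \<open>f(X\<^sub>t)\<close>; this replaces the strong locality of \<open>E\<close>.
  The approximation \<open>g\<close> need not be continuous; its role is the uniform integrability of its
  quadratic variation.\<close>

lemma fourth_moment_tendsto:
  assumes f: "f \<in> Bb" "f \<in> D" "continuous_on UNIV f"
  shows "(\<lambda>n. real n * (\<integral>w. (inc f (1 / real n) 0 w) ^ 4 \<partial>Q)) \<longlonglongrightarrow> 0"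
proof (rule LIMSEQ_I)
  fix e :: real assume e: "0 < e"
  obtain C where C: "0 < C" "\<And>x. \<bar>f x\<bar> \<le> C" using f by (metis bmE)
  \<comment> \<open>Makes the contribution \<open>8 * C^2 * (2 * \<eta>)\<close> of
    \<open>f - g\<close> equal to \<open>e / 4\<close>.\<close>
  define \<eta> where "\<eta> = e / (64 * C\<^sup>2)"
  have \<eta>: "0 < \<eta>" using e C by (simp add: \<eta>_def)
  obtain K n\<^sub>0 where K: "0 \<le> K" and n\<^sub>0: "0 < n\<^sub>0" and
    sm: "\<And>n. n \<ge> n\<^sub>0 \<Longrightarrow> \<exists>g\<in>Bb. (\<forall>x. \<bar>g x\<bar> \<le> C) \<and> (AE x in m. \<bar>T (1 / real n) g x - g x\<bar> \<le> K * (1 / real n)) \<and>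
      (\<integral>w. (inc (\<lambda>x. f x - g x) (1 / real n) 0 w)\<^sup>2 \<partial>Q) \<le> 2 * \<eta> / real n"
    using smoothing[OF f(1,2) C(2) \<eta>] by blast
  have E0: "0 \<le> E f f" using en_le_E[OF f(2), of 1] en_nonneg[of 1 f] f bm_L2 by fastforce
  \<comment> \<open>Bounds the second moment of the quadratic variation of \<open>g\<close> for all
    large \<open>n\<close>; the added 1 allows division by \<open>M\<close>.\<close>
  define M where "M = (6 * C\<^sup>2 + 4 * C * K) * (4 * (E f f + \<eta>)) + 1"
  have M: "0 < M" unfolding M_def using C K E0 \<eta> by (intro add_nonneg_pos mult_nonneg_nonneg) auto
  \<comment> \<open>Weight for Young's inequality on \<open>?Y w * ?Z w\<close>: the part with
    \<open>?Z\<close> is at most \<open>2 * \<kappa> * M = e / 4\<close>, while the large reciprocal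
    weight falls on the path oscillation \<open>?Y\<close>, whose second moment tends to
    zero.\<close>
  define \<kappa> where "\<kappa> = e / (8 * M)"
  have \<kappa>: "0 < \<kappa>" using e M by (simp add: \<kappa>_def)
  have "\<forall>\<^sub>F n in sequentially. (\<integral>w. (maxinc f n w)\<^sup>2 \<partial>Q) < e * \<kappa> / 2"
    using maxinc_sq_tendsto[OF f(1,3)] e \<kappa> by (intro order_tendstoD(2)) auto
  then obtain n\<^sub>1 where n\<^sub>1: "\<And>n. n \<ge> n\<^sub>1 \<Longrightarrow> (\<integral>w. (maxinc f n w)\<^sup>2 \<partial>Q) < e * \<kappa> / 2"
    by (auto simp: eventually_sequentially)
  have "norm (real n * (\<integral>w. (inc f (1 / real n) 0 w) ^ 4 \<partial>Q) - 0) < e" if n: "n \<ge> max n\<^sub>0 n\<^sub>1" for n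
  proof -
    let ?\<tau> = "1 / real n"
    have np: "0 < real n" using n n\<^sub>0 by simp
    have \<tau>: "0 < ?\<tau>" using np by simp
    obtain g where g: "g \<in> Bb" "\<And>x. \<bar>g x\<bar> \<le> C" and gT: "AE x in m. \<bar>T ?\<tau> g x - g x\<bar> \<le> K * ?\<tau>"
      and fg: "(\<integral>w. (inc (\<lambda>x. f x - g x) ?\<tau> 0 w)\<^sup>2 \<partial>Q) \<le> 2 * \<eta> / real n"
      using sm[of n] n by auto
    let ?h = "\<lambda>x. f x - g x"
    have h: "?h \<in> Bb" using f g by auto
    let ?Y = "maxinc f n" and ?Z = "\<lambda>w. \<Sum>i<n. (inc g ?\<tau> i w)\<^sup>2"
    have Y: "?Y \<in> bm Q" by (rule maxinc_bm[OF f(1)])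
    have Z: "?Z \<in> bm Q" using g \<tau> by (intro bm_sum bm_power inc_bm) auto
    have pw: "(\<Sum>i<n. (inc f ?\<tau> i w) ^ 4) \<le>
        2 * (\<kappa> * (?Z w)\<^sup>2) + (?Y w)\<^sup>2 / (2 * \<kappa>) + 8 * C\<^sup>2 * (\<Sum>i<n. (inc ?h ?\<tau> i w)\<^sup>2)" for w
    proof -
      \<comment> \<open>Only one of the two factors \<open>?a^2\<close> is split along
        \<open>f = g + (f - g)\<close>. The other is bounded by the path oscillation where it meets
        \<open>?b\<close>, and by the sup norm where it meets \<open>?c\<close>.\<close>
      have each: "(inc f ?\<tau> i w) ^ 4 \<le> 2 * (?Y w * (inc g ?\<tau> i w)\<^sup>2) + 8 * C\<^sup>2 * (inc ?h ?\<tau> i w)\<^sup>2" if "i < n" for i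
      proof -
        let ?a = "inc f ?\<tau> i w" and ?b = "inc g ?\<tau> i w" and ?c = "inc ?h ?\<tau> i w"
        have abc: "?a = ?b + ?c" by (simp add: inc_diff)
        have sq: "?a\<^sup>2 \<le> 2 * ?b\<^sup>2 + 2 * ?c\<^sup>2"
          unfolding abc using sum_squares_bound[of ?b ?c] by (simp add: power2_sum)
        have "?a\<^sup>2 \<le> (2 * C)\<^sup>2"
          using inc_abs_le[of f C ?\<tau> i w] C by (metis abs_ge_zero power2_abs power_mono)
        then have a1: "?a\<^sup>2 * ?c\<^sup>2 \<le> 4 * C\<^sup>2 * ?c\<^sup>2" by (intro mult_right_mono) (auto simp: power_mult_distrib)
        have a2: "?a\<^sup>2 * ?b\<^sup>2 \<le> ?Y w * ?b\<^sup>2" using inc_le_maxinc[of i n f w] that by (intro mult_right_mono) auto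
        have "?a ^ 4 = ?a\<^sup>2 * ?a\<^sup>2" by (simp add: power_add[symmetric])
        also have "\<dots> \<le> ?a\<^sup>2 * (2 * ?b\<^sup>2 + 2 * ?c\<^sup>2)" using sq by (intro mult_left_mono) auto
        also have "\<dots> = 2 * (?a\<^sup>2 * ?b\<^sup>2) + 2 * (?a\<^sup>2 * ?c\<^sup>2)" by (simp add: algebra_simps)
        also have "\<dots> \<le> 2 * (?Y w * ?b\<^sup>2) + 2 * (4 * C\<^sup>2 * ?c\<^sup>2)" using a1 a2 by linarith
        finally show ?thesis by simp
      qed
      have "(\<Sum>i<n. (inc f ?\<tau> i w) ^ 4) \<le> (\<Sum>i<n. 2 * (?Y w * (inc g ?\<tau> i w)\<^sup>2) + 8 * C\<^sup>2 * (inc ?h ?\<tau> i w)\<^sup>2)"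
        using each by (intro sum_mono) auto
      also have "\<dots> = 2 * (?Y w * ?Z w) + 8 * C\<^sup>2 * (\<Sum>i<n. (inc ?h ?\<tau> i w)\<^sup>2)"
        by (simp add: sum.distrib sum_distrib_left)
      also have "?Y w * ?Z w \<le> \<kappa> * (?Z w)\<^sup>2 + (?Y w)\<^sup>2 / (4 * \<kappa>)"
      proof -
        have "0 \<le> (2 * \<kappa> * ?Z w - ?Y w)\<^sup>2 / (4 * \<kappa>)" using \<kappa> by simp
        also have "\<dots> = \<kappa> * (?Z w)\<^sup>2 + (?Y w)\<^sup>2 / (4 * \<kappa>) - ?Y w * ?Z w"
          using \<kappa> by (simp add: power2_eq_square field_simps)
        finally show ?thesis by simp
      qed
      finally show ?thesis by (simp add: algebra_simps)
    qed
    have h2: "(\<integral>w. (\<Sum>i<n. (inc ?h ?\<tau> i w)\<^sup>2) \<partial>Q) \<le> 2 * \<eta>"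
    proof -
      have "(\<integral>w. (\<Sum>i<n. (inc ?h ?\<tau> i w)\<^sup>2) \<partial>Q) = (\<Sum>i<n. \<integral>w. (inc ?h ?\<tau> i w)\<^sup>2 \<partial>Q)"
        using h \<tau> by (intro Bochner_Integration.integral_sum bm_Q_integrable bm_power inc_bm) auto
      also have "\<dots> = real n * (\<integral>w. (inc ?h ?\<tau> 0 w)\<^sup>2 \<partial>Q)"
      proof -
        have "(\<Sum>i<n. \<integral>w. (inc ?h ?\<tau> i w)\<^sup>2 \<partial>Q) = (\<Sum>i<n. \<integral>w. (inc ?h ?\<tau> 0 w)\<^sup>2 \<partial>Q)"
          using h \<tau> by (intro sum.cong integral_inc_power) auto
        then show ?thesis by simp
      qed
      also have "\<dots> \<le> 2 * \<eta>" using fg np by (simp add: field_simps)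
      finally show ?thesis .
    qed
    have g2: "real n * (\<integral>w. (inc g ?\<tau> 0 w)\<^sup>2 \<partial>Q) \<le> 4 * (E f f + \<eta>)"
    proof -
      have "(\<integral>w. (inc g ?\<tau> 0 w)\<^sup>2 \<partial>Q) \<le> (\<integral>w. 2 * (inc f ?\<tau> 0 w)\<^sup>2 + 2 * (inc ?h ?\<tau> 0 w)\<^sup>2 \<partial>Q)"
      proof (intro integral_mono bm_Q_integrable bm_add bm_mult bm_const bm_power inc_bm)
        show "(inc g ?\<tau> 0 w)\<^sup>2 \<le> 2 * (inc f ?\<tau> 0 w)\<^sup>2 + 2 * (inc ?h ?\<tau> 0 w)\<^sup>2" for w
        proof -
          have eq: "inc g ?\<tau> 0 w = inc f ?\<tau> 0 w - inc ?h ?\<tau> 0 w" by (simp add: inc_diff)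
          have "0 \<le> (inc f ?\<tau> 0 w + inc ?h ?\<tau> 0 w)\<^sup>2" by simp
          then show ?thesis unfolding eq by (simp add: power2_sum power2_diff)
        qed
      qed (use f g h \<tau> in auto)
      also have "\<dots> = 2 * (\<integral>w. (inc f ?\<tau> 0 w)\<^sup>2 \<partial>Q) + 2 * (\<integral>w. (inc ?h ?\<tau> 0 w)\<^sup>2 \<partial>Q)"
        using f h \<tau> by (simp add: bm_Q_integrable bm_power inc_bm)
      also have "(\<integral>w. (inc f ?\<tau> 0 w)\<^sup>2 \<partial>Q) \<le> 2 * E f f / real n"
        using en_le_E[OF f(2) \<tau>] f \<tau> np by (simp add: en_Bb inc_0 field_simps)
      finally have "(\<integral>w. (inc g ?\<tau> 0 w)\<^sup>2 \<partial>Q) \<le> 2 * (2 * E f f / real n) + 2 * (2 * \<eta> / real n)"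
        using fg by simp
      then show ?thesis using np by (simp add: field_simps)
    qed
    have "(\<integral>w. (?Z w)\<^sup>2 \<partial>Q) \<le> (6 * C\<^sup>2 + 4 * C * K) * (real n * (\<integral>w. (inc g ?\<tau> 0 w)\<^sup>2 \<partial>Q))"
      using g \<tau> K gT np by (intro quadratic_variation_second_moment) auto
    also have "\<dots> \<le> (6 * C\<^sup>2 + 4 * C * K) * (4 * (E f f + \<eta>))"
      using g2 C K by (intro mult_left_mono) auto
    also have "\<dots> \<le> M" by (simp add: M_def)
    finally have Z2: "(\<integral>w. (?Z w)\<^sup>2 \<partial>Q) \<le> M" .
    have iZ: "integrable Q (\<lambda>w. (?Z w)\<^sup>2)" and iY: "integrable Q (\<lambda>w. (?Y w)\<^sup>2)"
      and iH: "integrable Q (\<lambda>w. \<Sum>i<n. (inc ?h ?\<tau> i w)\<^sup>2)"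
      and iF: "integrable Q (\<lambda>w. \<Sum>i<n. (inc f ?\<tau> i w) ^ 4)"
      using Y Z h f \<tau> by (auto intro!: bm_Q_integrable bm_power[of ?Z] bm_power[of ?Y] bm_sum bm_power[OF inc_bm])
    have "real n * (\<integral>w. (inc f ?\<tau> 0 w) ^ 4 \<partial>Q) = (\<Sum>i<n. \<integral>w. (inc f ?\<tau> 0 w) ^ 4 \<partial>Q)"
      by simp
    also have "\<dots> = (\<Sum>i<n. \<integral>w. (inc f ?\<tau> i w) ^ 4 \<partial>Q)"
      using f \<tau> by (intro sum.cong integral_inc_power[symmetric]) auto
    also have "\<dots> = (\<integral>w. (\<Sum>i<n. (inc f ?\<tau> i w) ^ 4) \<partial>Q)"
      using f \<tau> by (intro Bochner_Integration.integral_sum[symmetric] bm_Q_integrable bm_power inc_bm) auto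
    also have "\<dots> \<le> (\<integral>w. 2 * (\<kappa> * (?Z w)\<^sup>2) + (?Y w)\<^sup>2 / (2 * \<kappa>) + 8 * C\<^sup>2 * (\<Sum>i<n. (inc ?h ?\<tau> i w)\<^sup>2) \<partial>Q)"
      using iZ iY iH iF by (intro integral_mono pw) auto
    also have "\<dots> = 2 * (\<kappa> * (\<integral>w. (?Z w)\<^sup>2 \<partial>Q)) + (\<integral>w. (?Y w)\<^sup>2 \<partial>Q) / (2 * \<kappa>) + 8 * C\<^sup>2 * (\<integral>w. (\<Sum>i<n. (inc ?h ?\<tau> i w)\<^sup>2) \<partial>Q)"
      using iZ iY iH by simp
    also have "\<dots> < e"
    proof -
      have "\<kappa> * (\<integral>w. (?Z w)\<^sup>2 \<partial>Q) \<le> \<kappa> * M" using Z2 \<kappa> by (intro mult_left_mono) auto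
      also have "\<dots> = e / 8" using M by (simp add: \<kappa>_def)
      finally have 1: "\<kappa> * (\<integral>w. (?Z w)\<^sup>2 \<partial>Q) \<le> e / 8" .
      have 2: "(\<integral>w. (?Y w)\<^sup>2 \<partial>Q) / (2 * \<kappa>) < e / 4" using n\<^sub>1[of n] n \<kappa> by (simp add: field_simps)
      have "8 * C\<^sup>2 * (\<integral>w. (\<Sum>i<n. (inc ?h ?\<tau> i w)\<^sup>2) \<partial>Q) \<le> 8 * C\<^sup>2 * (2 * \<eta>)"
        using h2 by (intro mult_left_mono) auto
      also have "\<dots> = e / 4" using C by (simp add: \<eta>_def)
      finally show ?thesis using 1 2 e by linarith
    qed
    finally have "real n * (\<integral>w. (inc f ?\<tau> 0 w) ^ 4 \<partial>Q) < e" .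
    moreover have "0 \<le> real n * (\<integral>w. (inc f ?\<tau> 0 w) ^ 4 \<partial>Q)"
      by (intro mult_nonneg_nonneg integral_nonneg) auto
    ultimately show ?thesis by simp
  qed
  then show "\<exists>no. \<forall>n\<ge>no. norm (real n * (\<integral>w. (inc f (1 / real n) 0 w) ^ 4 \<partial>Q) - 0) < e" by blast
qed

end

section \<open>Gaussian estimates\<close>

text \<open>Odd Taylor terms cancel. The coefficient of \<open>z^2\<close> is exactly 1, which keeps
  the rate \<open>\<alpha>^2\<close> sharp; the crude quartic remainder is later absorbed by the
  fourth-moment limit.\<close>

lemma exp_plus_exp_minus_le:
  fixes z :: real
  assumes "\<bar>z\<bar> \<le> R"
  shows "exp z + exp (- z) - 2 \<le> z\<^sup>2 + exp R * z ^ 4"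
proof -
  have *: "\<exists>t. \<bar>t\<bar> \<le> \<bar>y\<bar> \<and> exp y = 1 + y + y\<^sup>2 / 2 + y ^ 3 / 6 + (exp t * y ^ 4) / 24" for y :: real
    using Maclaurin_exp_le[of y 4] by (auto simp: lessThan_nat_numeral fact_numeral algebra_simps)
  obtain t\<^sub>1 where t1: "\<bar>t\<^sub>1\<bar> \<le> \<bar>z\<bar>" "exp z = 1 + z + z\<^sup>2 / 2 + z ^ 3 / 6 + (exp t\<^sub>1 * z ^ 4) / 24"
    using *[of z] by blast
  obtain t\<^sub>2 where t2: "\<bar>t\<^sub>2\<bar> \<le> \<bar>z\<bar>" "exp (- z) = 1 - z + z\<^sup>2 / 2 - z ^ 3 / 6 + (exp t\<^sub>2 * z ^ 4) / 24"
    using *[of "- z"] by auto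
  have "exp t\<^sub>1 * z ^ 4 \<le> exp R * z ^ 4" "exp t\<^sub>2 * z ^ 4 \<le> exp R * z ^ 4"
    using t1(1) t2(1) assms by (auto intro!: mult_right_mono)
  moreover have "0 \<le> exp R * z ^ 4" by (intro mult_nonneg_nonneg zero_le_even_power) auto
  ultimately show ?thesis using t1(2) t2(2) by linarith
qed

lemma exp_plus_exp_minus_ge: "0 \<le> exp z + exp (- z) - 2" for z :: real
  using exp_ge_add_one_self[of z] exp_ge_add_one_self[of "- z"] by linarith

text \<open>The semigroup supplies derivatives in forward time only. A slack
  \<open>\<epsilon>\<close> makes the right derivative of \<open>K\<close> strictly negative, so the
  last point at which \<open>K\<close> is nonpositive would be followed by another such point. The
  start \<open>a'\<close> lies inside the interval, where the derivative is assumed, and is moved to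
  \<open>a\<close> by continuity.\<close>

lemma right_derivative_nonpos_imp_le:
  fixes h :: "real \<Rightarrow> real"
  assumes ab: "a \<le> b" and cont: "continuous_on {a..b} h"
    and deriv: "\<And>x. a < x \<Longrightarrow> x < b \<Longrightarrow> \<exists>d\<le>0. (h has_real_derivative d) (at_right x)"
  shows "h b \<le> h a"
proof (cases "a = b")
  case False
  then have ab': "a < b" using ab by simp
  have slope: "h b \<le> h a' + \<epsilon> * (b - a')" if a': "a < a'" "a' < b" and \<epsilon>: "0 < \<epsilon>" for a' \<epsilon>
  proof (rule ccontr)
    assume neg: "\<not> h b \<le> h a' + \<epsilon> * (b - a')"
    define K where "K r = h r - h a' - \<epsilon> * (r - a')" for r
    have contK: "continuous_on {a'..b} K"
      unfolding K_def using a' by (intro continuous_intros continuous_on_subset[OF cont]) auto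
    define S where "S = {r \<in> {a'..b}. K r \<le> 0}"
    have "closed S"
      unfolding S_def using contK by (intro continuous_closed_preimage_constant continuous_on_closed_Collect_le continuous_on_const) auto
    moreover have "bounded S" by (rule bounded_subset[of "{a'..b}"]) (auto simp: S_def)
    ultimately have "compact S" by (simp add: compact_eq_bounded_closed)
    moreover have "a' \<in> S" using a' by (simp add: S_def K_def)
    ultimately obtain r where r: "r \<in> S" "\<And>s. s \<in> S \<Longrightarrow> s \<le> r"
      using compact_attains_sup[of S] by auto
    have "K b > 0" using neg by (simp add: K_def)
    then have rb: "a' \<le> r" "r < b" "K r \<le> 0" using r(1) by (auto simp: S_def order_less_le)
    then obtain d where d: "d \<le> 0" "(h has_real_derivative d) (at_right r)" using deriv[of r] a' by auto
    have "(K has_real_derivative (d - \<epsilon>)) (at_right r)"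
      unfolding K_def using d(2) by (auto intro!: derivative_eq_intros)
    then have "((\<lambda>y. (K y - K r) / (y - r)) \<longlongrightarrow> d - \<epsilon>) (at_right r)"
      by (simp add: has_field_derivative_iff)
    then have "\<forall>\<^sub>F y in at_right r. (K y - K r) / (y - r) < 0"
      using d \<epsilon> by (intro order_tendstoD(2)) auto
    then have "\<forall>\<^sub>F y in at_right r. (K y - K r) / (y - r) < 0 \<and> r < y \<and> y < b"
      using eventually_at_right_less[of r] eventually_at_right[OF rb(2)] rb(2)
      by (auto simp: eventually_conj_iff)
    from eventually_happens'[OF trivial_limit_at_right_real this]
    obtain y where y: "(K y - K r) / (y - r) < 0" "r < y" "y < b" by auto
    then have "K y < K r" by (simp add: divide_less_0_iff)
    then have "y \<in> S" using rb y a' by (auto simp: S_def)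
    then show False using r(2) y by fastforce
  qed
  have le: "h b \<le> h a'" if a': "a < a'" "a' < b" for a'
  proof (rule field_le_epsilon)
    fix e :: real assume "0 < e"
    then show "h b \<le> h a' + e" using slope[OF a', of "e / (b - a')"] a' by simp
  qed
  have "(h \<longlongrightarrow> h a) (at_right a)"
    using cont ab' by (auto simp: continuous_on_def at_within_Icc_at_right dest: bspec[of _ _ a])
  then show ?thesis
  proof (rule tendsto_lowerbound)
    show "\<forall>\<^sub>F x in at_right a. h b \<le> h x"
      using eventually_at_right_less[of a] eventually_at_right[OF ab'] ab' le
      by (auto simp: eventually_at_right_field)
  qed simp
qed simp

context diffusion
begin

section \<open>Davies' method for exponentially weighted norms\<close>

lemma filterlim_inverse_nat: "filterlim (\<lambda>n. 1 / real n) (at_right 0) sequentially"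
proof (subst filterlim_at, intro conjI)
  show "\<forall>\<^sub>F n in sequentially. 1 / real n \<in> {0<..} \<and> 1 / real n \<noteq> 0"
    using eventually_gt_at_top[of 0] by eventually_elim auto
qed (rule lim_1_over_n)

text \<open>With weights \<open>a, b\<close> and values \<open>x, y\<close> of \<open>v\<close> at
  the two times, the product of increments is \<open>(b y - a x)^2 - (a - b)^2 x y\<close>. The
  square is dropped, and \<open>(a - b)^2 = a b (exp z + exp (- z) - 2)\<close> with
  \<open>z\<close> equal to \<open>\<alpha>\<close> times the increment of \<open>f\<close>. Its
  quadratic part converges to \<open>\<alpha>^2\<close> times \<open>Iform\<close> of the squared
  weighted function, and its quartic part vanishes by \<open>fourth_moment_tendsto\<close>.\<close>

lemma weighted_energy_lower_bound:
  assumes f: "f \<in> Bb" "f \<in> D" "continuous_on UNIV f"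
    and If: "\<And>h. h \<in> Bb \<Longrightarrow> h \<in> D \<Longrightarrow> Iform E f f h \<le> (\<integral>x. \<bar>h x\<bar> \<partial>m)"
    and v: "v \<in> Bb" "v \<in> D"
  shows "- (\<alpha>\<^sup>2) * (\<integral>x. (exp (\<alpha> * f x) * v x)\<^sup>2 \<partial>m) \<le> 2 * E v (\<lambda>x. (exp (\<alpha> * f x))\<^sup>2 * v x)"
proof -
  let ?\<phi> = "\<lambda>x. exp (\<alpha> * f x)"
  let ?u = "\<lambda>x. (?\<phi> x)\<^sup>2 * v x" and ?w = "\<lambda>x. ?\<phi> x * v x"
  let ?ww = "\<lambda>x. ?w x * ?w x"
  have \<phi>: "?\<phi> \<in> Bb" "?\<phi> \<in> D" using f Bb_exp D_exp by auto
  have w: "?w \<in> Bb" "?w \<in> D" using \<phi> v D_mult by auto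
  have ww: "?ww \<in> Bb" "?ww \<in> D" using w D_mult by auto
  have u: "?u \<in> Bb" "?u \<in> D"
    using \<phi> w D_mult[OF \<phi> w] by (auto simp: power2_eq_square mult.assoc)
  obtain C where C: "0 < C" "\<And>x. \<bar>f x\<bar> \<le> C" using f by (metis bmE)
  obtain W where W: "0 < W" "\<And>x. \<bar>?w x\<bar> \<le> W" using bmE[OF w(1)] by blast
  \<comment> \<open>Coefficient of the fourth power of the increment: \<open>W\<close> bounds the
    weighted function, and increments of \<open>f\<close> are at most \<open>2 * C\<close> in
    absolute value.\<close>
  define K where "K = W\<^sup>2 * (exp (\<bar>\<alpha>\<bar> * (2 * C)) * \<alpha> ^ 4)"
  have [measurable]: "f \<in> borel_measurable borel" "v \<in> borel_measurable borel"
    using f v by (auto intro: bm_borel_measurable)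
  have ineq: "- (\<alpha>\<^sup>2 * (n * (\<integral>w. ?ww (X 0 w) * (inc f (1 / n) 0 w)\<^sup>2 \<partial>Q)) + K * (n * (\<integral>w. (inc f (1 / n) 0 w) ^ 4 \<partial>Q)))
      \<le> 2 * (ip m (\<lambda>x. v x - T (1 / n) v x) ?u / (1 / n))" if n: "0 < n" for n :: real
  proof -
    let ?\<tau> = "1 / n"
    have \<tau>: "0 < ?\<tau>" using n by simp
    let ?\<Delta> = "inc f ?\<tau> 0"
    have \<Delta>: "?\<Delta> \<in> bm Q" using f \<tau> by (intro inc_bm) auto
    have pw: "- ((?ww (X 0 w) + ?ww (X ?\<tau> w)) * (\<alpha>\<^sup>2 * (?\<Delta> w)\<^sup>2) / 2 + K * (?\<Delta> w) ^ 4) \<le>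
        (v (X ?\<tau> w) - v (X 0 w)) * (?u (X ?\<tau> w) - ?u (X 0 w))" for w
    proof -
      \<comment> \<open>The factor \<open>a * b\<close> in \<open>(a - b)^2\<close> combines with
        \<open>x * y\<close> into \<open>(a * x) * (b * y)\<close>, the product of the weighted
        function at the two times. The mean of the two squares bounds it and leaves weights that
        depend on one time each.\<close>
      define a b x y c where abc: "a = ?\<phi> (X 0 w)" "b = ?\<phi> (X ?\<tau> w)" "x = v (X 0 w)" "y = v (X ?\<tau> w)"
        "c = exp (\<alpha> * ?\<Delta> w) + exp (- (\<alpha> * ?\<Delta> w)) - 2"
      have b: "b = a * exp (\<alpha> * ?\<Delta> w)" and a: "a = b * exp (- (\<alpha> * ?\<Delta> w))"
        by (simp_all add: abc inc_0 algebra_simps flip: exp_add)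
      have "a * b * c = a * b * exp (\<alpha> * ?\<Delta> w) + a * b * exp (- (\<alpha> * ?\<Delta> w)) - 2 * a * b"
        by (simp add: abc(5) algebra_simps)
      also have "a * b * exp (\<alpha> * ?\<Delta> w) = b * b" using b by simp
      also have "a * b * exp (- (\<alpha> * ?\<Delta> w)) = a * a" using a by simp
      finally have abc2: "(a - b)\<^sup>2 = a * b * c" by (simp add: power2_eq_square algebra_simps)
      have id: "(y - x) * (b\<^sup>2 * y - a\<^sup>2 * x) = (b * y - a * x)\<^sup>2 - (a - b)\<^sup>2 * (x * y)"
        by (simp add: power2_eq_square algebra_simps)
      have c0: "0 \<le> c" unfolding abc by (rule exp_plus_exp_minus_ge)
      have "\<bar>\<alpha> * ?\<Delta> w\<bar> \<le> \<bar>\<alpha>\<bar> * (2 * C)"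
        using inc_abs_le[of f C ?\<tau> 0 w] C by (simp add: abs_mult mult_left_mono)
      then have c1: "c \<le> \<alpha>\<^sup>2 * (?\<Delta> w)\<^sup>2 + exp (\<bar>\<alpha>\<bar> * (2 * C)) * (\<alpha> ^ 4 * (?\<Delta> w) ^ 4)"
        using exp_plus_exp_minus_le unfolding abc by (metis power_mult_distrib)
      let ?s = "((a * x)\<^sup>2 + (b * y)\<^sup>2) / 2"
      have xW: "(a * x)\<^sup>2 \<le> W\<^sup>2" "(b * y)\<^sup>2 \<le> W\<^sup>2"
        unfolding abc using W by (metis abs_ge_zero power2_abs power_mono)+
      have "(a - b)\<^sup>2 * (x * y) = ((a * x) * (b * y)) * c" using abc2 by (simp add: algebra_simps)
      also have "\<dots> \<le> ?s * c"
        using sum_squares_bound[of "a * x" "b * y"] c0 by (intro mult_right_mono) auto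
      also have "\<dots> \<le> ?s * (\<alpha>\<^sup>2 * (?\<Delta> w)\<^sup>2 + exp (\<bar>\<alpha>\<bar> * (2 * C)) * (\<alpha> ^ 4 * (?\<Delta> w) ^ 4))"
        using c1 by (intro mult_left_mono) auto
      also have "\<dots> = ?s * (\<alpha>\<^sup>2 * (?\<Delta> w)\<^sup>2) + ?s * (exp (\<bar>\<alpha>\<bar> * (2 * C)) * (\<alpha> ^ 4 * (?\<Delta> w) ^ 4))"
        by (simp add: distrib_left)
      also have "?s * (exp (\<bar>\<alpha>\<bar> * (2 * C)) * (\<alpha> ^ 4 * (?\<Delta> w) ^ 4)) \<le> W\<^sup>2 * (exp (\<bar>\<alpha>\<bar> * (2 * C)) * (\<alpha> ^ 4 * (?\<Delta> w) ^ 4))"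
        using xW by (intro mult_right_mono mult_nonneg_nonneg) auto
      finally have "(a - b)\<^sup>2 * (x * y) \<le> ?s * (\<alpha>\<^sup>2 * (?\<Delta> w)\<^sup>2) + K * (?\<Delta> w) ^ 4"
        by (simp add: K_def mult.assoc)
      moreover have "0 \<le> (b * y - a * x)\<^sup>2" by simp
      ultimately have "- (?s * (\<alpha>\<^sup>2 * (?\<Delta> w)\<^sup>2) + K * (?\<Delta> w) ^ 4) \<le> (y - x) * (b\<^sup>2 * y - a\<^sup>2 * x)"
        unfolding id by linarith
      moreover have "?s * (\<alpha>\<^sup>2 * (?\<Delta> w)\<^sup>2) = ((a * x) * (a * x) + (b * y) * (b * y)) * (\<alpha>\<^sup>2 * (?\<Delta> w)\<^sup>2) / 2"
        by (simp add: power2_eq_square)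
      ultimately have "- (((a * x) * (a * x) + (b * y) * (b * y)) * (\<alpha>\<^sup>2 * (?\<Delta> w)\<^sup>2) / 2 + K * (?\<Delta> w) ^ 4)
          \<le> (y - x) * (b\<^sup>2 * y - a\<^sup>2 * x)" by (simp only:)
      then show ?thesis unfolding abc(1-4) .
    qed
    have i0: "integrable Q (\<lambda>w. ?ww (X 0 w) * (?\<Delta> w)\<^sup>2)" and i1: "integrable Q (\<lambda>w. ?ww (X ?\<tau> w) * (?\<Delta> w)\<^sup>2)"
      and i4: "integrable Q (\<lambda>w. (?\<Delta> w) ^ 4)"
      by (intro bm_Q_integrable bm_mult bm_power[OF \<Delta>] bm_X[OF ww(1)]; use \<tau> in simp)+
    \<comment> \<open>Reversibility turns the mean of the weights at the two times into the weight
      at time 0, which is the form required by \<open>Iform_lim\<close>.\<close>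
    have flip: "(\<integral>w. ?ww (X ?\<tau> w) * (?\<Delta> w)\<^sup>2 \<partial>Q) = (\<integral>w. ?ww (X 0 w) * (?\<Delta> w)\<^sup>2 \<partial>Q)"
    proof -
      let ?\<Phi> = "\<lambda>(x, y). ?ww x * (f y - f x)\<^sup>2"
      have "?\<Phi> \<in> borel_measurable (borel \<Otimes>\<^sub>M borel)" by measurable
      from pair_flip[OF this, of ?\<tau>] \<tau> show ?thesis
        by (simp add: inc_0 power2_commute)
    qed
    have "- (\<alpha>\<^sup>2 * (\<integral>w. ?ww (X 0 w) * (?\<Delta> w)\<^sup>2 \<partial>Q) + K * (\<integral>w. (?\<Delta> w) ^ 4 \<partial>Q)) =
        (\<integral>w. - (\<alpha>\<^sup>2 / 2 * (?ww (X 0 w) * (?\<Delta> w)\<^sup>2) + \<alpha>\<^sup>2 / 2 * (?ww (X ?\<tau> w) * (?\<Delta> w)\<^sup>2) + K * (?\<Delta> w) ^ 4) \<partial>Q)"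
      using i0 i1 i4 flip by simp
    also have "\<dots> = (\<integral>w. - ((?ww (X 0 w) + ?ww (X ?\<tau> w)) * (\<alpha>\<^sup>2 * (?\<Delta> w)\<^sup>2) / 2 + K * (?\<Delta> w) ^ 4) \<partial>Q)"
      by (intro Bochner_Integration.integral_cong) (auto simp: algebra_simps)
    also have "\<dots> \<le> (\<integral>w. (v (X ?\<tau> w) - v (X 0 w)) * (?u (X ?\<tau> w) - ?u (X 0 w)) \<partial>Q)"
    proof (intro integral_mono pw)
      have "(\<lambda>w. - ((?ww (X 0 w) + ?ww (X ?\<tau> w)) * (\<alpha>\<^sup>2 * (?\<Delta> w)\<^sup>2) * (1 / 2) + K * (?\<Delta> w) ^ 4)) \<in> bm Q"
        by (intro bm_uminus bm_add bm_mult bm_const bm_power[OF \<Delta>] bm_X[OF ww(1)]; use \<tau> in simp)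
      then show "integrable Q (\<lambda>w. - ((?ww (X 0 w) + ?ww (X ?\<tau> w)) * (\<alpha>\<^sup>2 * (?\<Delta> w)\<^sup>2) / 2 + K * (?\<Delta> w) ^ 4))"
        using bm_Q_integrable by fastforce
      show "integrable Q (\<lambda>w. (v (X ?\<tau> w) - v (X 0 w)) * (?u (X ?\<tau> w) - ?u (X 0 w)))"
        by (intro bm_Q_integrable bm_mult[of "\<lambda>w. v (X ?\<tau> w) - v (X 0 w)"] bm_diff bm_X[OF u(1)] bm_X[OF v(1)]; use \<tau> in simp)
    qed
    also have "\<dots> = 2 * ip m (\<lambda>x. v x - T ?\<tau> v x) ?u"
      using u v \<tau> by (subst ip_minus_T_eq) auto
    finally have "n * - (\<alpha>\<^sup>2 * (\<integral>w. ?ww (X 0 w) * (?\<Delta> w)\<^sup>2 \<partial>Q) + K * (\<integral>w. (?\<Delta> w) ^ 4 \<partial>Q)) \<le>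
        n * (2 * ip m (\<lambda>x. v x - T ?\<tau> v x) ?u)"
      using n by (intro mult_left_mono) auto
    then show ?thesis using n by (simp add: algebra_simps)
  qed
  have "(\<lambda>n. 2 * (ip m (\<lambda>x. v x - T (1 / real n) v x) ?u / (1 / real n))) \<longlonglongrightarrow> 2 * E v ?u"
    using filterlim_compose[OF E_lim[OF v(2) u(2)] filterlim_inverse_nat] by (intro tendsto_mult tendsto_const)
  moreover have "(\<lambda>n. - (\<alpha>\<^sup>2 * (real n * (\<integral>w. ?ww (X 0 w) * (inc f (1 / real n) 0 w)\<^sup>2 \<partial>Q)) +
      K * (real n * (\<integral>w. (inc f (1 / real n) 0 w) ^ 4 \<partial>Q)))) \<longlonglongrightarrow> - (\<alpha>\<^sup>2 * Iform E f f ?ww + K * 0)"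
    using filterlim_compose[OF Iform_lim[OF f(1,2) ww] filterlim_inverse_nat]
    by (intro tendsto_intros fourth_moment_tendsto f) (simp add: inc_0 mult.commute)
  moreover have "\<forall>\<^sub>F n in sequentially. - (\<alpha>\<^sup>2 * (real n * (\<integral>w. ?ww (X 0 w) * (inc f (1 / real n) 0 w)\<^sup>2 \<partial>Q)) +
      K * (real n * (\<integral>w. (inc f (1 / real n) 0 w) ^ 4 \<partial>Q))) \<le> 2 * (ip m (\<lambda>x. v x - T (1 / real n) v x) ?u / (1 / real n))"
    using eventually_gt_at_top[of 0] by eventually_elim (rule ineq, simp)
  ultimately have "- (\<alpha>\<^sup>2 * Iform E f f ?ww + K * 0) \<le> 2 * E v ?u"
    using tendsto_le[OF sequentially_bot] by blast
  moreover have "\<alpha>\<^sup>2 * Iform E f f ?ww \<le> \<alpha>\<^sup>2 * (\<integral>x. (?w x)\<^sup>2 \<partial>m)"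
    using If[OF ww] by (intro mult_left_mono) (auto simp: power2_eq_square)
  ultimately show ?thesis by simp
qed

text \<open>The quadratic remainder is negligible: the squared norm of \<open>T t v - v\<close>
  divided by \<open>t\<close> equals \<open>2 * en t v - 2 * en (2 * t) v\<close>, and both energies
  have the limit \<open>E v v\<close>. The linear term gives the derivative.\<close>

lemma weighted_right_derivative:
  assumes \<phi>: "\<phi> \<in> Bb" "\<phi> \<in> D" and v: "v \<in> Bb" "v \<in> D"
  shows "((\<lambda>t. (ip m (\<lambda>x. \<phi> x * T t v x) (\<lambda>x. \<phi> x * T t v x) - ip m (\<lambda>x. \<phi> x * v x) (\<lambda>x. \<phi> x * v x)) / t)
    \<longlongrightarrow> - 2 * E v (\<lambda>x. (\<phi> x)\<^sup>2 * v x)) (at_right 0)"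
proof -
  let ?u = "\<lambda>x. (\<phi> x)\<^sup>2 * v x" and ?p = "\<lambda>t x. T t v x - v x"
  have \<phi>v: "(\<lambda>x. \<phi> x * v x) \<in> Bb" "(\<lambda>x. \<phi> x * v x) \<in> D" using \<phi> v D_mult by auto
  have u: "?u \<in> Bb" "?u \<in> D"
    using \<phi> \<phi>v D_mult[OF \<phi> \<phi>v] by (auto simp: power2_eq_square mult.assoc)
  have vL: "v \<in> L2 m" using v by (rule_tac bm_L2)
  obtain c where c: "\<And>x. \<bar>\<phi> x\<bar> \<le> c" using \<phi> by (metis bmE)
  let ?r = "\<lambda>t. ip m (\<lambda>x. \<phi> x * ?p t x) (\<lambda>x. \<phi> x * ?p t x)"
  have eq: "ip m (\<lambda>x. \<phi> x * T t v x) (\<lambda>x. \<phi> x * T t v x) - ip m (\<lambda>x. \<phi> x * v x) (\<lambda>x. \<phi> x * v x) =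
      ?r t - 2 * ip m (\<lambda>x. v x - T t v x) ?u" if t: "0 < t" for t
  proof -
    have L: "(\<lambda>x. \<phi> x * T t v x) \<in> L2 m" "(\<lambda>x. \<phi> x * v x) \<in> L2 m" and Tt: "T t v \<in> L2 m"
      using \<phi> vL t by (auto intro!: L2_bm_mult)
    have "?r t = ip m (\<lambda>x. \<phi> x * T t v x - \<phi> x * v x) (\<lambda>x. \<phi> x * T t v x - \<phi> x * v x)"
      by (simp add: right_diff_distrib)
    also have "\<dots> = ip m (\<lambda>x. \<phi> x * T t v x) (\<lambda>x. \<phi> x * T t v x) - 2 * ip m (\<lambda>x. \<phi> x * T t v x) (\<lambda>x. \<phi> x * v x)
        + ip m (\<lambda>x. \<phi> x * v x) (\<lambda>x. \<phi> x * v x)"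
      using L by (rule ip_diff_self)
    also have "ip m (\<lambda>x. \<phi> x * T t v x) (\<lambda>x. \<phi> x * v x) = ip m (T t v) ?u"
      "ip m (\<lambda>x. \<phi> x * v x) (\<lambda>x. \<phi> x * v x) = ip m v ?u"
      by (simp_all add: ip_def power2_eq_square algebra_simps)
    moreover have "ip m (\<lambda>x. v x - T t v x) ?u = ip m v ?u - ip m (T t v) ?u"
      using u vL Tt by (intro ip_diff_left) (auto intro: bm_L2)
    ultimately show ?thesis by (simp add: ip_def power2_eq_square algebra_simps)
  qed
  have r_le: "?r t / t \<le> c\<^sup>2 * (2 * en t v - 2 * en (2 * t) v)" if t: "0 < t" for t
  proof -
    have p: "?p t \<in> L2 m" using vL t by (intro L2_diff T_L2) auto
    have "?r t = (\<integral>x. (\<phi> x * ?p t x)\<^sup>2 \<partial>m)" by (rule ip_self)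
    also have "\<dots> \<le> (\<integral>x. c\<^sup>2 * (?p t x)\<^sup>2 \<partial>m)"
    proof (rule integral_mono)
      show "integrable m (\<lambda>x. (\<phi> x * ?p t x)\<^sup>2)" using L2_bm_mult[OF \<phi>(1) p] by (simp add: L2_def)
      show "integrable m (\<lambda>x. c\<^sup>2 * (?p t x)\<^sup>2)" using p by (simp add: L2_def)
      have "(\<phi> x)\<^sup>2 \<le> c\<^sup>2" for x using c[of x] by (metis abs_ge_zero power2_abs power_mono)
      then show "(\<phi> x * ?p t x)\<^sup>2 \<le> c\<^sup>2 * (?p t x)\<^sup>2" for x
        by (simp add: power_mult_distrib mult_right_mono)
    qed
    also have "\<dots> = c\<^sup>2 * ip m (?p t) (?p t)" by (simp add: ip_self)
    also have "ip m (?p t) (?p t) = G v 0 - 2 * G v t + G v (2 * t)"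
      using t vL by (intro ip_T_minus_self) auto
    also have "\<dots> = t * (2 * en t v - 2 * en (2 * t) v)"
      using t vL by (simp add: en_eq field_simps)
    finally show ?thesis using t by (simp add: field_simps)
  qed
  have "((\<lambda>t. en (2 * t) v) \<longlongrightarrow> E v v) (at_right 0)"
  proof (rule filterlim_compose[OF en_tendsto[OF v(2)]])
    show "filterlim (\<lambda>t::real. 2 * t) (at_right 0) (at_right 0)"
    proof (subst filterlim_at, intro conjI)
      show "\<forall>\<^sub>F t::real in at_right 0. 2 * t \<in> {0<..} \<and> 2 * t \<noteq> 0"
        using eventually_at_right_less[of "0::real"] by eventually_elim auto
    qed (auto intro!: tendsto_eq_intros)
  qed
  then have "((\<lambda>t. c\<^sup>2 * (2 * en t v - 2 * en (2 * t) v)) \<longlongrightarrow> c\<^sup>2 * (2 * E v v - 2 * E v v)) (at_right 0)"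
    using en_tendsto[OF v(2)] by (intro tendsto_intros)
  then have lim: "((\<lambda>t. c\<^sup>2 * (2 * en t v - 2 * en (2 * t) v)) \<longlongrightarrow> 0) (at_right 0)" by simp
  have "((\<lambda>t. ?r t / t) \<longlongrightarrow> 0) (at_right 0)"
  proof (rule tendsto_sandwich[OF _ _ tendsto_const lim])
    show "\<forall>\<^sub>F t in at_right 0. ?r t / t \<le> c\<^sup>2 * (2 * en t v - 2 * en (2 * t) v)"
      using eventually_at_right_less[of "0::real"] by eventually_elim (rule r_le)
    show "\<forall>\<^sub>F t in at_right 0. 0 \<le> ?r t / t"
      using eventually_at_right_less[of "0::real"] by eventually_elim (simp add: ip_nonneg)
  qed
  then have "((\<lambda>t. ?r t / t - 2 * (ip m (\<lambda>x. v x - T t v x) ?u / t)) \<longlongrightarrow> 0 - 2 * E v ?u) (at_right 0)"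
    using E_lim[OF v(2) u(2)] by (intro tendsto_intros)
  then show ?thesis
  proof (simp only: diff_0 minus_mult_left[symmetric], elim Lim_transform_eventually)
    show "\<forall>\<^sub>F t in at_right 0. ?r t / t - 2 * (ip m (\<lambda>x. v x - T t v x) ?u / t) =
        (ip m (\<lambda>x. \<phi> x * T t v x) (\<lambda>x. \<phi> x * T t v x) - ip m (\<lambda>x. \<phi> x * v x) (\<lambda>x. \<phi> x * v x)) / t"
      using eventually_at_right_less[of "0::real"] by eventually_elim (simp add: eq diff_divide_distrib)
  qed
qed

text \<open>\<open>\<rho>\<close> is a seminorm dominated by the L2 norm, so the triangle inequality
  applies; the contraction property reduces continuity at any time to strong continuity at
  zero.\<close>

lemma weighted_continuous:
  assumes \<phi>: "\<phi> \<in> Bb" and u: "u \<in> L2 m"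
  shows "continuous_on {0..} (\<lambda>s. ip m (\<lambda>x. \<phi> x * T s u x) (\<lambda>x. \<phi> x * T s u x))" (is "continuous_on _ ?F")
proof -
  obtain c where c: "0 < c" "\<And>x. \<bar>\<phi> x\<bar> \<le> c" using \<phi> by (metis bmE)
  let ?N = "\<lambda>h. ip m (\<lambda>x. T h u x - u x) (\<lambda>x. T h u x - u x)"
  define \<rho> where "\<rho> f = sqrt (ip m (\<lambda>x. \<phi> x * f x) (\<lambda>x. \<phi> x * f x))" for f
  have tri: "\<rho> f \<le> \<rho> g + \<rho> (\<lambda>x. g x - f x)" if f: "f \<in> L2 m" and g: "g \<in> L2 m" for f g
  proof -
    let ?a = "\<lambda>x. \<phi> x * g x" and ?b = "\<lambda>x. \<phi> x * (g x - f x)"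
    have L: "?a \<in> L2 m" "?b \<in> L2 m" using f g \<phi> by (auto intro!: L2_bm_mult L2_diff)
    have "ip m (\<lambda>x. \<phi> x * f x) (\<lambda>x. \<phi> x * f x) = ip m (\<lambda>x. ?a x - ?b x) (\<lambda>x. ?a x - ?b x)"
      by (simp add: algebra_simps)
    also have "\<dots> = ip m ?a ?a - 2 * ip m ?a ?b + ip m ?b ?b" using L by (rule ip_diff_self)
    also have "\<dots> \<le> (\<rho> g)\<^sup>2 + 2 * (\<rho> g * \<rho> (\<lambda>x. g x - f x)) + (\<rho> (\<lambda>x. g x - f x))\<^sup>2"
      using ip_abs_le[OF L] ip_nonneg[of m ?a] ip_nonneg[of m ?b] by (simp add: \<rho>_def)
    also have "\<dots> = (\<rho> g + \<rho> (\<lambda>x. g x - f x))\<^sup>2" by (simp add: power2_sum)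
    finally show ?thesis
      unfolding \<rho>_def[of f] by (intro real_le_lsqrt) (auto simp: \<rho>_def ip_nonneg)
  qed
  have \<rho>_le: "\<rho> f \<le> c * sqrt (ip m f f)" if f: "f \<in> L2 m" for f
  proof -
    have "ip m (\<lambda>x. \<phi> x * f x) (\<lambda>x. \<phi> x * f x) \<le> (\<integral>x. c\<^sup>2 * (f x)\<^sup>2 \<partial>m)"
      unfolding ip_self
    proof (rule integral_mono)
      show "integrable m (\<lambda>x. (\<phi> x * f x)\<^sup>2)" using L2_bm_mult[OF \<phi> f] by (simp add: L2_def)
      show "integrable m (\<lambda>x. c\<^sup>2 * (f x)\<^sup>2)" using f by (simp add: L2_def)
      have "(\<phi> x)\<^sup>2 \<le> c\<^sup>2" for x using c(2)[of x] by (metis abs_ge_zero power2_abs power_mono)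
      then show "(\<phi> x * f x)\<^sup>2 \<le> c\<^sup>2 * (f x)\<^sup>2" for x by (simp add: power_mult_distrib mult_right_mono)
    qed
    also have "\<dots> = (c * sqrt (ip m f f))\<^sup>2" by (simp add: ip_self power_mult_distrib)
    finally show ?thesis unfolding \<rho>_def
      by (intro real_le_lsqrt) (use c in \<open>auto simp: ip_nonneg\<close>)
  qed
  have diff: "\<bar>\<rho> (T a u) - \<rho> (T b u)\<bar> \<le> c * sqrt (?N (b - a))" if ab: "0 \<le> a" "a \<le> b" for a b
  proof -
    have L: "T a u \<in> L2 m" "T b u \<in> L2 m" "T (b - a) u \<in> L2 m" using ab u by auto
    let ?d = "\<lambda>x. T b u x - T a u x"
    have d: "?d \<in> L2 m" "(\<lambda>x. T (b - a) u x - u x) \<in> L2 m" using L u by (auto intro: L2_diff)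
    have "AE x in m. T (a + (b - a)) u x = T a (T (b - a) u) x" using ab u by (intro T_add) auto
    moreover have "AE x in m. T a (\<lambda>x. T (b - a) u x - u x) x = T a (T (b - a) u) x - T a u x"
      using ab u L by (intro T_diff) auto
    ultimately have ae: "AE x in m. ?d x = T a (\<lambda>x. T (b - a) u x - u x) x"
      by eventually_elim simp
    have "ip m ?d ?d = ip m (T a (\<lambda>x. T (b - a) u x - u x)) (T a (\<lambda>x. T (b - a) u x - u x))"
      using d ab ae by (intro ip_cong_AE) (auto intro!: L2_borel_measurable)
    also have "\<dots> \<le> ?N (b - a)" using d ab by (intro T_contraction) auto
    finally have "c * sqrt (ip m ?d ?d) \<le> c * sqrt (?N (b - a))" using c by simp
    then have dN: "\<rho> ?d \<le> c * sqrt (?N (b - a))" using \<rho>_le[OF d(1)] by linarith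
    have "(\<lambda>x. \<phi> x * (T a u x - T b u x)) = (\<lambda>x. - (\<phi> x * ?d x))" by (auto simp: algebra_simps)
    then have "\<rho> (\<lambda>x. T a u x - T b u x) = \<rho> ?d" by (simp add: \<rho>_def ip_def)
    then show ?thesis using tri[OF L(1,2)] tri[OF L(2,1)] dN by simp
  qed
  have "continuous_on {0..} (\<lambda>s. \<rho> (T s u))"
  proof (rule continuous_onI)
    fix s e :: real assume s: "s \<in> {0..}" and e: "0 < e"
    have "((\<lambda>h. c * sqrt (?N h)) \<longlongrightarrow> c * sqrt 0) (at_right 0)"
      using T_continuous[OF u] by (intro tendsto_intros)
    then have "\<forall>\<^sub>F h in at_right 0. c * sqrt (?N h) < e"
      using e by (intro order_tendstoD(2)) auto
    then obtain d where d: "0 < d" "\<And>h. 0 < h \<Longrightarrow> h < d \<Longrightarrow> c * sqrt (?N h) < e"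
      by (auto simp: eventually_at_right_field)
    have "dist (\<rho> (T r u)) (\<rho> (T s u)) \<le> e" if r: "r \<in> {0..}" "dist r s < d" for r
    proof (cases r s rule: linorder_cases)
      case less
      then show ?thesis using diff[of r s] d(2)[of "s - r"] r by (auto simp: dist_real_def)
    next
      case greater
      then show ?thesis using diff[of s r] d(2)[of "r - s"] r s by (auto simp: dist_real_def abs_minus_commute)
    qed (use e in simp)
    then show "\<exists>d>0. \<forall>r\<in>{0..}. dist r s < d \<longrightarrow> dist (\<rho> (T r u)) (\<rho> (T s u)) \<le> e"
      using d(1) by blast
  qed
  then have "continuous_on {0..} (\<lambda>s. (\<rho> (T s u))\<^sup>2)" by (intro continuous_intros)
  then show ?thesis by (simp add: \<rho>_def ip_nonneg)
qed

text \<open>A Gronwall argument for \<open>exp (- \<alpha>^2 s) F s\<close>. For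
  \<open>s > 0\<close> the function \<open>T s u\<close> lies in \<open>D\<close>, so restarting the
  semigroup from a bounded version \<open>v\<close> of it reduces the derivative at \<open>s\<close>
  to the one at zero. At \<open>s = 0\<close> only continuity is available, as \<open>u\<close> need
  not lie in \<open>D\<close>.\<close>

lemma Davies_estimate:
  assumes f: "f \<in> Bb" "f \<in> D" "continuous_on UNIV f"
    and If: "\<And>h. h \<in> Bb \<Longrightarrow> h \<in> D \<Longrightarrow> Iform E f f h \<le> (\<integral>x. \<bar>h x\<bar> \<partial>m)"
    and u: "u \<in> Bb" and S: "0 \<le> S"
  shows "ip m (\<lambda>x. exp (\<alpha> * f x) * T S u x) (\<lambda>x. exp (\<alpha> * f x) * T S u x) \<le>
    exp (\<alpha>\<^sup>2 * S) * ip m (\<lambda>x. exp (\<alpha> * f x) * u x) (\<lambda>x. exp (\<alpha> * f x) * u x)"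
proof -
  let ?\<phi> = "\<lambda>x. exp (\<alpha> * f x)"
  define F where "F s = ip m (\<lambda>x. ?\<phi> x * T s u x) (\<lambda>x. ?\<phi> x * T s u x)" for s
  have \<phi>: "?\<phi> \<in> Bb" "?\<phi> \<in> D" using f Bb_exp D_exp by auto
  have uL: "u \<in> L2 m" using u by (rule bm_L2)
  obtain c where c: "\<And>x. \<bar>u x\<bar> \<le> c" using u by (metis bmE)
  define H where "H s = exp (- (\<alpha>\<^sup>2) * s) * F s" for s
  have "H S \<le> H 0"
  proof (rule right_derivative_nonpos_imp_le[OF S])
    have "continuous_on {0..S} F"
      unfolding F_def[abs_def] by (rule continuous_on_subset[OF weighted_continuous[OF \<phi>(1) uL]]) auto
    then show "continuous_on {0..S} H" unfolding H_def[abs_def] by (intro continuous_intros)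
    fix s assume s: "0 < s" "s < S"
    obtain v where v: "v \<in> Bb" "AE x in m. T s u x = v x"
      using T_representative[OF u c, of s] s by auto
    have vD: "v \<in> D" using D_cong[OF T_in_D[OF s(1) uL] _ v(2)] v(1) by (auto intro: bm_borel_measurable)
    have Ts: "T s u \<in> L2 m" using uL s by auto
    have shift: "F (s + t) = ip m (\<lambda>x. ?\<phi> x * T t v x) (\<lambda>x. ?\<phi> x * T t v x)" if t: "0 \<le> t" for t
    proof -
      have "AE x in m. T t (T s u) x = T t v x" using Ts v t by (intro T_cong) (auto intro: bm_L2)
      moreover have "AE x in m. T (t + s) u x = T t (T s u) x" using uL s t by (intro T_add) auto
      ultimately have "AE x in m. ?\<phi> x * T (s + t) u x = ?\<phi> x * T t v x"
        by eventually_elim (simp add: add.commute)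
      then show ?thesis
        unfolding F_def using s t uL v \<phi>
        by (intro ip_cong_AE) (auto intro!: L2_borel_measurable L2_bm_mult T_L2 intro: bm_L2)
    qed
    have Fs: "F s = ip m (\<lambda>x. ?\<phi> x * v x) (\<lambda>x. ?\<phi> x * v x)"
    proof -
      have "AE x in m. ?\<phi> x * T s u x = ?\<phi> x * v x" using v(2) by eventually_elim simp
      then show ?thesis
        unfolding F_def using Ts v \<phi>
        by (intro ip_cong_AE) (auto intro!: L2_borel_measurable L2_bm_mult intro: bm_L2)
    qed
    define d where "d = - 2 * E v (\<lambda>x. (?\<phi> x)\<^sup>2 * v x)"
    have d_le: "d \<le> \<alpha>\<^sup>2 * F s"
      using weighted_energy_lower_bound[OF f If v(1) vD, of \<alpha>] unfolding d_def Fs ip_self by simp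
    have "((\<lambda>t. (F (s + t) - F s) / t) \<longlongrightarrow> d) (at_right 0)"
      using weighted_right_derivative[OF \<phi> v(1) vD]
    proof (simp only: d_def, elim Lim_transform_eventually)
      show "\<forall>\<^sub>F t in at_right 0. (ip m (\<lambda>x. ?\<phi> x * T t v x) (\<lambda>x. ?\<phi> x * T t v x) - ip m (\<lambda>x. ?\<phi> x * v x) (\<lambda>x. ?\<phi> x * v x)) / t =
          (F (s + t) - F s) / t"
        using eventually_at_right_less[of "0::real"] by eventually_elim (simp add: shift Fs)
    qed
    then have "((\<lambda>y. (F y - F s) / (y - s)) \<longlongrightarrow> d) (at_right s)"
      by (subst filterlim_at_right_to_0) (simp add: add.commute)
    then have "(F has_real_derivative d) (at_right s)" by (simp add: has_field_derivative_iff)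
    then have "(H has_real_derivative (exp (- (\<alpha>\<^sup>2) * s) * (d - \<alpha>\<^sup>2 * F s))) (at_right s)"
      unfolding H_def[abs_def] by (auto intro!: derivative_eq_intros simp: algebra_simps)
    moreover have "exp (- (\<alpha>\<^sup>2) * s) * (d - \<alpha>\<^sup>2 * F s) \<le> 0"
      using d_le by (intro mult_nonneg_nonpos) auto
    ultimately show "\<exists>d\<le>0. (H has_real_derivative d) (at_right s)" by blast
  qed
  then have "exp (\<alpha>\<^sup>2 * S) * (exp (- (\<alpha>\<^sup>2) * S) * F S) \<le> exp (\<alpha>\<^sup>2 * S) * F 0"
    unfolding H_def by (intro mult_left_mono) auto
  then have "F S \<le> exp (\<alpha>\<^sup>2 * S) * F 0" by (simp add: mult.assoc[symmetric] flip: exp_add)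
  moreover have "F 0 = ip m (\<lambda>x. ?\<phi> x * u x) (\<lambda>x. ?\<phi> x * u x)"
  proof -
    have "AE x in m. ?\<phi> x * T 0 u x = ?\<phi> x * u x" using T_0[OF uL] by eventually_elim simp
    then show ?thesis
      unfolding F_def using uL \<phi>
      by (intro ip_cong_AE) (auto intro!: L2_borel_measurable L2_bm_mult T_L2)
  qed
  ultimately show ?thesis by (simp add: F_def)
qed

section \<open>Bounded versions of functions in the form domain\<close>

lemma Db_representative:
  assumes "f \<in> Db m D"
  obtains f' where "f' \<in> Bb" "f' \<in> D" "AE x in m. f' x = f x"
    "continuous_on UNIV f \<Longrightarrow> continuous_on UNIV f'"
proof -
  have fD: "f \<in> D" and [measurable]: "f \<in> borel_measurable borel"
    using assms by (auto simp: Db_def Linf_def borel_measurable_m)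
  obtain c where c: "AE x in m. \<bar>f x\<bar> \<le> c" using assms by (auto simp: Db_def Linf_def)
  define f' where "f' x = max (- \<bar>c\<bar>) (min \<bar>c\<bar> (f x))" for x
  have m': "f' \<in> borel_measurable borel" unfolding f'_def[abs_def] by measurable
  have ae: "AE x in m. f' x = f x" using c by eventually_elim (auto simp: f'_def)
  then have ae': "AE x in m. f x = f' x" by eventually_elim simp
  show ?thesis
  proof (rule that[OF _ D_cong[OF fD m' ae'] ae])
    show "f' \<in> Bb" by (rule bmI[OF m', of "\<bar>c\<bar>"]) (auto simp: f'_def)
    show "continuous_on UNIV f'" if "continuous_on UNIV f"
      unfolding f'_def[abs_def] using that by (intro continuous_intros)
  qed
qed

text \<open>Functions in \<open>D0\<close> are only essentially bounded. Truncation preserves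
  continuity and alters \<open>f\<close> on a null set, hence leaves each term of
  \<open>Iform\<close> unchanged.\<close>

lemma D0_representative:
  assumes f: "f \<in> D0 m E D" "continuous_on UNIV f"
  obtains f' where "f' \<in> Bb" "f' \<in> D" "continuous_on UNIV f'" "AE x in m. f' x = f x"
    "\<And>h. h \<in> Bb \<Longrightarrow> h \<in> D \<Longrightarrow> Iform E f' f' h \<le> (\<integral>x. \<bar>h x\<bar> \<partial>m)"
proof -
  have fb: "f \<in> Db m D" and If: "\<And>h. h \<in> Db m D \<Longrightarrow> Iform E f f h \<le> (\<integral>x. \<bar>h x\<bar> \<partial>m)"
    using f by (auto simp: D0_def)
  have fD: "f \<in> D" and fm[measurable]: "f \<in> borel_measurable borel"
    using fb by (auto simp: Db_def Linf_def borel_measurable_m)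
  obtain f' where B: "f' \<in> Bb" and D': "f' \<in> D" and ae: "AE x in m. f' x = f x"
    and cont: "continuous_on UNIV f'"
    using Db_representative[OF fb] f(2) by blast
  have bound: "Iform E f' f' h \<le> (\<integral>x. \<bar>h x\<bar> \<partial>m)" if h: "h \<in> Bb" "h \<in> D" for h
  proof -
    have hm[measurable]: "h \<in> borel_measurable borel" using h by (rule_tac bm_borel_measurable)
    obtain k where "\<And>x. \<bar>h x\<bar> \<le> k" using h by (metis bmE)
    then have "h \<in> Db m D"
      using h hm by (auto simp: Db_def Linf_def borel_measurable_m intro!: exI[of _ k])
    then have "Iform E f f h \<le> (\<integral>x. \<bar>h x\<bar> \<partial>m)" by (rule If)
    moreover have "Iform E f f h = Iform E f' f' h"
    proof -
      have 1: "(\<lambda>x. f' x * h x) \<in> D" "(\<lambda>x. f' x * f' x) \<in> D" using D_mult B D' h by auto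
      have 2: "AE x in m. f' x * h x = f x * h x" "AE x in m. f' x * f' x = f x * f x"
        using ae by (eventually_elim, simp)+
      have 3: "E (\<lambda>x. f x * h x) k = E (\<lambda>x. f' x * h x) k" if "k \<in> D" for k
        by (rule E_cong[OF 1(1) _ 2(1) that]) measurable
      have 4: "E (\<lambda>x. f x * f x) k = E (\<lambda>x. f' x * f' x) k" if "k \<in> D" for k
        by (rule E_cong[OF 1(2) _ 2(2) that]) measurable
      have "E (\<lambda>x. f' x * h x) f = E (\<lambda>x. f' x * h x) f'"
        using E_sym[OF 1(1) fD] E_sym[OF 1(1) D'] E_cong[OF D' fm ae 1(1)] by simp
      then show ?thesis unfolding Iform_def using 3[OF fD] 4[OF h(2)] by simp
    qed
    ultimately show ?thesis by simp
  qed
  show ?thesis by (rule that[OF B D' cont ae bound])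
qed

text \<open>The weight is at least \<open>exp (\<alpha> * a)\<close> on \<open>B\<close> and at most
  \<open>exp (\<alpha> * b)\<close> where \<open>g\<close> is nonzero, so
  \<open>Davies_estimate\<close> leaves the exponent
  \<open>\<alpha>^2 * s - 2 * \<alpha> * (a - b)\<close>. The separation is stated for
  \<open>f\<close>, whose point values enter \<open>d\<close>; its bounded version agrees almost
  everywhere, enough under the integrals.\<close>

lemma Gaussian_estimate:
  assumes f: "f \<in> D0 m E D" "continuous_on UNIV f" and g: "g \<in> Bb" and B: "B \<in> sets borel"
    and fB: "\<And>x. x \<in> B \<Longrightarrow> a \<le> f x" and fg: "\<And>x. g x \<noteq> 0 \<Longrightarrow> f x \<le> b"
    and s: "0 < s" and r: "0 \<le> r" "r \<le> a - b"
  shows "ip m (\<lambda>x. indicator B x * T s g x) (\<lambda>x. indicator B x * T s g x) \<le> exp (- (r\<^sup>2 / s)) * ip m g g"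
proof -
  obtain f' where f': "f' \<in> Bb" "f' \<in> D" "continuous_on UNIV f'" and ae: "AE x in m. f' x = f x"
    and If: "\<And>h. h \<in> Bb \<Longrightarrow> h \<in> D \<Longrightarrow> Iform E f' f' h \<le> (\<integral>x. \<bar>h x\<bar> \<partial>m)"
    using D0_representative[OF f] by blast
  \<comment> \<open>The minimiser of \<open>\<alpha>^2 * s - 2 * \<alpha> * r\<close>, with minimum
    \<open>- r^2 / s\<close>.\<close>
  define \<alpha> where "\<alpha> = r / s"
  have \<alpha>: "0 \<le> \<alpha>" using r s by (simp add: \<alpha>_def)
  let ?\<phi> = "\<lambda>x. exp (\<alpha> * f' x)"
  have \<phi>: "?\<phi> \<in> Bb" using f' Bb_exp by auto
  have gL: "g \<in> L2 m" and TL: "T s g \<in> L2 m" using g s by (auto intro: bm_L2)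
  have BT: "(\<lambda>x. indicator B x * T s g x) \<in> L2 m" using B TL by (intro L2_bm_mult bm_indicator)
  have 1: "exp (2 * \<alpha> * a) * ip m (\<lambda>x. indicator B x * T s g x) (\<lambda>x. indicator B x * T s g x) \<le>
      ip m (\<lambda>x. ?\<phi> x * T s g x) (\<lambda>x. ?\<phi> x * T s g x)"
  proof -
    have "(\<integral>x. exp (2 * \<alpha> * a) * (indicator B x * T s g x)\<^sup>2 \<partial>m) \<le> (\<integral>x. (?\<phi> x * T s g x)\<^sup>2 \<partial>m)"
    proof (rule integral_mono_AE)
      show "integrable m (\<lambda>x. exp (2 * \<alpha> * a) * (indicator B x * T s g x)\<^sup>2)" using BT by (simp add: L2_def)
      show "integrable m (\<lambda>x. (?\<phi> x * T s g x)\<^sup>2)" using L2_bm_mult[OF \<phi> TL] by (simp add: L2_def)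
      show "AE x in m. exp (2 * \<alpha> * a) * (indicator B x * T s g x)\<^sup>2 \<le> (?\<phi> x * T s g x)\<^sup>2"
        using ae
      proof eventually_elim
        case (elim x)
        have "exp (2 * \<alpha> * a) \<le> (?\<phi> x)\<^sup>2" if "x \<in> B"
          using fB[OF that] elim \<alpha> by (simp add: exp_double[symmetric] mult.assoc mult_left_mono)
        then show ?case by (auto simp: indicator_def power_mult_distrib mult_right_mono)
      qed
    qed
    then show ?thesis by (simp add: ip_self)
  qed
  have 2: "ip m (\<lambda>x. ?\<phi> x * g x) (\<lambda>x. ?\<phi> x * g x) \<le> exp (2 * \<alpha> * b) * ip m g g"
  proof -
    have "(\<integral>x. (?\<phi> x * g x)\<^sup>2 \<partial>m) \<le> (\<integral>x. exp (2 * \<alpha> * b) * (g x)\<^sup>2 \<partial>m)"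
    proof (rule integral_mono_AE)
      show "integrable m (\<lambda>x. exp (2 * \<alpha> * b) * (g x)\<^sup>2)" using gL by (simp add: L2_def)
      show "integrable m (\<lambda>x. (?\<phi> x * g x)\<^sup>2)" using L2_bm_mult[OF \<phi> gL] by (simp add: L2_def)
      show "AE x in m. (?\<phi> x * g x)\<^sup>2 \<le> exp (2 * \<alpha> * b) * (g x)\<^sup>2"
        using ae
      proof eventually_elim
        case (elim x)
        have "(?\<phi> x)\<^sup>2 \<le> exp (2 * \<alpha> * b)" if "g x \<noteq> 0"
          using fg[OF that] elim \<alpha> by (simp add: exp_double[symmetric] mult.assoc mult_left_mono)
        then show ?case by (cases "g x = 0") (auto simp: power_mult_distrib mult_right_mono)
      qed
    qed
    then show ?thesis by (simp add: ip_self)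
  qed
  let ?I = "ip m (\<lambda>x. indicator B x * T s g x) (\<lambda>x. indicator B x * T s g x)"
  have "exp (2 * \<alpha> * a) * ?I \<le> exp (\<alpha>\<^sup>2 * s) * ip m (\<lambda>x. ?\<phi> x * g x) (\<lambda>x. ?\<phi> x * g x)"
    using 1 Davies_estimate[OF f' If g, of s \<alpha>] s by simp
  also have "\<dots> \<le> exp (\<alpha>\<^sup>2 * s) * (exp (2 * \<alpha> * b) * ip m g g)"
    using 2 by (intro mult_left_mono) auto
  finally have "exp (- (2 * \<alpha> * a)) * (exp (2 * \<alpha> * a) * ?I) \<le>
      exp (- (2 * \<alpha> * a)) * (exp (\<alpha>\<^sup>2 * s) * (exp (2 * \<alpha> * b) * ip m g g))"
    by (intro mult_left_mono) auto
  moreover have "exp (- (2 * \<alpha> * a)) * (exp (2 * \<alpha> * a) * ?I) = ?I"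
    by (simp flip: exp_add mult.assoc)
  moreover have "exp (- (2 * \<alpha> * a)) * (exp (\<alpha>\<^sup>2 * s) * (exp (2 * \<alpha> * b) * ip m g g)) =
      exp (- (2 * \<alpha> * a) + (\<alpha>\<^sup>2 * s + 2 * \<alpha> * b)) * ip m g g"
    by (simp only: exp_add mult.assoc)
  ultimately have "?I \<le> exp (- (2 * \<alpha> * a) + (\<alpha>\<^sup>2 * s + 2 * \<alpha> * b)) * ip m g g" by (simp only:)
  also have "\<dots> \<le> exp (- (r\<^sup>2 / s)) * ip m g g"
  proof (intro mult_right_mono ip_nonneg)
    have "\<alpha>\<^sup>2 * s = r\<^sup>2 / s" using s by (simp add: \<alpha>_def power2_eq_square)
    moreover have "2 * \<alpha> * r \<le> 2 * \<alpha> * (a - b)" using r \<alpha> by (intro mult_left_mono) auto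
    moreover have "2 * \<alpha> * r = 2 * (r\<^sup>2 / s)" by (simp add: \<alpha>_def power2_eq_square)
    ultimately have "- (2 * \<alpha> * a) + (\<alpha>\<^sup>2 * s + 2 * \<alpha> * b) \<le> - (r\<^sup>2 / s)" by (simp add: algebra_simps)
    then show "exp (- (2 * \<alpha> * a) + (\<alpha>\<^sup>2 * s + 2 * \<alpha> * b)) \<le> exp (- (r\<^sup>2 / s))" by simp
  qed
  finally show ?thesis .
qed

section \<open>The intrinsic metric\<close>

lemma Db_mult_D:
  assumes "f \<in> Db m D" "g \<in> Db m D"
  shows "(\<lambda>x. f x * g x) \<in> D"
proof -
  obtain f' where f': "f' \<in> Bb" "f' \<in> D" "AE x in m. f' x = f x" using Db_representative[OF assms(1)] by blast
  obtain g' where g': "g' \<in> Bb" "g' \<in> D" "AE x in m. g' x = g x" using Db_representative[OF assms(2)] by blast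
  have [measurable]: "f \<in> borel_measurable borel" "g \<in> borel_measurable borel"
    using assms by (auto simp: Db_def Linf_def borel_measurable_m)
  show ?thesis
  proof (rule D_cong[OF D_mult[OF f'(1,2) g'(1,2)]])
    show "AE x in m. f' x * g' x = f x * g x" using f'(3) g'(3) by eventually_elim simp
  qed measurable
qed

lemma D_uminus: "f \<in> D \<Longrightarrow> (\<lambda>x. - f x) \<in> D"
  using D_lincomb[of f f "-1" 0] by simp

lemma E_uminus: "f \<in> D \<Longrightarrow> g \<in> D \<Longrightarrow> E (\<lambda>x. - f x) g = - E f g"
  using E_lincomb[of f f g "-1" 0] by simp

lemma zero_D: "(\<lambda>_. 0) \<in> D"
proof -
  \<comment> \<open>Supplies some element of \<open>D\<close> from which to form the zero
    combination.\<close>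
  have "T 1 (\<lambda>_. 1) \<in> D" by (intro T_in_D bm_L2) auto
  from D_lincomb[OF this this, of 0 0] show ?thesis by simp
qed

lemma E_zero: "g \<in> D \<Longrightarrow> E (\<lambda>_. 0) g = 0"
  using E_lincomb[OF zero_D zero_D, of g 0 0] by simp

lemma D0_zero: "(\<lambda>_. 0) \<in> D0 m E D"
proof -
  have "(\<lambda>_. 0) \<in> Db m D" using zero_D by (auto simp: Db_def Linf_def)
  moreover have "Iform E (\<lambda>_. 0) (\<lambda>_. 0) h \<le> (\<integral>x. \<bar>h x\<bar> \<partial>m)" if "h \<in> Db m D" for h
    using that E_zero[OF zero_D] E_zero[of h] by (simp add: Iform_def Db_def)
  ultimately show ?thesis by (simp add: D0_def)
qed

text \<open>\<open>Iform\<close> is quadratic in its first two arguments. Closure under negation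
  makes a one-sided bound on \<open>d x y\<close> control absolute differences in
  \<open>abs_diff_le\<close>.\<close>

lemma D0_uminus:
  assumes f: "f \<in> D0 m E D"
  shows "(\<lambda>x. - f x) \<in> D0 m E D"
proof -
  have fb: "f \<in> Db m D" and fD: "f \<in> D" using f by (auto simp: D0_def Db_def)
  have nD: "(\<lambda>x. - f x) \<in> D" using fD by (rule D_uminus)
  have "(\<lambda>x. - f x) \<in> Db m D" using fb nD by (auto simp: Db_def Linf_def)
  moreover have "Iform E (\<lambda>x. - f x) (\<lambda>x. - f x) h = Iform E f f h" if h: "h \<in> Db m D" for h
  proof -
    have fh: "(\<lambda>x. f x * h x) \<in> D" using fb h by (rule Db_mult_D)
    have "E (\<lambda>x. - (f x * h x)) (\<lambda>x. - f x) = E (\<lambda>x. f x * h x) f"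
      using E_uminus[OF fh nD] E_sym[OF fh nD] E_uminus[OF fD fh] E_sym[OF fh fD] by simp
    then show ?thesis by (simp add: Iform_def)
  qed
  ultimately show ?thesis using f by (simp add: D0_def)
qed

abbreviation "d \<equiv> intrinsic_dist m E D"

lemma diff_le_dist: "f \<in> D0 m E D \<Longrightarrow> continuous_on UNIV f \<Longrightarrow> ereal (f x - f y) \<le> d x y"
  unfolding intrinsic_dist_def by (rule SUP_upper) auto

lemma dist_nonneg: "0 \<le> d x y"
  using diff_le_dist[OF D0_zero continuous_on_const, of x y] by (simp add: zero_ereal_def)

lemma abs_diff_le:
  assumes f: "f \<in> D0 m E D" "continuous_on UNIV f" and "d x y \<le> ereal e"
  shows "\<bar>f x - f y\<bar> \<le> e"
proof -
  have "continuous_on UNIV (\<lambda>x. - f x)" using f(2) by (intro continuous_intros)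
  from order_trans[OF diff_le_dist[OF D0_uminus[OF f(1)] this] assms(3)]
    order_trans[OF diff_le_dist[OF f] assms(3)]
  show ?thesis by simp
qed

text \<open>The supremum in \<open>d\<close> may run over uncountably many functions, but each is
  continuous, so a ball given by a non-strict inequality is an intersection of closed sets.\<close>

lemma dist_ball_borel: "{x. d x z \<le> ereal e} \<in> sets borel"
proof -
  have "{x. d x z \<le> ereal e} = (\<Inter>f\<in>{f \<in> D0 m E D. continuous_on UNIV f}. {x. f x - f z \<le> e})"
    by (auto simp: intrinsic_dist_def SUP_le_iff)
  moreover have "closed \<dots>"
    by (intro closed_INT ballI closed_Collect_le continuous_intros) auto
  ultimately show ?thesis by (metis borel_closed)
qed

section \<open>Finite-dimensional distributions\<close>

lemma event_measurable:
  fixes t :: "nat \<Rightarrow> real"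
  assumes "0 < s" "t 0 = 0" "\<And>i. i < n \<Longrightarrow> t i < t (Suc i)" "\<And>i. i \<le> n \<Longrightarrow> B i \<in> sets borel"
  shows "{w \<in> space Q. \<forall>i\<le>n. X (s * t i) w \<in> B i} \<in> sets Q"
proof -
  have Xm: "X (s * t i) \<in> measurable Q borel" if "i \<le> n" for i
  proof -
    have "0 \<le> t i" using that
    proof (induction i)
      case (Suc i)
      then show ?case using assms(3)[of i] by simp
    qed (simp add: assms(2))
    then show ?thesis using assms(1) by (intro X_measurable) auto
  qed
  have "{w \<in> space Q. \<forall>i\<le>n. X (s * t i) w \<in> B i} = (\<Inter>i\<in>{..n}. X (s * t i) -` B i \<inter> space Q)" by auto
  also have "\<dots> \<in> sets Q"
    using Xm assms(4) by (intro sets.finite_INT measurable_sets[of _ Q borel]) auto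
  finally show ?thesis .
qed

text \<open>The times are peeled off from the last one, each step contributing
  \<open>exp (- q i)\<close> to a squared L2 norm. Only the final integral against 1 uses
  Cauchy-Schwarz, so one square root is taken and the whole exponent is halved once.\<close>

lemma chain_estimate:
  fixes t :: "nat \<Rightarrow> real"
  assumes s: "0 < s" and t0: "t 0 = 0" and t: "\<And>i. i < n \<Longrightarrow> t i < t (Suc i)"
    and B: "\<And>i. i \<le> n \<Longrightarrow> B i \<in> sets borel"
    and step: "\<And>i g. i < n \<Longrightarrow> g \<in> Bb \<Longrightarrow> (\<And>x. x \<notin> B (Suc i) \<Longrightarrow> g x = 0) \<Longrightarrow>
      ip m (\<lambda>x. indicator (B i) x * T (s * (t (Suc i) - t i)) g x)
           (\<lambda>x. indicator (B i) x * T (s * (t (Suc i) - t i)) g x) \<le> exp (- q i) * ip m g g"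
  shows "measure Q {w \<in> space Q. \<forall>i\<le>n. X (s * t i) w \<in> B i} \<le> exp (- (\<Sum>i<n. q i) / 2)"
proof -
  \<comment> \<open>At \<open>i = 0\<close> truncated subtraction gives
    \<open>t (i - 1) = t 0\<close>, so the first time step has length zero and the chain begins at
    time 0.\<close>
  define L where "L k = map (\<lambda>i. (s * (t i - t (i - 1)), indicator (B i) :: 'a \<Rightarrow> real)) [k..<Suc n]" for k
  have L_Cons: "L k = (s * (t k - t (k - 1)), indicator (B k)) # L (Suc k)" if "k \<le> n" for k
    using that unfolding L_def by (subst upt_conv_Cons) auto
  have L_end: "L (Suc n) = []" by (simp add: L_def)
  have dt: "0 \<le> t i - t (i - 1)" if "i \<le> n" for i
    using t[of "i - 1"] that by (cases i) auto
  have L_ok: "0 \<le> h \<and> f \<in> Bb" if "(h, f) \<in> set (L k)" for h f k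
    using that s dt B by (auto simp: L_def intro!: bm_indicator)
  \<comment> \<open>The chain is an L2 function; the bounded version \<open>v\<close> makes its
    product with an indicator an admissible \<open>g\<close> in the one-step hypothesis.\<close>
  have chain: "\<exists>v\<in>Bb. (AE x in m. sg_chain T (L (Suc k)) x = v x) \<and>
      ip m (\<lambda>x. indicator (B k) x * v x) (\<lambda>x. indicator (B k) x * v x) \<le> exp (- (\<Sum>i = k..<n. q i))"
    if "k \<le> n" for k
    using that
  proof (induction rule: inc_induct)
    case base
    have "ip m (\<lambda>x. indicator (B n) x * 1) (\<lambda>x. indicator (B n) x * 1) = (\<integral>x. indicator (B n) x \<partial>m)"
      unfolding ip_def by (intro Bochner_Integration.integral_cong) (auto simp: indicator_def)
    also have "\<dots> \<le> 1" using B[of n] by (simp add: sets_m)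
    finally show ?case by (intro bexI[of _ "\<lambda>_. 1"]) (auto simp: L_end)
  next
    case (step k)
    then obtain v where v: "v \<in> Bb" "AE x in m. sg_chain T (L (Suc (Suc k))) x = v x"
      "ip m (\<lambda>x. indicator (B (Suc k)) x * v x) (\<lambda>x. indicator (B (Suc k)) x * v x) \<le> exp (- (\<Sum>i = Suc k..<n. q i))"
      by auto
    let ?g = "\<lambda>x. indicator (B (Suc k)) x * v x" and ?h = "s * (t (Suc k) - t k)"
    have kn: "k < n" using step by simp
    have h: "0 \<le> ?h" using t[OF kn] s by simp
    have iB: "indicator (B (Suc k)) \<in> Bb" "indicator (B k) \<in> Bb" using B kn by (auto intro!: bm_indicator)
    have g: "?g \<in> Bb" using iB v by auto
    have gL: "?g \<in> L2 m" "T ?h ?g \<in> L2 m" by (rule bm_L2[OF g], rule T_L2[OF h bm_L2[OF g]])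
    obtain c where c: "\<And>x. \<bar>?g x\<bar> \<le> c" using bmE[OF g] by blast
    obtain v' where v': "v' \<in> Bb" "AE x in m. T ?h ?g x = v' x"
      using T_representative[OF g c h] by auto
    have cL: "sg_chain T (L (Suc (Suc k))) \<in> L2 m" using L_ok by (intro sg_chain_L2)
    have "AE x in m. indicator (B (Suc k)) x * sg_chain T (L (Suc (Suc k))) x = ?g x"
      using v(2) by eventually_elim simp
    then have "AE x in m. T ?h (\<lambda>x. indicator (B (Suc k)) x * sg_chain T (L (Suc (Suc k))) x) x = T ?h ?g x"
      by (intro T_cong L2_bm_mult[OF iB(1) cL] gL(1) h)
    with v'(2) have ae: "AE x in m. sg_chain T (L (Suc k)) x = v' x"
      using kn by (subst L_Cons) (auto elim!: AE_mp)
    have "AE x in m. indicator (B k) x * v' x = indicator (B k) x * T ?h ?g x"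
      using v'(2) by eventually_elim simp
    then have "ip m (\<lambda>x. indicator (B k) x * v' x) (\<lambda>x. indicator (B k) x * v' x) =
        ip m (\<lambda>x. indicator (B k) x * T ?h ?g x) (\<lambda>x. indicator (B k) x * T ?h ?g x)"
      by (intro ip_cong_AE L2_borel_measurable L2_bm_mult[OF iB(2)] gL bm_L2[OF v'(1)])
    also have "\<dots> \<le> exp (- q k) * ip m ?g ?g"
      using kn g by (intro assms(5)) auto
    also have "\<dots> \<le> exp (- q k) * exp (- (\<Sum>i = Suc k..<n. q i))"
      using v(3) by (intro mult_left_mono) auto
    also have "\<dots> = exp (- (\<Sum>i = k..<n. q i))"
      using kn by (simp add: sum.atLeast_Suc_lessThan flip: exp_add)
    finally show ?case using ae v'(1) by blast
  qed
  obtain v where v: "v \<in> Bb" "AE x in m. sg_chain T (L (Suc 0)) x = v x"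
    "ip m (\<lambda>x. indicator (B 0) x * v x) (\<lambda>x. indicator (B 0) x * v x) \<le> exp (- (\<Sum>i = 0..<n. q i))"
    using chain[of 0] by auto
  have iB0: "indicator (B 0) \<in> Bb" using B[of 0] by (auto intro!: bm_indicator)
  let ?g = "\<lambda>x. indicator (B 0) x * v x"
  have gB: "?g \<in> Bb" using iB0 v by auto
  have one: "(\<lambda>_. 1) \<in> L2 m" by (intro bm_L2) simp
  have cL: "sg_chain T (L (Suc 0)) \<in> L2 m" using L_ok by (intro sg_chain_L2)
  have path: "path_prod X w (s * t (k - 1)) (L k) = (if \<forall>i\<in>{k..n}. X (s * t i) w \<in> B i then 1 else 0)"
    if "k \<le> Suc n" for k w
    using that
  proof (induction rule: inc_induct)
    case (step k)
    then have "{k..n} = insert k {Suc k..n}" by auto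
    moreover have "s * t (k - 1) + s * (t k - t (k - 1)) = s * t k" by (simp add: algebra_simps)
    ultimately show ?case using step by (subst L_Cons) auto
  qed (simp add: L_end)
  define V where "V = {w \<in> space Q. \<forall>i\<le>n. X (s * t i) w \<in> B i}"
  have "V \<in> sets Q" unfolding V_def using s t0 t B by (rule event_measurable)
  then have "measure Q V = (\<integral>w. indicator V w \<partial>Q)" by simp
  also have "\<dots> = (\<integral>w. path_prod X w 0 (L 0) \<partial>Q)"
    using path[of 0] by (intro Bochner_Integration.integral_cong) (auto simp: t0 V_def indicator_def)
  also have "\<dots> = (\<integral>x. sg_chain T (L 0) x \<partial>m)" using L_ok by (intro process_formula)
  also have "\<dots> = (\<integral>x. indicator (B 0) x * sg_chain T (L (Suc 0)) x \<partial>m)"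
    using cL iB0 by (subst L_Cons) (auto intro!: integral_T L2_bm_mult)
  also have "\<dots> = ip m ?g (\<lambda>_. 1)"
  proof -
    have "AE x in m. indicator (B 0) x * sg_chain T (L (Suc 0)) x = ?g x" using v(2) by eventually_elim simp
    moreover have "(\<lambda>x. indicator (B 0) x * sg_chain T (L (Suc 0)) x) \<in> borel_measurable m" "?g \<in> borel_measurable m"
      using L2_bm_mult[OF iB0 cL] bm_L2[OF gB] by (auto intro: L2_borel_measurable)
    ultimately show ?thesis unfolding ip_def by (subst mult_1_right, intro integral_cong_AE)
  qed
  also have "\<dots> \<le> sqrt (ip m ?g ?g) * sqrt (ip m (\<lambda>_. 1) (\<lambda>_. 1))"
    using ip_abs_le[OF bm_L2[OF gB] one] by simp
  also have "\<dots> = sqrt (ip m ?g ?g)" by (simp add: ip_def m.prob_space[simplified])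
  also have "\<dots> \<le> sqrt (exp (- (\<Sum>i = 0..<n. q i)))" using v(3) by simp
  also have "\<dots> = exp (- (\<Sum>i<n. q i) / 2)"
    using exp_double[of "- (\<Sum>i<n. q i) / 2"] by (simp add: lessThan_atLeast0)
  finally show ?thesis by (simp only: V_def)
qed

text \<open>Within one tube all points at time \<open>t i\<close> are nearly indistinguishable for
  every function in \<open>D0\<close>, so a single curve in the tube provides separations valid for
  the whole tube. \<open>K\<close> counts the tubes and does not depend on \<open>s\<close>.\<close>

lemma probability_bound:
  fixes t :: "nat \<Rightarrow> real"
  assumes pre: "precompact_wrt d" and t0: "t 0 = 0" and tn: "t n = 1" and t: "\<And>i. i < n \<Longrightarrow> t i < t (Suc i)"
    and A: "\<And>i. i \<le> n \<Longrightarrow> A i \<in> sets borel"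
    and M: "ereal M < (INF \<gamma>\<in>{\<gamma>. continuous_on {0..1} \<gamma> \<and> (\<forall>i\<le>n. \<gamma> (t i) \<in> A i)}. H_energy d t n \<gamma>)"
    and \<eta>: "0 < \<eta>"
  obtains K where "0 < K"
    "\<And>s. 0 < s \<Longrightarrow> measure Q {w \<in> space Q. \<forall>i\<le>n. X (s * t i) w \<in> A i} \<le> K * exp (- (M - \<eta>) / s)"
proof -
  define \<delta> where "\<delta> i = t (Suc i) - t i" for i
  have \<delta>: "0 < \<delta> i" if "i < n" for i using t[OF that] by (simp add: \<delta>_def)
  have "(\<Sum>i<n. \<delta> i) = 1" unfolding \<delta>_def by (simp add: sum_lessThan_telescope t0 tn)
  then have \<delta>1: "\<delta> i \<le> 1" if "i < n" for i
    using member_le_sum[of i "{..<n}" \<delta>] \<delta> that by (auto intro: less_imp_le)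
  \<comment> \<open>Truncation level for distances, which may be infinite. Since \<open>R^2\<close>
    is at least \<open>2 * M\<close> and each \<open>\<delta> i\<close> is at most 1, a single step
    longer than \<open>R\<close> already provides the required energy.\<close>
  define R where "R = sqrt (2 * \<bar>M\<bar>) + 1"
  have R: "0 < R" by (simp add: R_def add_nonneg_pos)
  have "sqrt (2 * \<bar>M\<bar>) ^ 2 \<le> R\<^sup>2" unfolding R_def by (intro power_mono) auto
  then have R2: "2 * M \<le> R\<^sup>2" by simp
  define c where "c = (\<Sum>i<n. 1 / \<delta> i)"
  have c: "0 \<le> c" unfolding c_def using \<delta> by (intro sum_nonneg) (auto intro: less_imp_le)
  \<comment> \<open>The ball radius: shortening each distance by \<open>5 * e\<close> costs at most
    \<open>5 * e * R * c\<close> in energy, which is kept below \<open>\<eta>\<close>.\<close>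
  define e where "e = \<eta> / (5 * R * c + 1)"
  have den: "0 < 5 * R * c + 1" using R c by (intro add_nonneg_pos) auto
  have e: "0 < e" using \<eta> den by (simp add: e_def)
  have ec: "5 * e * R * c \<le> \<eta>"
  proof -
    have "5 * e * R * c = e * (5 * R * c)" by simp
    also have "\<dots> \<le> e * (5 * R * c + 1)" using e by (intro mult_left_mono) auto
    also have "\<dots> = \<eta>" using den by (simp add: e_def)
    finally show ?thesis .
  qed
  obtain F where F: "finite F" "\<And>x. \<exists>y\<in>F. d x y < ereal e"
    using pre e unfolding precompact_wrt_def by blast
  define B where "B \<kappa> i = A i \<inter> {x. d x (\<kappa> i) \<le> ereal e}" for \<kappa> :: "nat \<Rightarrow> 'a" and i
  have B: "B \<kappa> i \<in> sets borel" if "i \<le> n" for \<kappa> i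
    unfolding B_def using A[OF that] dist_ball_borel by auto
  have tube: "measure Q {w \<in> space Q. \<forall>i\<le>n. X (s * t i) w \<in> B \<kappa> i} \<le> exp (- (M - \<eta>) / s)"
    if s: "0 < s" for s \<kappa>
  \<comment> \<open>A tube that meets no continuous curve has an empty event, since a rescaled path
    would be such a curve. Otherwise the infimum over curves applies to a curve in the tube.\<close>
  proof (cases "\<exists>\<gamma>. continuous_on {0..1} \<gamma> \<and> (\<forall>i\<le>n. \<gamma> (t i) \<in> B \<kappa> i)")
    case False
    have "{w \<in> space Q. \<forall>i\<le>n. X (s * t i) w \<in> B \<kappa> i} = {}"
    proof (rule ccontr)
      assume "{w \<in> space Q. \<forall>i\<le>n. X (s * t i) w \<in> B \<kappa> i} \<noteq> {}"
      then obtain w where w: "w \<in> space Q" "\<forall>i\<le>n. X (s * t i) w \<in> B \<kappa> i" by auto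
      have "continuous_on {0..1} (\<lambda>u. X (s * u) w)"
        by (rule continuous_on_compose2[OF X_continuous[OF w(1)]]) (use s in \<open>auto intro!: continuous_intros\<close>)
      then show False using False w(2) by blast
    qed
    then show ?thesis by (simp only: measure_empty exp_ge_zero)
  next
    case True
    then obtain \<gamma> where \<gamma>: "continuous_on {0..1} \<gamma>" "\<And>i. i \<le> n \<Longrightarrow> \<gamma> (t i) \<in> B \<kappa> i" by blast
    have "\<gamma> \<in> {\<gamma>. continuous_on {0..1} \<gamma> \<and> (\<forall>i\<le>n. \<gamma> (t i) \<in> A i)}" using \<gamma> by (auto simp: B_def)
    then have HM: "ereal M < H_energy d t n \<gamma>" using M by (rule less_le_trans[OF _ INF_lower, rotated])
    define \<Delta> where "\<Delta> i = d (\<gamma> (t i)) (\<gamma> (t (Suc i)))" for i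
    define D' where "D' i = real_of_ereal (min (\<Delta> i) (ereal R))" for i
    have D': "ereal (D' i) = min (\<Delta> i) (ereal R)" for i
      unfolding D'_def using dist_nonneg[of "\<gamma> (t i)" "\<gamma> (t (Suc i))"] R
      by (cases "\<Delta> i") (auto simp: \<Delta>_def[symmetric] min_def)
    have D'0: "0 \<le> D' i" for i
    proof -
      have "0 \<le> min (\<Delta> i) (ereal R)" using dist_nonneg R by (simp add: \<Delta>_def)
      then show ?thesis using D'[of i] by (metis ereal_less_eq(5))
    qed
    have D'R: "D' i \<le> R" for i using D'[of i] by (metis ereal_less_eq(3) min.cobounded2)
    \<comment> \<open>The loss is \<open>e\<close> for a function that only nearly attains the
      supremum in \<open>d\<close>, and \<open>2 * e\<close> at each end for passing from the curve
      to an arbitrary point of the ball via its centre.\<close>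
    define r where "r i = max 0 (D' i - 5 * e)" for i
    have sumD: "2 * M \<le> (\<Sum>i<n. (D' i)\<^sup>2 / \<delta> i)"
    proof (cases "\<forall>i<n. \<Delta> i \<le> ereal R")
      case True
      then have \<Delta>D: "\<Delta> i = ereal (D' i)" if "i < n" for i using D'[of i] that by (simp add: min_def)
      have "(\<Sum>i<n. (\<Delta> i)\<^sup>2 * ereal (1 / \<delta> i)) = (\<Sum>i<n. ereal ((D' i)\<^sup>2 * (1 / \<delta> i)))"
        by (intro sum.cong) (auto simp: \<Delta>D)
      also have "\<dots> = ereal (\<Sum>i<n. (D' i)\<^sup>2 * (1 / \<delta> i))" by (rule sum_ereal)
      finally have "H_energy d t n \<gamma> = ereal (1 / 2 * (\<Sum>i<n. (D' i)\<^sup>2 * (1 / \<delta> i)))"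
        unfolding H_energy_def \<Delta>_def \<delta>_def by simp
      then show ?thesis using HM by simp
    next
      case False
      then obtain j where j: "j < n" "\<not> \<Delta> j \<le> ereal R" by blast
      then have "D' j = R" using D'[of j] by (simp add: min_def)
      then have "2 * M \<le> (D' j)\<^sup>2" using R2 by simp
      also have "\<dots> \<le> (D' j)\<^sup>2 / \<delta> j"
        using \<delta>[OF j(1)] \<delta>1[OF j(1)] mult_left_mono[OF \<delta>1[OF j(1)], of "(D' j)\<^sup>2"] by (simp add: field_simps)
      also have "\<dots> \<le> (\<Sum>i<n. (D' i)\<^sup>2 / \<delta> i)"
        using j \<delta> by (intro member_le_sum divide_nonneg_nonneg zero_le_power2) (auto intro: less_imp_le)
      finally show ?thesis .
    qed
    \<comment> \<open>Shortening a length of at most \<open>R\<close> by \<open>5 * e\<close> lowers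
      its square by at most \<open>10 * e * R\<close>; when the length is below
      \<open>5 * e\<close>, the left side is already nonpositive.\<close>
    have r_sq: "(D' i)\<^sup>2 - 10 * e * R \<le> (r i)\<^sup>2" for i
    proof (cases "D' i \<ge> 5 * e")
      case True
      have "(D' i)\<^sup>2 - 10 * e * R \<le> (D' i)\<^sup>2 - 10 * e * D' i"
        using D'R[of i] e by simp
      also have "\<dots> \<le> (D' i - 5 * e)\<^sup>2" by (simp add: power2_diff)
      finally show ?thesis using True by (simp add: r_def)
    next
      case False
      have "(D' i)\<^sup>2 \<le> (5 * e) * R"
        unfolding power2_eq_square using False D'0[of i] D'R[of i] e by (intro mult_mono) auto
      moreover have "0 \<le> e * R" using e R by simp
      ultimately have "(D' i)\<^sup>2 - 10 * e * R \<le> 0" by simp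
      then show ?thesis using zero_le_power2[of "r i"] by linarith
    qed
    have "2 * (M - \<eta>) \<le> (\<Sum>i<n. (D' i)\<^sup>2 / \<delta> i) - 10 * e * R * c" using sumD ec by simp
    also have "\<dots> = (\<Sum>i<n. ((D' i)\<^sup>2 - 10 * e * R) / \<delta> i)"
      by (simp add: c_def sum_distrib_left diff_divide_distrib sum_subtractf)
    also have "\<dots> \<le> (\<Sum>i<n. (r i)\<^sup>2 / \<delta> i)"
      using r_sq \<delta> by (intro sum_mono divide_right_mono) (auto intro: less_imp_le)
    finally have sumr: "2 * (M - \<eta>) \<le> (\<Sum>i<n. (r i)\<^sup>2 / \<delta> i)" .
    have close: "\<bar>f x - f (\<gamma> (t i))\<bar> \<le> 2 * e"
      if "f \<in> D0 m E D" "continuous_on UNIV f" "x \<in> B \<kappa> i" "i \<le> n" for f x i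
    proof -
      have "\<bar>f x - f (\<kappa> i)\<bar> \<le> e" "\<bar>f (\<gamma> (t i)) - f (\<kappa> i)\<bar> \<le> e"
        using that \<gamma>(2)[of i] by (auto intro!: abs_diff_le simp: B_def)
      then show ?thesis by linarith
    qed
    have "measure Q {w \<in> space Q. \<forall>i\<le>n. X (s * t i) w \<in> B \<kappa> i} \<le> exp (- (\<Sum>i<n. (r i)\<^sup>2 / (s * \<delta> i)) / 2)"
    proof (rule chain_estimate[OF s t0 t B])
      fix i :: nat and g :: "'a \<Rightarrow> real"
      assume i: "i < n" and g: "g \<in> Bb" and g0: "\<And>x. x \<notin> B \<kappa> (Suc i) \<Longrightarrow> g x = 0"
      have sd: "0 < s * (t (Suc i) - t i)" using s t[OF i] by simp
      have Bi: "B \<kappa> i \<in> sets borel" using i by (intro B) simp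
      obtain f a b where f: "f \<in> D0 m E D" "continuous_on UNIV f"
        and a: "\<And>x. x \<in> B \<kappa> i \<Longrightarrow> a \<le> f x" and b: "\<And>x. x \<in> B \<kappa> (Suc i) \<Longrightarrow> f x \<le> b" and ab: "r i \<le> a - b"
      proof (cases "D' i \<ge> 5 * e")
        case True
        have "ereal (D' i - e) < ereal (D' i)" using e by simp
        also have "\<dots> \<le> \<Delta> i" unfolding D' by simp
        finally have "ereal (D' i - e) < (SUP f\<in>{f \<in> D0 m E D. continuous_on UNIV f}. ereal (f (\<gamma> (t i)) - f (\<gamma> (t (Suc i)))))"
          unfolding \<Delta>_def intrinsic_dist_def .
        then obtain f where f: "f \<in> D0 m E D" "continuous_on UNIV f" "D' i - e < f (\<gamma> (t i)) - f (\<gamma> (t (Suc i)))"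
          unfolding less_SUP_iff by auto
        show ?thesis
        proof (rule that[OF f(1,2), of "f (\<gamma> (t i)) - 2 * e" "f (\<gamma> (t (Suc i))) + 2 * e"])
          show "f (\<gamma> (t i)) - 2 * e \<le> f x" if "x \<in> B \<kappa> i" for x
            using close[OF f(1,2) that] i by simp
          show "f x \<le> f (\<gamma> (t (Suc i))) + 2 * e" if "x \<in> B \<kappa> (Suc i)" for x
            using close[OF f(1,2) that] i by simp
          show "r i \<le> f (\<gamma> (t i)) - 2 * e - (f (\<gamma> (t (Suc i))) + 2 * e)"
            using f(3) True by (simp add: r_def)
        qed
      next
        case False
        \<comment> \<open>In this case \<open>r i = 0\<close>, so no separation is asked for and the
          zero function suffices.\<close>
        then show ?thesis using that[OF D0_zero, of 0 0] by (auto simp: r_def)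
      qed
      have "g x \<noteq> 0 \<Longrightarrow> f x \<le> b" for x using g0 b by blast
      from Gaussian_estimate[OF f g Bi a this sd _ ab]
      show "ip m (\<lambda>x. indicator (B \<kappa> i) x * T (s * (t (Suc i) - t i)) g x)
          (\<lambda>x. indicator (B \<kappa> i) x * T (s * (t (Suc i) - t i)) g x) \<le> exp (- ((r i)\<^sup>2 / (s * \<delta> i))) * ip m g g"
        by (simp add: \<delta>_def r_def)
    qed
    also have "\<dots> \<le> exp (- (M - \<eta>) / s)"
    proof -
      have "(\<Sum>i<n. (r i)\<^sup>2 / (s * \<delta> i)) = (\<Sum>i<n. (r i)\<^sup>2 / \<delta> i) / s"
        by (simp add: sum_divide_distrib mult.commute)
      moreover have "- (\<Sum>i<n. (r i)\<^sup>2 / \<delta> i) / 2 / s \<le> - (M - \<eta>) / s"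
        using sumr s by (intro divide_right_mono) auto
      ultimately show ?thesis by (simp add: mult.commute)
    qed
    finally show ?thesis .
  qed
  \<comment> \<open>Tubes are indexed by extensional choices of a centre for each time, so that
    there are finitely many.\<close>
  define I where "I = {..n} \<rightarrow>\<^sub>E F"
  have finI: "finite I" unfolding I_def using F(1) by (intro finite_PiE) auto
  show ?thesis
  proof (rule that)
    show "0 < real (card I) + 1" by simp
    fix s :: real assume s: "0 < s"
    have ev: "{w \<in> space Q. \<forall>i\<le>n. X (s * t i) w \<in> B \<kappa> i} \<in> sets Q" for \<kappa>
      using s t0 t B by (rule event_measurable)
    have "{w \<in> space Q. \<forall>i\<le>n. X (s * t i) w \<in> A i} \<subseteq> (\<Union>\<kappa>\<in>I. {w \<in> space Q. \<forall>i\<le>n. X (s * t i) w \<in> B \<kappa> i})"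
    proof
      fix w assume w: "w \<in> {w \<in> space Q. \<forall>i\<le>n. X (s * t i) w \<in> A i}"
      obtain y where y: "\<And>x. y x \<in> F" "\<And>x. d x (y x) < ereal e" using F(2) by metis
      define \<kappa> where "\<kappa> = restrict (\<lambda>i. y (X (s * t i) w)) {..n}"
      have "\<kappa> \<in> I" using y by (auto simp: I_def \<kappa>_def)
      moreover have "\<forall>i\<le>n. X (s * t i) w \<in> B \<kappa> i"
        using w y(2) by (auto simp: B_def \<kappa>_def intro: less_imp_le)
      ultimately show "w \<in> (\<Union>\<kappa>\<in>I. {w \<in> space Q. \<forall>i\<le>n. X (s * t i) w \<in> B \<kappa> i})" using w by auto
    qed
    then have "measure Q {w \<in> space Q. \<forall>i\<le>n. X (s * t i) w \<in> A i} \<le>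
        measure Q (\<Union>\<kappa>\<in>I. {w \<in> space Q. \<forall>i\<le>n. X (s * t i) w \<in> B \<kappa> i})"
      by (rule Q.finite_measure_mono[OF _ sets.finite_UN[OF finI ev]])
    also have "\<dots> \<le> (\<Sum>\<kappa>\<in>I. measure Q {w \<in> space Q. \<forall>i\<le>n. X (s * t i) w \<in> B \<kappa> i})"
      by (intro Q.finite_measure_subadditive_finite image_subsetI finI ev)
    also have "\<dots> \<le> (\<Sum>\<kappa>\<in>I. exp (- (M - \<eta>) / s))"
      by (intro sum_mono tube s)
    also have "\<dots> \<le> (real (card I) + 1) * exp (- (M - \<eta>) / s)" by (simp add: distrib_right)
    finally show "measure Q {w \<in> space Q. \<forall>i\<le>n. X (s * t i) w \<in> A i} \<le> (real (card I) + 1) * exp (- (M - \<eta>) / s)" .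
  qed
qed

end

theorem theorem4p2:
  fixes m :: "'a::polish_space measure"
    and E :: "('a \<Rightarrow> real) \<Rightarrow> ('a \<Rightarrow> real) \<Rightarrow> real"
    and D :: "('a \<Rightarrow> real) set"
    and T :: "real \<Rightarrow> ('a \<Rightarrow> real) \<Rightarrow> ('a \<Rightarrow> real)"
    and Q :: "'w measure"
    and X :: "real \<Rightarrow> 'w \<Rightarrow> 'a"
    and t :: "nat \<Rightarrow> real"
    and n :: nat
    and A :: "nat \<Rightarrow> 'a set"
  assumes "prob_space m"
    and "sets m = sets borel"
    and "precompact_wrt (intrinsic_dist m E D)"
    and "dirichlet_form m E D"
    and "strongly_local m E D"
    and "associated_semigroup m E D T"
    and "conservative m T"
    and "continuous_markov_process Q X m T"
    and "n \<ge> 1" and "t 0 = 0" and "t n = 1"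
    and "\<And>i. i < n \<Longrightarrow> t i < t (Suc i)"
    and "\<And>i. i \<le> n \<Longrightarrow> A i \<in> sets borel"
  shows "Limsup (at_right 0)
           (\<lambda>s. let p = measure Q {w \<in> space Q. \<forall>i\<le>n. X (s * t i) w \<in> A i}
                in if p = 0 then -\<infinity> else ereal (s * ln p))
         \<le> - (INF \<gamma>\<in>{\<gamma>. continuous_on {0..1} \<gamma> \<and> (\<forall>i\<le>n. \<gamma> (t i) \<in> A i)}.
                 H_energy (intrinsic_dist m E D) t n \<gamma>)"
    (is "Limsup _ ?\<psi> \<le> - ?I")
proof -
  interpret diffusion m E D T Q X
    by (intro diffusion.intro) fact+
  let ?p = "\<lambda>s. measure Q {w \<in> space Q. \<forall>i\<le>n. X (s * t i) w \<in> A i}"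
  have bound: "Limsup (at_right 0) ?\<psi> \<le> ereal (- M + \<eta>)" if M: "ereal M < ?I" and \<eta>: "0 < \<eta>" for M \<eta>
  proof (rule Limsup_bounded)
    \<comment> \<open>One half of \<open>\<eta>\<close> is spent in
      \<open>probability_bound\<close>, the other on \<open>s * ln K\<close>, which tends to
      zero.\<close>
    obtain K where K: "0 < K" "\<And>s. 0 < s \<Longrightarrow> ?p s \<le> K * exp (- (M - \<eta> / 2) / s)"
      using probability_bound[OF assms(3,10,11,12,13) M, of "\<eta> / 2"] \<eta> by auto
    have "((\<lambda>s. s * ln K) \<longlongrightarrow> 0 * ln K) (at_right 0)" by (intro tendsto_intros)
    then have "\<forall>\<^sub>F s in at_right 0. s * ln K < \<eta> / 2" using \<eta> by (intro order_tendstoD(2)) auto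
    then show "\<forall>\<^sub>F s in at_right 0. ?\<psi> s \<le> ereal (- M + \<eta>)"
      using eventually_at_right_less[of "0::real"]
    proof eventually_elim
      case (elim s)
      show ?case
      proof (cases "?p s = 0")
        case False
        then have p: "0 < ?p s" by (simp add: order_less_le)
        have "ln (?p s) \<le> ln (K * exp (- (M - \<eta> / 2) / s))"
          using K(2)[OF elim(2)] p by (subst ln_le_cancel_iff) (auto intro: less_le_trans)
        also have "\<dots> = ln K - (M - \<eta> / 2) / s" using K(1) by (simp add: ln_mult minus_divide_left)
        finally have "s * ln (?p s) \<le> s * (ln K - (M - \<eta> / 2) / s)"
          using elim(2) by (intro mult_left_mono) auto
        also have "\<dots> = s * ln K - (M - \<eta> / 2)" using elim(2) by (simp add: field_simps)
        finally show ?thesis using False elim(1) by (simp add: Let_def)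
      qed (simp add: Let_def)
    qed
  qed
  \<comment> \<open>Negation turns the claim into a lower bound, which is tested on values below the
    infimum: \<open>M\<close> stays real even when the infimum is infinite.\<close>
  have "?I \<le> - Limsup (at_right 0) ?\<psi>"
  proof (rule dense_le)
    fix x assume x: "x < ?I"
    show "x \<le> - Limsup (at_right 0) ?\<psi>"
    proof (cases x)
      case (real M)
      have "Limsup (at_right 0) ?\<psi> \<le> ereal (- M)"
      proof (rule ereal_le_epsilon2)
        fix \<eta> :: real assume "0 < \<eta>"
        then show "Limsup (at_right 0) ?\<psi> \<le> ereal (- M) + ereal \<eta>"
          using bound[of M \<eta>] x real by simp
      qed
      then have "- ereal (- M) \<le> - Limsup (at_right 0) ?\<psi>" by (simp only: ereal_minus_le_minus)
      then show ?thesis using real by (simp only: uminus_ereal.simps minus_minus)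
    qed (use x in auto)
  qed
  then have "- (- Limsup (at_right 0) ?\<psi>) \<le> - ?I" by (simp only: ereal_minus_le_minus)
  then show ?thesis by (simp only: ereal_uminus_uminus)
qed

end
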